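(* There exists a universal constant $C$ such that the following holds. Let $q$ be a prime power and let $\mathcal F \subseteq \mathbb F_q[T]$ be a set of non-zero polynomials such that $$|\mathcal F| \le q^2 + 0.4877\, q - C.$$ Then $\mathcal F$ is of loneliness at least $q^{-2}$, that is, $\delta(\mathcal F) \ge q^{-2}$.
   Context: The constant $C$ does not depend on $q$ or $\mathcal F$. $\mathbb F_q$ is the field with $q$ elements and $\mathbb F_q((T^{-1}))$ is the field of formal Laurent series $\alpha = \sum_{i=-\infty}^{n} x_i T^i$ in $T^{-1}$. For such $\alpha$, $\mathrm{ord}(\alpha)$ is the greatest $i$ with $x_i \neq 0$, and $\langle \alpha \rangle = q^{\mathrm{ord}(\alpha)}$, with $\mathrm{ord}(0) = -\infty$ and $\langle 0 \rangle = 0$. Put $\mathbb T = \{\alpha \in \mathbb F_q((T^{-1})) : \langle \alpha \rangle < 1\}$. Each $\alpha$ decomposes uniquely as $\alpha = [\alpha] + \|\alpha\|$ with $[\alpha] \in \mathbb F_q[T]$ and $\|\alpha\| \in \mathbb T$; write $|\alpha| := \langle \|\alpha\| \rangle$. The loneliness of $\mathcal F \subseteq \mathbb F_q[T] \setminus \{0\}$ is $\delta(\mathcal F) := \sup_{\alpha \in \mathbb T} \min_{f \in \mathcal F} |\alpha f|$ (a minimum over the empty set is read as $+\infty$). *)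

theory Defs
  imports
    "HOL-Algebra.UnivPoly"
    "HOL-Algebra.Weak_Morphisms"
    "HOL-Number_Theory.Prime_Powers"
    "HOL-Library.Extended_Real"
begin

text \<open>
  The finite field is an explicit structure of HOL-Algebra rather than a type of class
  \<^class>\<open>field\<close>: a universal constant must be chosen before the field, and HOL does not allow
  quantifying over types inside a formula.  The library's formal Laurent series are tied to a
  coefficient type, so the field of Laurent series in \<open>1/T\<close> is built here over such a structure.
\<close>

section \<open>Laurent series in \<open>1/T\<close>\<close>

text \<open>A series is the function taking \<open>i\<close> to the coefficient of \<open>T ^ i\<close>; the support is bounded above.\<close>

definition laurent_carrier :: "('a, 'm) ring_scheme \<Rightarrow> (int \<Rightarrow> 'a) set" where
  "laurent_carrier R =
     {\<alpha>. (\<forall>i. \<alpha> i \<in> carrier R) \<and> (\<exists>n. \<forall>i>n. \<alpha> i = \<zero>\<^bsub>R\<^esub>)}"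

text \<open>The index set of the sum in the product is finite for members of the carrier.\<close>

definition laurent :: "('a, 'm) ring_scheme \<Rightarrow> (int \<Rightarrow> 'a) ring" where
  "laurent R = \<lparr>
     carrier = laurent_carrier R,
     monoid.mult = (\<lambda>\<alpha> \<beta> k. \<Oplus>\<^bsub>R\<^esub>i \<in> {i. \<alpha> i \<noteq> \<zero>\<^bsub>R\<^esub> \<and> \<beta> (k - i) \<noteq> \<zero>\<^bsub>R\<^esub>}. \<alpha> i \<otimes>\<^bsub>R\<^esub> \<beta> (k - i)),
     one = (\<lambda>i. if i = 0 then \<one>\<^bsub>R\<^esub> else \<zero>\<^bsub>R\<^esub>),
     zero = (\<lambda>i. \<zero>\<^bsub>R\<^esub>),
     add = (\<lambda>\<alpha> \<beta> i. \<alpha> i \<oplus>\<^bsub>R\<^esub> \<beta> i)\<rparr>"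

definition poly_to_laurent :: "('a, 'm) ring_scheme \<Rightarrow> (nat \<Rightarrow> 'a) \<Rightarrow> int \<Rightarrow> 'a" where
  "poly_to_laurent R f = (\<lambda>i. if 0 \<le> i then f (nat i) else \<zero>\<^bsub>R\<^esub>)"

text \<open>Meaningful for nonzero series only; \<open>laurent_abs\<close> treats the zero series separately.\<close>

definition laurent_ord :: "('a, 'm) ring_scheme \<Rightarrow> (int \<Rightarrow> 'a) \<Rightarrow> int" where
  "laurent_ord R \<alpha> = (GREATEST i. \<alpha> i \<noteq> \<zero>\<^bsub>R\<^esub>)"

definition laurent_abs :: "('a, 'm) ring_scheme \<Rightarrow> (int \<Rightarrow> 'a) \<Rightarrow> real" where
  "laurent_abs R \<alpha> =
     (if \<alpha> = \<zero>\<^bsub>laurent R\<^esub> then 0 else real (order R) powi laurent_ord R \<alpha>)"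

definition unit_torus :: "('a, 'm) ring_scheme \<Rightarrow> (int \<Rightarrow> 'a) set" where
  "unit_torus R = {\<alpha> \<in> carrier (laurent R). laurent_abs R \<alpha> < 1}"

text \<open>
  The two parts of the decomposition of a series into a polynomial and a member of the torus;
  see \<open>laurent_decomposition\<close> and \<open>laurent_decomposition_unique\<close> below.
\<close>

definition int_part :: "(int \<Rightarrow> 'a) \<Rightarrow> nat \<Rightarrow> 'a" where
  "int_part \<alpha> = (\<lambda>n. \<alpha> (int n))"

definition frac_part :: "('a, 'm) ring_scheme \<Rightarrow> (int \<Rightarrow> 'a) \<Rightarrow> int \<Rightarrow> 'a" where
  "frac_part R \<alpha> = (\<lambda>i. if i < 0 then \<alpha> i else \<zero>\<^bsub>R\<^esub>)"

definition frac_abs :: "('a, 'm) ring_scheme \<Rightarrow> (int \<Rightarrow> 'a) \<Rightarrow> real" where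
  "frac_abs R \<alpha> = laurent_abs R (frac_part R \<alpha>)"

text \<open>
  In \<^typ>\<open>ereal\<close> the infimum over the empty set is \<open>\<infinity>\<close>, and over a finite nonempty set it is the
  minimum.
\<close>

definition loneliness :: "('a, 'm) ring_scheme \<Rightarrow> (nat \<Rightarrow> 'a) set \<Rightarrow> ereal" where
  "loneliness R F =
     (SUP \<alpha>\<in>unit_torus R. INF f\<in>F.
        ereal (frac_abs R (\<alpha> \<otimes>\<^bsub>laurent R\<^esub> poly_to_laurent R f)))"

section \<open>The decomposition into integral and fractional part\<close>

lemma laurent_abs_less_1_iff:
  assumes "\<alpha> \<in> carrier (laurent R)" and "1 < order R"
  shows "laurent_abs R \<alpha> < 1 \<longleftrightarrow> (\<forall>i\<ge>0. \<alpha> i = \<zero>\<^bsub>R\<^esub>)"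
proof (cases "\<alpha> = \<zero>\<^bsub>laurent R\<^esub>")
  case True
  then show ?thesis by (simp add: laurent_abs_def laurent_def)
next
  case False
  then obtain j where j: "\<alpha> j \<noteq> \<zero>\<^bsub>R\<^esub>" by (auto simp: laurent_def)
  obtain n where n: "\<And>i. i > n \<Longrightarrow> \<alpha> i = \<zero>\<^bsub>R\<^esub>"
    using assms by (auto simp: laurent_def laurent_carrier_def)
  define A where "A = {i. \<alpha> i \<noteq> \<zero>\<^bsub>R\<^esub> \<and> j \<le> i}"
  have fin: "finite A"
    by (rule finite_subset[of _ "{j..n}"]) (use n in \<open>auto simp: A_def not_less[symmetric]\<close>)
  have jA: "j \<in> A" by (simp add: A_def j)
  have M: "Max A \<in> A" using fin jA Max_in by blast
  have bd: "i \<le> Max A" if "\<alpha> i \<noteq> \<zero>\<^bsub>R\<^esub>" for i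
  proof (cases "j \<le> i")
    case True then show ?thesis using that fin by (intro Max_ge) (auto simp: A_def)
  next
    case False then show ?thesis using Max_ge[OF fin jA] by linarith
  qed
  have ord: "laurent_ord R \<alpha> = Max A"
    unfolding laurent_ord_def by (rule Greatest_equality) (use M bd in \<open>auto simp: A_def\<close>)
  have "laurent_abs R \<alpha> < 1 \<longleftrightarrow> Max A < 0"
  proof -
    have q: "1 < real (order R)" using assms by simp
    have "1 \<le> real (order R) powi Max A" if "0 \<le> Max A"
      using that q by (simp add: power_int_def)
    moreover have "real (order R) powi Max A < 1" if "Max A < 0"
      using that q by (simp add: power_int_def power_less_one_iff inverse_less_1_iff)
    ultimately show ?thesis
      using False by (force simp: laurent_abs_def ord)
  qed
  also have "\<dots> \<longleftrightarrow> (\<forall>i\<ge>0. \<alpha> i = \<zero>\<^bsub>R\<^esub>)"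
    using M bd by (force simp: A_def not_less[symmetric])
  finally show ?thesis .
qed

lemma poly_to_laurent_carrier:
  assumes "ring R" and "f \<in> carrier (UP R)"
  shows "poly_to_laurent R f \<in> carrier (laurent R)"
proof -
  interpret ring R by fact
  obtain n where "bound \<zero>\<^bsub>R\<^esub> n f" using assms by (auto simp: UP_def up_def)
  then have "\<forall>i>int n. poly_to_laurent R f i = \<zero>\<^bsub>R\<^esub>"
    by (auto simp: poly_to_laurent_def bound_def)
  moreover have "\<forall>i. poly_to_laurent R f i \<in> carrier R"
    using assms by (auto simp: poly_to_laurent_def UP_def)
  ultimately show ?thesis by (auto simp: laurent_def laurent_carrier_def)
qed

lemma laurent_decomposition:
  assumes "ring R" and "1 < order R" and a: "\<alpha> \<in> carrier (laurent R)"
  shows "int_part \<alpha> \<in> carrier (UP R)" and "frac_part R \<alpha> \<in> unit_torus R"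
    and "\<alpha> = poly_to_laurent R (int_part \<alpha>) \<oplus>\<^bsub>laurent R\<^esub> frac_part R \<alpha>"
proof -
  interpret ring R by fact
  obtain n where n: "\<And>i. i > n \<Longrightarrow> \<alpha> i = \<zero>\<^bsub>R\<^esub>"
    using a by (auto simp: laurent_def laurent_carrier_def)
  have c: "\<And>i. \<alpha> i \<in> carrier R" using a by (auto simp: laurent_def laurent_carrier_def)
  have "bound \<zero>\<^bsub>R\<^esub> (nat n) (int_part \<alpha>)" using n by (auto simp: bound_def int_part_def)
  then show "int_part \<alpha> \<in> carrier (UP R)" using c by (auto simp: UP_def up_def int_part_def)
  have "frac_part R \<alpha> \<in> carrier (laurent R)"
    using c n by (auto simp: laurent_def laurent_carrier_def frac_part_def)
  with assms(2) show "frac_part R \<alpha> \<in> unit_torus R"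
    by (simp add: unit_torus_def laurent_abs_less_1_iff) (simp add: frac_part_def)
  show "\<alpha> = poly_to_laurent R (int_part \<alpha>) \<oplus>\<^bsub>laurent R\<^esub> frac_part R \<alpha>"
    using c by (auto simp: laurent_def poly_to_laurent_def int_part_def frac_part_def)
qed

lemma laurent_decomposition_unique:
  assumes "ring R" and "1 < order R" and g: "g \<in> carrier (UP R)" and b: "\<beta> \<in> unit_torus R"
    and eq: "\<alpha> = poly_to_laurent R g \<oplus>\<^bsub>laurent R\<^esub> \<beta>"
  shows "g = int_part \<alpha>" and "\<beta> = frac_part R \<alpha>"
proof -
  interpret ring R by fact
  have z: "\<forall>i\<ge>0. \<beta> i = \<zero>\<^bsub>R\<^esub>" and c: "\<And>i. \<beta> i \<in> carrier R"
    using b assms(2) laurent_abs_less_1_iff[of \<beta> R]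
    by (auto simp: unit_torus_def laurent_def laurent_carrier_def)
  have gc: "\<And>i. g i \<in> carrier R" using g by (auto simp: UP_def)
  show "g = int_part \<alpha>" "\<beta> = frac_part R \<alpha>"
    using z c gc
    by (auto simp: eq laurent_def poly_to_laurent_def int_part_def frac_part_def fun_eq_iff)
qed

section \<open>Every finite field is covered by the carriers inside \<^typ>\<open>nat\<close>\<close>

text \<open>
  The loneliness is invariant under isomorphism of the coefficient field, and every finite field is
  isomorphic to one whose elements are natural numbers.  A statement about all fields of type
  \<open>nat ring\<close> is thus one about all finite fields.
\<close>

lemma loneliness_iso:
  assumes R: "ring R" and S: "ring S" and h: "h \<in> ring_iso R S" and F: "F \<subseteq> carrier (UP R)"
  shows "loneliness S ((\<lambda>f. h \<circ> f) ` F) = loneliness R F"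
proof -
  interpret R: ring R by fact
  interpret S: ring S by fact
  have hom: "h \<in> ring_hom R S" and bij: "bij_betw h (carrier R) (carrier S)"
    using h by (auto simp: ring_iso_def)
  interpret H: ring_hom_ring R S h
    using hom R S by (simp add: ring_hom_ringI2)
  have inj: "inj_on h (carrier R)" using bij by (simp add: bij_betw_def)
  have h0: "h x = \<zero>\<^bsub>S\<^esub> \<longleftrightarrow> x = \<zero>\<^bsub>R\<^esub>" if "x \<in> carrier R" for x
    using inj_onD[OF inj _ that R.zero_closed] by auto
  have ordq: "order S = order R"
    using bij_betw_same_card[OF bij] by (simp add: order_def)
  have abs: "laurent_abs S (h \<circ> \<alpha>) = laurent_abs R \<alpha>" if "\<And>i. \<alpha> i \<in> carrier R" for \<alpha> :: "int \<Rightarrow> _"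
    using that h0 by (simp add: laurent_abs_def laurent_ord_def laurent_def ordq fun_eq_iff)
  have fabs: "frac_abs S (h \<circ> \<alpha>) = frac_abs R \<alpha>" if "\<And>i. \<alpha> i \<in> carrier R" for \<alpha> :: "int \<Rightarrow> _"
  proof -
    have "frac_part S (h \<circ> \<alpha>) = h \<circ> frac_part R \<alpha>" by (auto simp: frac_part_def)
    moreover have "\<And>i. frac_part R \<alpha> i \<in> carrier R" using that by (auto simp: frac_part_def)
    ultimately show ?thesis using abs by (simp add: frac_abs_def)
  qed
  have mult: "(h \<circ> \<alpha>) \<otimes>\<^bsub>laurent S\<^esub> (h \<circ> \<beta>) = h \<circ> (\<alpha> \<otimes>\<^bsub>laurent R\<^esub> \<beta>)"
    if a: "\<And>i. \<alpha> i \<in> carrier R" and b: "\<And>i. \<beta> i \<in> carrier R" for \<alpha> \<beta> :: "int \<Rightarrow> _"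
  proof
    fix k
    let ?A = "{i. \<alpha> i \<noteq> \<zero>\<^bsub>R\<^esub> \<and> \<beta> (k - i) \<noteq> \<zero>\<^bsub>R\<^esub>}"
    have "h (\<Oplus>\<^bsub>R\<^esub>i\<in>?A. \<alpha> i \<otimes>\<^bsub>R\<^esub> \<beta> (k - i)) = (\<Oplus>\<^bsub>S\<^esub>i\<in>?A. h (\<alpha> i) \<otimes>\<^bsub>S\<^esub> h (\<beta> (k - i)))"
      using a b by (subst H.hom_finsum) (auto simp: o_def)
    then show "((h \<circ> \<alpha>) \<otimes>\<^bsub>laurent S\<^esub> (h \<circ> \<beta>)) k = (h \<circ> (\<alpha> \<otimes>\<^bsub>laurent R\<^esub> \<beta>)) k"
      using a b by (simp add: laurent_def h0)
  qed
  have multc: "(\<alpha> \<otimes>\<^bsub>laurent R\<^esub> \<beta>) k \<in> carrier R"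
    if a: "\<And>i. \<alpha> i \<in> carrier R" and b: "\<And>i. \<beta> i \<in> carrier R" for \<alpha> \<beta> :: "int \<Rightarrow> _" and k
    using a b by (simp add: laurent_def)
  have mem_torus: "\<beta> \<in> unit_torus Q \<longleftrightarrow>
      (\<forall>i. \<beta> i \<in> carrier Q) \<and> (\<exists>n. \<forall>i>n. \<beta> i = \<zero>\<^bsub>Q\<^esub>) \<and> laurent_abs Q \<beta> < 1"
    for \<beta> and Q :: "('x, 'y) ring_scheme"
    by (simp add: unit_torus_def laurent_def laurent_carrier_def conj_assoc)
  have torus: "unit_torus S = (\<lambda>\<alpha>. h \<circ> \<alpha>) ` unit_torus R"
  proof (intro equalityI subsetI)
    fix \<beta> assume "\<beta> \<in> (\<lambda>\<alpha>. h \<circ> \<alpha>) ` unit_torus R"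
    then obtain \<alpha> where \<alpha>: "\<alpha> \<in> unit_torus R" "\<beta> = h \<circ> \<alpha>" by blast
    have c: "\<And>i. \<alpha> i \<in> carrier R" and l: "laurent_abs R \<alpha> < 1"
      using \<alpha> by (auto simp: unit_torus_def laurent_def laurent_carrier_def)
    obtain n where "\<forall>i>n. \<alpha> i = \<zero>\<^bsub>R\<^esub>"
      using \<alpha> by (auto simp: unit_torus_def laurent_def laurent_carrier_def)
    then have "\<forall>i>n. (h \<circ> \<alpha>) i = \<zero>\<^bsub>S\<^esub>" by simp
    then show "\<beta> \<in> unit_torus S"
      using c l abs[of \<alpha>, OF c] unfolding \<alpha>(2) mem_torus by (metis H.hom_closed comp_apply)
  next
    fix \<beta> assume \<beta>: "\<beta> \<in> unit_torus S"
    have c: "\<And>i. \<beta> i \<in> carrier S" and l: "laurent_abs S \<beta> < 1"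
      using \<beta> by (auto simp: unit_torus_def laurent_def laurent_carrier_def)
    obtain n where n: "\<And>i. i > n \<Longrightarrow> \<beta> i = \<zero>\<^bsub>S\<^esub>"
      using \<beta> by (auto simp: unit_torus_def laurent_def laurent_carrier_def)
    define \<alpha> where "\<alpha> = inv_into (carrier R) h \<circ> \<beta>"
    have ac: "\<alpha> i \<in> carrier R" for i
      using c[of i] bij by (auto simp: \<alpha>_def bij_betw_def intro: inv_into_into)
    have ha: "h \<circ> \<alpha> = \<beta>"
      using c bij by (auto simp: \<alpha>_def bij_betw_def f_inv_into_f fun_eq_iff)
    have "\<alpha> i = \<zero>\<^bsub>R\<^esub>" if "i > n" for i
      using n[OF that] h0[OF ac[of i]] fun_cong[OF ha, of i] by simp
    then have "\<alpha> \<in> unit_torus R"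
      using ac l abs[of \<alpha>, OF ac] unfolding ha mem_torus by metis
    then show "\<beta> \<in> (\<lambda>\<alpha>. h \<circ> \<alpha>) ` unit_torus R" using ha by blast
  qed
  have "frac_abs S ((h \<circ> \<alpha>) \<otimes>\<^bsub>laurent S\<^esub> poly_to_laurent S (h \<circ> f))
      = frac_abs R (\<alpha> \<otimes>\<^bsub>laurent R\<^esub> poly_to_laurent R f)"
    if \<alpha>: "\<alpha> \<in> unit_torus R" and f: "f \<in> F" for \<alpha> f
  proof -
    have ac: "\<And>i. \<alpha> i \<in> carrier R"
      using \<alpha> by (auto simp: unit_torus_def laurent_def laurent_carrier_def)
    have fc: "\<And>i. poly_to_laurent R f i \<in> carrier R"
      using poly_to_laurent_carrier[OF R, of f] f F by (auto simp: laurent_def laurent_carrier_def)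
    have "poly_to_laurent S (h \<circ> f) = h \<circ> poly_to_laurent R f"
      by (auto simp: poly_to_laurent_def)
    then show ?thesis using mult[OF ac fc] fabs[OF multc[OF ac fc]] by simp
  qed
  then show ?thesis
    unfolding loneliness_def torus image_image by (intro SUP_cong INF_cong refl) simp
qed

lemma finite_field_iso_nat:
  fixes R :: "'a ring"
  assumes "Ring.field R" and fin: "finite (carrier R)"
  shows "\<exists>(S :: nat ring) h. Ring.field S \<and> h \<in> ring_iso R S"
proof -
  interpret field R by fact
  obtain h :: "'a \<Rightarrow> nat" where inj: "inj_on h (carrier R)"
    using finite_imp_inj_to_nat_seg[OF fin] by blast
  show ?thesis
    using inj_imp_image_ring_is_field[OF inj] inj_imp_image_ring_iso[OF inj]
    by (intro exI[of _ "image_ring h R"] exI[of _ h] conjI)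
qed

end

theory Submission
  imports Defs "HOL-Algebra.Embedded_Algebras"
begin

text \<open>
  Suppose that the loneliness is less than \<open>q^-2\<close>.  For \<open>\<alpha>\<close> in the torus, \<open>|\<alpha> f| < q^-2\<close> says that the
  coefficients of \<open>T^-1\<close> and \<open>T^-2\<close> in \<open>\<alpha> f\<close> vanish, that is, that the linear functional on polynomials
  which \<open>\<alpha>\<close> defines vanishes on the line spanned by \<open>f\<close> and \<open>T f\<close>.  So \<open>F\<close>, taken up to constant
  factors, is a covering: every functional kills (vanishes on) one of these lines.  A line is
  killed with probability \<open>q^-2\<close>, so \<open>F\<close> has at least \<open>q^2\<close> points, and if it has at most
  \<open>q^2 + 0.4877 q\<close> points, the expected number of killed lines exceeds \<open>1\<close> by at most \<open>0.4877 / q\<close>.  It is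
  enough to refute this for large \<open>q\<close> (\<open>card_F_gt\<close>); the constant takes care of the small ones.

  As \<open>2 * 0.4877 < 1\<close>, for a positive proportion of \<open>f\<close> in \<open>F\<close>, called good, a functional that kills
  \<open>f\<close> kills another member of \<open>F\<close> with probability less than \<open>0.99 / q\<close> (\<open>card_good\<close>).  The line of a good
  \<open>f\<close> meets the line of no other member of \<open>F\<close> (\<open>good_skew\<close>), and by a second moment estimate the lines of \<open>F\<close> span, together
  with the line of \<open>f\<close>, only \<open>O(q)\<close> different spaces of dimension four, called joins (\<open>class_bound\<close>).
  The points \<open>g\<close> of one join lie on a projective line through \<open>f\<close>, unless \<open>f\<close> and \<open>g\<close> are quadratically
  related, meaning that \<open>f / g\<close> is a quotient of polynomials of degree at most two; in that case they
  lie in a plane \<open>{h r | deg r \<le> 2}\<close> (\<open>join_class_not_quad\<close>, \<open>join_class_quad\<close>).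

  A three-dimensional space \<open>U\<close> of polynomials has \<open>q^2 + q + 1\<close> points, and most functionals that kill one
  of them kill no other.  If \<open>F\<close> misses \<open>m > 0\<close> of these points, fewer than \<open>m\<close> points of \<open>F\<close> outside
  \<open>U\<close> have to take care of the functionals concerned, although each of them is killed together
  with a missing point in a proportion of about \<open>m / q^2\<close> of the cases only.  This forces \<open>m\<close> to be close
  to \<open>q^2\<close>, so that \<open>F\<close> has only \<open>O(q)\<close> points in \<open>U\<close> (\<open>plane_bound\<close>).

  Now take two good points \<open>f0\<close> and \<open>f1\<close>.  The points that are quadratically related to neither of them are
  determined by their two joins, and organised by the planes through \<open>f0\<close> and \<open>f1\<close>; since each plane
  has \<open>O(q)\<close> points and there are \<open>O(q)\<close> joins, there are only \<open>o(q^2)\<close> such points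
  (\<open>card_neither_quad_related\<close>).  If \<open>f0\<close> and \<open>f1\<close> are quadratically related, divisibility
  of quadratics shows that only \<open>O(q)\<close> good points are quadratically related to both
  (\<open>card_both_quad_related\<close>).  As the good points are a positive proportion of \<open>q^2\<close>, a pigeonhole argument
  on the relation yields a contradiction.
\<close>

section \<open>Normalising equations in a commutative ring\<close>

context cring
begin

lemma add_minus_left: "\<lbrakk>a \<in> carrier R; b \<in> carrier R; c \<in> carrier R\<rbrakk> \<Longrightarrow> (a \<ominus> b) \<oplus> c = (a \<oplus> c) \<ominus> b"
  by (simp add: a_minus_def a_ac)

lemma add_minus_right: "\<lbrakk>a \<in> carrier R; b \<in> carrier R; c \<in> carrier R\<rbrakk> \<Longrightarrow> a \<oplus> (b \<ominus> c) = (a \<oplus> b) \<ominus> c"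
  by (simp add: a_minus_def a_ac)

lemma minus_minus_left: "\<lbrakk>a \<in> carrier R; b \<in> carrier R; c \<in> carrier R\<rbrakk> \<Longrightarrow> (a \<ominus> b) \<ominus> c = a \<ominus> (b \<oplus> c)"
  by (simp add: a_minus_def a_ac minus_add)

lemma minus_minus_right: "\<lbrakk>a \<in> carrier R; b \<in> carrier R; c \<in> carrier R\<rbrakk> \<Longrightarrow> a \<ominus> (b \<ominus> c) = (a \<oplus> c) \<ominus> b"
  by (simp add: a_minus_def a_ac minus_add)

lemma add_uminus_right: "a \<oplus> (\<ominus> b) = a \<ominus> b"
  by (simp add: a_minus_def)

lemma add_uminus_left: "\<lbrakk>a \<in> carrier R; b \<in> carrier R\<rbrakk> \<Longrightarrow> \<ominus> a \<oplus> b = b \<ominus> a"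
  by (simp add: a_minus_def a_comm)

lemma minus_uminus: "\<lbrakk>a \<in> carrier R; b \<in> carrier R\<rbrakk> \<Longrightarrow> a \<ominus> (\<ominus> b) = a \<oplus> b"
  by (simp add: a_minus_def)

lemma uminus_diff: "\<lbrakk>a \<in> carrier R; b \<in> carrier R\<rbrakk> \<Longrightarrow> \<ominus> (a \<ominus> b) = b \<ominus> a"
  by (simp add: a_minus_def minus_add a_comm)

lemma minus_l_distr: "\<lbrakk>a \<in> carrier R; b \<in> carrier R; c \<in> carrier R\<rbrakk> \<Longrightarrow> (a \<ominus> b) \<otimes> c = a \<otimes> c \<ominus> b \<otimes> c"
  by (simp add: a_minus_def l_distr l_minus)

lemma minus_r_distr: "\<lbrakk>a \<in> carrier R; b \<in> carrier R; c \<in> carrier R\<rbrakk> \<Longrightarrow> c \<otimes> (a \<ominus> b) = c \<otimes> a \<ominus> c \<otimes> b"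
  by (simp add: a_minus_def r_distr r_minus)

lemma minus_eq_iff: assumes "a \<in> carrier R" "b \<in> carrier R" "c \<in> carrier R"
  shows "a \<ominus> b = c \<longleftrightarrow> a = c \<oplus> b"
proof
  assume "a \<ominus> b = c"
  then show "a = c \<oplus> b" using assms by (auto simp: a_minus_def a_assoc l_neg)
qed (use assms in \<open>simp add: a_minus_def a_assoc r_neg\<close>)

lemma eq_minus_iff: "\<lbrakk>a \<in> carrier R; b \<in> carrier R; c \<in> carrier R\<rbrakk> \<Longrightarrow> c = a \<ominus> b \<longleftrightarrow> c \<oplus> b = a"
  using minus_eq_iff[of a b c] by auto

text \<open>
  Rewriting to a difference of two sums of monomials and then moving subtracted terms across the
  equation proves polynomial identities between elements that the simplifier knows to be in the carrier.
\<close>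

lemmas ring_nf =
  l_distr r_distr m_ac a_ac l_minus r_minus
  add_minus_left add_minus_right minus_minus_left minus_minus_right
  add_uminus_right add_uminus_left minus_uminus uminus_diff minus_l_distr minus_r_distr
  minus_eq_iff eq_minus_iff

end

section \<open>Polynomials of bounded degree over a finite subfield\<close>

text \<open>
  A polynomial ring seen from inside: a domain \<open>E\<close> with a finite subfield \<open>K\<close> of constants
  and an element \<open>T\<close>.  Generation of \<open>E\<close> by \<open>T\<close> is not needed, only that \<open>T\<close> is
  nonzero and divides no nonzero constant.  Constants being ring elements, scalar multiplication is ring
  multiplication and the notions of span, independence and dimension over a subfield apply.
\<close>

locale poly_domain = domain E for E (structure) +
  fixes K :: "'a set" and T :: 'a
  assumes K: "subfield K E" and finite_K: "finite K" and T_closed [simp]: "T \<in> carrier E"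
    and T_nonzero [simp]: "T \<noteq> \<zero>"
    and T_not_unit: "\<lbrakk>a \<in> K; x \<in> carrier E; a \<oplus> T \<otimes> x = \<zero>\<rbrakk> \<Longrightarrow> a = \<zero>"
begin

lemmas K_props [simp] = subringE[OF subfieldE(1)[OF K]]

lemma K_carrier [simp]: "a \<in> K \<Longrightarrow> a \<in> carrier E"
  using K_props(1) by blast

lemma K_minus [simp]: "\<lbrakk>a \<in> K; b \<in> K\<rbrakk> \<Longrightarrow> a \<ominus> b \<in> K"
  by (simp add: a_minus_def)

lemma K_inv: assumes "c \<in> K" "c \<noteq> \<zero>" obtains d where "d \<in> K" "d \<noteq> \<zero>" "d \<otimes> c = \<one>"
  using subfield_m_inv[OF K, of c] assms by auto

abbreviation q :: nat where "q \<equiv> card K"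

lemma q_ge_2: "2 \<le> q"
proof -
  have "card {\<zero>, \<one>} \<le> q" by (intro card_mono) (auto simp: finite_K)
  then show ?thesis by simp
qed

text \<open>
  \<open>P n\<close> is the space of polynomials of degree at most \<open>n\<close> in \<open>T\<close>, in Horner form.
\<close>

primrec P :: "nat \<Rightarrow> 'a set" where
  "P 0 = K"
| "P (Suc n) = {a \<oplus> T \<otimes> x | a x. a \<in> K \<and> x \<in> P n}"

lemma P_carrier [simp]: "x \<in> P n \<Longrightarrow> x \<in> carrier E"
  by (induction n arbitrary: x) auto

lemma P_SucI: "\<lbrakk>a \<in> K; x \<in> P n\<rbrakk> \<Longrightarrow> a \<oplus> T \<otimes> x \<in> P (Suc n)"
  by auto

lemma P_add [simp]: "\<lbrakk>x \<in> P n; y \<in> P n\<rbrakk> \<Longrightarrow> x \<oplus> y \<in> P n"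
proof (induction n arbitrary: x y)
  case (Suc n)
  then obtain a b x' y' where *: "a \<in> K" "b \<in> K" "x' \<in> P n" "y' \<in> P n" "x = a \<oplus> T \<otimes> x'" "y = b \<oplus> T \<otimes> y'"
    by auto
  have [simp]: "a \<in> carrier E" "b \<in> carrier E" "x' \<in> carrier E" "y' \<in> carrier E" using * by auto
  have "x \<oplus> y = (a \<oplus> b) \<oplus> T \<otimes> (x' \<oplus> y')" unfolding * by (simp add: ring_nf)
  also have "\<dots> \<in> P (Suc n)" using Suc.IH[of x' y'] * by (intro P_SucI) auto
  finally show ?case .
qed simp

lemma P_smult [simp]: "\<lbrakk>c \<in> K; x \<in> P n\<rbrakk> \<Longrightarrow> c \<otimes> x \<in> P n"
proof (induction n arbitrary: x)
  case (Suc n)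
  then obtain a x' where *: "c \<in> K" "a \<in> K" "x' \<in> P n" "x = a \<oplus> T \<otimes> x'" by auto
  have [simp]: "c \<in> carrier E" "a \<in> carrier E" "x' \<in> carrier E" using * by auto
  have "c \<otimes> x = (c \<otimes> a) \<oplus> T \<otimes> (c \<otimes> x')" unfolding * by (simp add: ring_nf)
  also have "\<dots> \<in> P (Suc n)" using Suc.IH[of x'] * by (intro P_SucI) auto
  finally show ?case .
qed simp

lemma P_zero [simp]: "\<zero> \<in> P n"
proof (induction n)
  case (Suc n)
  then show ?case using P_SucI[of \<zero> \<zero> n] by simp
qed simp

lemma P_neg [simp]: "x \<in> P n \<Longrightarrow> \<ominus> x \<in> P n"
  using P_smult[of "\<ominus> \<one>" x n] by (simp add: l_minus)

lemma P_minus [simp]: "\<lbrakk>x \<in> P n; y \<in> P n\<rbrakk> \<Longrightarrow> x \<ominus> y \<in> P n"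
  by (simp add: a_minus_def)

lemma P_T [simp]: "x \<in> P n \<Longrightarrow> T \<otimes> x \<in> P (Suc n)"
  using P_SucI[of \<zero> x n] by simp

lemma P_Suc_mono: "x \<in> P n \<Longrightarrow> x \<in> P (Suc n)"
proof (induction n arbitrary: x)
  case 0
  then show ?case using P_SucI[of x \<zero> 0] by simp
next
  case (Suc n)
  then obtain a x' where *: "a \<in> K" "x' \<in> P n" "x = a \<oplus> T \<otimes> x'" by auto
  show ?case unfolding *(3) by (rule P_SucI[OF *(1) Suc.IH[OF *(2)]])
qed

lemma P_mono: "\<lbrakk>x \<in> P m; m \<le> n\<rbrakk> \<Longrightarrow> x \<in> P n"
  by (induction n) (auto simp del: P.simps(2) simp: P_Suc_mono le_Suc_eq)

lemma P_Suc_E: assumes "x \<in> P (Suc n)" obtains a y where "a \<in> K" "y \<in> P n" "x = a \<oplus> T \<otimes> y"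
  using assms by auto

declare P.simps(2) [simp del]

lemma K_P [simp]: "a \<in> K \<Longrightarrow> a \<in> P n"
  using P_mono[of a 0 n] by simp

lemma P_T_cancel: assumes "x \<in> carrier E" "T \<otimes> x \<in> P (Suc n)" shows "x \<in> P n"
proof -
  obtain a y where *: "a \<in> K" "y \<in> P n" "T \<otimes> x = a \<oplus> T \<otimes> y" using assms(2) by (rule P_Suc_E)
  have [simp]: "x \<in> carrier E" "a \<in> carrier E" "y \<in> carrier E" using assms * by auto
  have 0: "a \<oplus> T \<otimes> (y \<ominus> x) = \<zero>"
  proof -
    have "a \<oplus> T \<otimes> (y \<ominus> x) = (a \<oplus> T \<otimes> y) \<ominus> T \<otimes> x" by (simp add: ring_nf)
    then show ?thesis unfolding *(3)[symmetric] by simp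
  qed
  have "a = \<zero>" by (rule T_not_unit[OF *(1) _ 0]) simp
  then have "T \<otimes> x = T \<otimes> y" using * by simp
  then have "x = y" using m_lcancel[of T x y] by simp
  then show ?thesis using * by simp
qed

lemma P_T_cancel_0: assumes "x \<in> carrier E" "T \<otimes> x \<in> K" shows "x = \<zero>"
proof -
  have "\<ominus> (T \<otimes> x) \<in> K" using assms by simp
  moreover have "\<ominus> (T \<otimes> x) \<oplus> T \<otimes> x = \<zero>" using assms by (simp add: l_neg)
  ultimately have "\<ominus> (T \<otimes> x) = \<zero>" using T_not_unit assms(1) by blast
  then have "T \<otimes> x = \<zero>" using assms by (metis T_closed m_closed minus_minus minus_zero)
  then show ?thesis using integral[of T x] assms by simp
qed

lemma P_mult [simp]: "\<lbrakk>x \<in> P m; y \<in> P n\<rbrakk> \<Longrightarrow> x \<otimes> y \<in> P (m + n)"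
proof (induction m arbitrary: x)
  case (Suc m)
  then obtain a x' where *: "a \<in> K" "x' \<in> P m" "x = a \<oplus> T \<otimes> x'" "y \<in> P n" by (auto elim: P_Suc_E)
  have [simp]: "a \<in> carrier E" "x' \<in> carrier E" "y \<in> carrier E" using * by auto
  have "x \<otimes> y = (a \<otimes> y) \<oplus> T \<otimes> (x' \<otimes> y)" unfolding * by (simp add: ring_nf)
  moreover have "a \<otimes> y \<in> P (Suc (m + n))" using P_mono[of "a \<otimes> y" n "Suc (m + n)"] * by simp
  moreover have "T \<otimes> (x' \<otimes> y) \<in> P (Suc (m + n))" using Suc.IH[of x'] * by simp
  ultimately show ?case using P_add by simp
qed simp

lemma P1_E: assumes "x \<in> P 1" obtains a b where "a \<in> K" "b \<in> K" "x = a \<oplus> T \<otimes> b"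
  using assms P_Suc_E[of x 0] by auto

lemma P1_I [intro]: "\<lbrakk>a \<in> K; b \<in> K\<rbrakk> \<Longrightarrow> a \<oplus> T \<otimes> b \<in> P 1"
  using P_SucI[of a b 0] by simp

lemma T_P1 [simp]: "T \<in> P 1" "T \<in> P (Suc 0)"
  using P_T[of \<one> 0] by simp_all

lemma Span_Cons: "x \<in> Span K (u # Us) \<longleftrightarrow> (\<exists>k\<in>K. \<exists>v\<in>Span K Us. x = k \<otimes> u \<oplus> v)"
  by (simp add: line_extension_mem_iff)

lemma Span_Nil: "Span K [] = {\<zero>}"
  by simp

declare Span.simps [simp del]

lemma Span_1: assumes "a \<in> carrier E" shows "x \<in> Span K [a] \<longleftrightarrow> (\<exists>k\<in>K. x = k \<otimes> a)"
  using assms by (simp add: Span_Cons Span_Nil)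

lemma Span_2: assumes "a \<in> carrier E" "b \<in> carrier E"
  shows "x \<in> Span K [a, b] \<longleftrightarrow> (\<exists>k\<in>K. \<exists>l\<in>K. x = k \<otimes> a \<oplus> l \<otimes> b)"
  unfolding Span_Cons[of x a "[b]"] Bex_def[of "Span K [b]"] Span_1[OF assms(2)] by blast

lemma Span_3: assumes "a \<in> carrier E" "b \<in> carrier E" "c \<in> carrier E"
  shows "x \<in> Span K [a, b, c] \<longleftrightarrow> (\<exists>k\<in>K. \<exists>l\<in>K. \<exists>m\<in>K. x = k \<otimes> a \<oplus> (l \<otimes> b \<oplus> m \<otimes> c))"
  unfolding Span_Cons[of x a "[b, c]"] Bex_def[of "Span K [b, c]"] Span_2[OF assms(2,3)] by blast

lemma Span_4: assumes "a \<in> carrier E" "b \<in> carrier E" "c \<in> carrier E" "d \<in> carrier E"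
  shows "x \<in> Span K [a, b, c, d] \<longleftrightarrow>
    (\<exists>k\<in>K. \<exists>l\<in>K. \<exists>m\<in>K. \<exists>n\<in>K. x = k \<otimes> a \<oplus> (l \<otimes> b \<oplus> (m \<otimes> c \<oplus> n \<otimes> d)))"
  unfolding Span_Cons[of x a "[b, c, d]"] Bex_def[of "Span K [b, c, d]"] Span_3[OF assms(2-4)] by blast

lemma independent_Cons_iff: "independent K (u # Us) \<longleftrightarrow> u \<in> carrier E \<and> u \<notin> Span K Us \<and> independent K Us"
  using independent_backwards li_Cons by blast

lemma dimension_P: "dimension (Suc n) K (P n)"
proof (induction n)
  case 0 then show ?case using dimension_one[OF K] by simp
next
  case (Suc n)
  have *: "P (Suc n) = line_extension K \<one> ((\<lambda>x. T \<otimes> x) ` P n)"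
    by (auto simp: line_extension_mem_iff set_eq_iff P.simps(2))
  obtain Us where Us: "independent K Us" "length Us = Suc n" "Span K Us = P n"
    using exists_base[OF K Suc] by blast
  have ind: "independent K (map (\<lambda>x. T \<otimes> x) Us) \<and> Span K (map (\<lambda>x. T \<otimes> x) Us) = (\<lambda>x. T \<otimes> x) ` Span K Us"
    if "independent K Us" for Us
    using that
  proof (induction Us rule: list.induct)
    case Nil then show ?case by (simp add: Span_Nil)
  next
    case (Cons u Us)
    have u: "u \<in> carrier E" "u \<notin> Span K Us" "independent K Us"
      using Cons.prems by (auto simp: independent_Cons_iff)
    have Sc: "Span K Us \<subseteq> carrier E"
      using Span_subgroup_props(1)[OF K independent_in_carrier[OF u(3)]] .
    have "T \<otimes> u \<notin> (\<lambda>x. T \<otimes> x) ` Span K Us"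
    proof
      assume "T \<otimes> u \<in> (\<lambda>x. T \<otimes> x) ` Span K Us"
      then obtain x where x: "x \<in> Span K Us" "T \<otimes> u = T \<otimes> x" by auto
      then have "u = x" using m_lcancel[of T u x] u Sc by auto
      then show False using x u by simp
    qed
    moreover have "line_extension K (T \<otimes> u) ((\<lambda>x. T \<otimes> x) ` Span K Us) = (\<lambda>x. T \<otimes> x) ` line_extension K u (Span K Us)"
    proof -
      have eq: "k \<otimes> (T \<otimes> u) \<oplus> T \<otimes> v = T \<otimes> (k \<otimes> u \<oplus> v)" if "k \<in> K" "v \<in> Span K Us" for k v
      proof -
        have [simp]: "u \<in> carrier E" "k \<in> carrier E" "v \<in> carrier E" using that Sc u by auto
        show ?thesis by (simp add: ring_nf)
      qed
      have "line_extension K (T \<otimes> u) ((\<lambda>x. T \<otimes> x) ` Span K Us)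
          = {k \<otimes> (T \<otimes> u) \<oplus> T \<otimes> v | k v. k \<in> K \<and> v \<in> Span K Us}"
        unfolding set_eq_iff line_extension_mem_iff by blast
      also have "\<dots> = {T \<otimes> (k \<otimes> u \<oplus> v) | k v. k \<in> K \<and> v \<in> Span K Us}"
        by (intro Collect_cong) (metis eq)
      also have "\<dots> = (\<lambda>x. T \<otimes> x) ` {k \<otimes> u \<oplus> v | k v. k \<in> K \<and> v \<in> Span K Us}"
        by blast
      also have "{k \<otimes> u \<oplus> v | k v. k \<in> K \<and> v \<in> Span K Us} = line_extension K u (Span K Us)"
        unfolding set_eq_iff line_extension_mem_iff by blast
      finally show ?thesis .
    qed
    ultimately show ?case using Cons.IH u by (simp add: independent_Cons_iff Span.simps)
  qed
  have dT: "dimension (Suc n) K ((\<lambda>x. T \<otimes> x) ` P n)"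
    using ind[OF Us(1)] dimension_independent[of K "map (\<lambda>x. T \<otimes> x) Us"] Us by simp
  have "\<one> \<notin> (\<lambda>x. T \<otimes> x) ` P n"
  proof
    assume "\<one> \<in> (\<lambda>x. T \<otimes> x) ` P n"
    then obtain x where x: "x \<in> P n" "\<one> = T \<otimes> x" by auto
    then have "x = \<zero>" using P_T_cancel_0[of x] by (metis K_props(3) P_carrier)
    then show False using x by simp
  qed
  then show ?case unfolding * using dT by (intro Suc_dim) auto
qed

lemma card_Span: "independent K Us \<Longrightarrow> finite (Span K Us) \<and> card (Span K Us) = q ^ length Us"
proof (induction Us)
  case Nil then show ?case by (simp add: Span_Nil)
next
  case (Cons u Us)
  let ?S = "Span K Us"
  have u [simp]: "u \<in> carrier E" and uS: "u \<notin> ?S" and ind: "independent K Us"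
    using Cons.prems by (auto simp: independent_Cons_iff)
  have Us: "set Us \<subseteq> carrier E" using independent_in_carrier[OF ind] .
  note S = Span_subgroup_props[OF K Us]
  have eq: "Span K (u # Us) = (\<lambda>(k, v). k \<otimes> u \<oplus> v) ` (K \<times> ?S)"
    by (auto simp: Span_Cons image_iff) blast
  have "inj_on (\<lambda>(k, v). k \<otimes> u \<oplus> v) (K \<times> ?S)"
  proof (rule inj_onI, clarify)
    fix k v k' v' assume *: "k \<in> K" "v \<in> ?S" "k' \<in> K" "v' \<in> ?S" "k \<otimes> u \<oplus> v = k' \<otimes> u \<oplus> v'"
    have [simp]: "v \<in> carrier E" "v' \<in> carrier E" "k \<in> carrier E" "k' \<in> carrier E" using S(1) * by auto
    have "(k \<ominus> k') \<otimes> u = (k \<otimes> u \<oplus> v) \<ominus> k' \<otimes> u \<ominus> v" by (simp add: ring_nf)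
    also have "\<dots> = v' \<ominus> v" unfolding *(5) by (simp add: ring_nf)
    also have "\<dots> \<in> ?S" using S * by (simp add: a_minus_def)
    finally have mem: "(k \<ominus> k') \<otimes> u \<in> ?S" .
    have kk: "k = k'"
    proof (rule ccontr)
      assume "k \<noteq> k'"
      then have "k \<ominus> k' \<in> K - {\<zero>}" using * by simp
      then show False using uS Span_m_inv_simprule[OF K Us _ u mem] by blast
    qed
    then show "k = k' \<and> v = v'" using *(5) by simp
  qed
  then show ?case using Cons.IH[OF ind] finite_K unfolding eq by (simp add: card_image card_cartesian_product)
qed

lemma card_dimension: assumes "dimension n K W" shows "finite W" "card W = q ^ n"
  using exists_base[OF K assms] card_Span by blast+

lemma dimension_eqI: assumes "dimension n K W" "dimension n K W'" "W \<subseteq> W'" shows "W = W'"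
  using card_subset_eq[of W' W] card_dimension[OF assms(1)] card_dimension[OF assms(2)] assms(3) by simp

section \<open>Skew lines and common quadratic multiples\<close>

text \<open>
  The line of a nonzero \<open>f\<close> is spanned by \<open>f\<close> and \<open>T \<otimes> f\<close>; its elements are the multiples of \<open>f\<close>
  by members of \<open>P 1\<close>.  Two polynomials are skew if their lines meet in zero only.  For members of
  \<open>P 2\<close> this says that they are coprime as binary forms of degree two.
\<close>

definition skew :: "'a \<Rightarrow> 'a \<Rightarrow> bool" where
  "skew f g \<longleftrightarrow> (\<forall>u\<in>P 1. \<forall>v\<in>P 1. u \<otimes> f = v \<otimes> g \<longrightarrow> u = \<zero> \<and> v = \<zero>)"

text \<open>
  The span of the lines of \<open>f\<close> and \<open>g\<close>.
\<close>

definition join :: "'a \<Rightarrow> 'a \<Rightarrow> 'a set" where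
  "join f g = Span K [f, T \<otimes> f, g, T \<otimes> g]"

text \<open>
  Both polynomials are multiples of some \<open>h\<close> by members of \<open>P 2\<close>; for skew \<open>f\<close> and \<open>g\<close>
  this means that \<open>f / g\<close> is a quotient of two such members (\<open>quad_relatedI\<close>).  For skew \<open>f\<close> and
  \<open>g\<close> this is the case in which more lines lie in \<open>join f g\<close> than those of the combinations of \<open>f\<close>
  and \<open>g\<close> with constant coefficients.
\<close>

definition quad_related :: "'a \<Rightarrow> 'a \<Rightarrow> bool" where
  "quad_related f g \<longleftrightarrow> (\<exists>h\<in>carrier E. \<exists>r\<in>P 2. \<exists>s\<in>P 2. f = h \<otimes> r \<and> g = h \<otimes> s)"

lemma skewD: "\<lbrakk>skew f g; u \<in> P 1; v \<in> P 1; u \<otimes> f = v \<otimes> g\<rbrakk> \<Longrightarrow> u = \<zero> \<and> v = \<zero>"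
  by (auto simp: skew_def)

lemma skew_sym: "skew f g \<Longrightarrow> skew g f"
  unfolding skew_def by metis

lemma skew_nonzero: assumes "skew f g" "f \<in> carrier E" "g \<in> carrier E" shows "f \<noteq> \<zero>" "g \<noteq> \<zero>"
  using skewD[OF assms(1), of \<one> \<zero>] skewD[OF assms(1), of \<zero> \<one>] assms by auto

lemma not_skewE:
  assumes "\<not> skew f g" "f \<in> carrier E" "g \<in> carrier E" "f \<noteq> \<zero>" "g \<noteq> \<zero>"
  obtains u v where "u \<in> P 1" "v \<in> P 1" "u \<noteq> \<zero>" "v \<noteq> \<zero>" "u \<otimes> f = v \<otimes> g"
proof -
  obtain u v where *: "u \<in> P 1" "v \<in> P 1" "u \<otimes> f = v \<otimes> g" "\<not> (u = \<zero> \<and> v = \<zero>)"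
    using assms(1) by (auto simp: skew_def)
  have "u \<noteq> \<zero>"
  proof
    assume "u = \<zero>"
    then have "v \<otimes> g = \<zero>" using * assms by simp
    then show False using integral[of v g] * assms \<open>u = \<zero>\<close> by auto
  qed
  moreover have "v \<noteq> \<zero>"
  proof
    assume "v = \<zero>"
    then have "u \<otimes> f = \<zero>" using * assms by simp
    then show False using integral[of u f] * assms \<open>v = \<zero>\<close> by auto
  qed
  ultimately show thesis using that * by blast
qed

lemma one_minus_T_nonzero: assumes "k \<in> K" shows "\<one> \<ominus> T \<otimes> k \<noteq> \<zero>"
proof
  assume 0: "\<one> \<ominus> T \<otimes> k = \<zero>"
  have [simp]: "k \<in> carrier E" using assms by simp
  have "\<one> \<oplus> T \<otimes> (\<ominus> k) = \<one> \<ominus> T \<otimes> k" by (simp add: ring_nf)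
  then have "\<one> \<oplus> T \<otimes> (\<ominus> k) = \<zero>" using 0 by simp
  then have "\<one> = \<zero>" using assms by (intro T_not_unit[of \<one> "\<ominus> k"]) auto
  then show False by simp
qed

lemma one_minus_T_P1: "k \<in> K \<Longrightarrow> \<one> \<ominus> T \<otimes> k \<in> P 1"
  using P_T[of k 0] by simp

lemma independent_1: assumes "x \<in> carrier E" shows "independent K [x] \<longleftrightarrow> x \<noteq> \<zero>"
  using assms by (simp add: independent_Cons_iff Span_Nil)

lemma independent_2: assumes "x \<in> carrier E" "y \<in> carrier E"
  shows "independent K [x, y] \<longleftrightarrow> y \<noteq> \<zero> \<and> (\<forall>k\<in>K. x \<noteq> k \<otimes> y)"
  using assms independent_1[of y] by (auto simp: independent_Cons_iff[of x "[y]"] Span_1)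

lemma skew_independent:
  assumes f: "f \<in> carrier E" and g: "g \<in> carrier E" and sk: "skew f g"
  shows "independent K [f, T \<otimes> f, g, T \<otimes> g]"
proof -
  note nz = skew_nonzero[OF sk f g]
  have fg [simp]: "f \<in> carrier E" "g \<in> carrier E" using f g by auto
  have Tg: "T \<otimes> g \<noteq> \<zero>" using integral[of T g] nz by auto
  have 2: "independent K [g, T \<otimes> g]"
  unfolding independent_2[OF fg(2) m_closed[OF T_closed fg(2)]]
  proof (intro conjI ballI Tg notI)
    fix k assume k: "k \<in> K" "g = k \<otimes> (T \<otimes> g)"
    have [simp]: "k \<in> carrier E" using k by simp
    have "(\<one> \<ominus> T \<otimes> k) \<otimes> g = g \<ominus> k \<otimes> (T \<otimes> g)" by (simp add: ring_nf)
    also have "\<dots> = \<zero>" using k(2) by simp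
    finally show False using integral[of "\<one> \<ominus> T \<otimes> k" g] one_minus_T_nonzero[OF k(1)] nz by simp
  qed
  have 3: "T \<otimes> f \<notin> Span K [g, T \<otimes> g]"
  proof
    assume "T \<otimes> f \<in> Span K [g, T \<otimes> g]"
    then obtain k l where kl: "k \<in> K" "l \<in> K" "T \<otimes> f = k \<otimes> g \<oplus> l \<otimes> (T \<otimes> g)"
      by (auto simp: Span_2)
    have [simp]: "k \<in> carrier E" "l \<in> carrier E" using kl by simp_all
    have "T \<otimes> f = (k \<oplus> T \<otimes> l) \<otimes> g" unfolding kl(3) by (simp add: ring_nf)
    then show False using skewD[OF sk, of T "k \<oplus> T \<otimes> l"] kl by auto
  qed
  have 4: "f \<notin> Span K [T \<otimes> f, g, T \<otimes> g]"
  proof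
    assume "f \<in> Span K [T \<otimes> f, g, T \<otimes> g]"
    then obtain k l m where kl: "k \<in> K" "l \<in> K" "m \<in> K" "f = k \<otimes> (T \<otimes> f) \<oplus> (l \<otimes> g \<oplus> m \<otimes> (T \<otimes> g))"
      by (auto simp: Span_3)
    have [simp]: "k \<in> carrier E" "l \<in> carrier E" "m \<in> carrier E" using kl by simp_all
    have "(\<one> \<ominus> T \<otimes> k) \<otimes> f = f \<ominus> k \<otimes> (T \<otimes> f)" by (simp add: ring_nf)
    also have "\<dots> = (k \<otimes> (T \<otimes> f) \<oplus> (l \<otimes> g \<oplus> m \<otimes> (T \<otimes> g))) \<ominus> k \<otimes> (T \<otimes> f)"
      using kl(4) by simp
    also have "\<dots> = (l \<oplus> T \<otimes> m) \<otimes> g" by (simp add: ring_nf)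
    finally show False
      using skewD[OF sk one_minus_T_P1[OF kl(1)], of "l \<oplus> T \<otimes> m"] one_minus_T_nonzero[OF kl(1)] kl by auto
  qed
  show ?thesis using 2 3 4 by (subst independent_Cons_iff, subst independent_Cons_iff) auto
qed

lemma join_iff: assumes [simp]: "f \<in> carrier E" "g \<in> carrier E"
  shows "x \<in> join f g \<longleftrightarrow> (\<exists>u\<in>P 1. \<exists>v\<in>P 1. x = u \<otimes> f \<oplus> v \<otimes> g)"
proof
  assume "x \<in> join f g"
  then obtain k l m n where kl: "k \<in> K" "l \<in> K" "m \<in> K" "n \<in> K"
      "x = k \<otimes> f \<oplus> (l \<otimes> (T \<otimes> f) \<oplus> (m \<otimes> g \<oplus> n \<otimes> (T \<otimes> g)))"
    by (auto simp: join_def Span_4)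
  have [simp]: "k \<in> carrier E" "l \<in> carrier E" "m \<in> carrier E" "n \<in> carrier E" using kl by simp_all
  have "x = (k \<oplus> T \<otimes> l) \<otimes> f \<oplus> (m \<oplus> T \<otimes> n) \<otimes> g" unfolding kl(5) by (simp add: ring_nf)
  then show "\<exists>u\<in>P 1. \<exists>v\<in>P 1. x = u \<otimes> f \<oplus> v \<otimes> g" using kl by blast
next
  assume "\<exists>u\<in>P 1. \<exists>v\<in>P 1. x = u \<otimes> f \<oplus> v \<otimes> g"
  then obtain k l m n where kl: "k \<in> K" "l \<in> K" "m \<in> K" "n \<in> K" "x = (k \<oplus> T \<otimes> l) \<otimes> f \<oplus> (m \<oplus> T \<otimes> n) \<otimes> g"
    by (metis P1_E)
  have [simp]: "k \<in> carrier E" "l \<in> carrier E" "m \<in> carrier E" "n \<in> carrier E" using kl by simp_all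
  have "x = k \<otimes> f \<oplus> (l \<otimes> (T \<otimes> f) \<oplus> (m \<otimes> g \<oplus> n \<otimes> (T \<otimes> g)))" unfolding kl(5) by (simp add: ring_nf)
  then show "x \<in> join f g" using kl unfolding join_def by (subst Span_4) (auto intro!: bexI)
qed

lemma dimension_join:
  "\<lbrakk>f \<in> carrier E; g \<in> carrier E; skew f g\<rbrakk> \<Longrightarrow> dimension 4 K (join f g)"
  using dimension_independent[OF skew_independent[of f g]] by (simp add: join_def numeral_eq_Suc)

lemma dimension_P_numeral: "dimension 2 K (P 1)" "dimension 3 K (P 2)" "dimension 4 K (P 3)"
  using dimension_P[of 1] dimension_P[of 2] dimension_P[of 3] by (simp_all add: numeral_eq_Suc)

lemma independent_forms_span:
  assumes uv: "u \<in> P 1" "v \<in> P 1" "independent K [u, v]" and x: "x \<in> P 1"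
  obtains a b where "a \<in> K" "b \<in> K" "x = a \<otimes> u \<oplus> b \<otimes> v"
proof -
  have "Span K [u, v] = P 1"
    using independent_length_eq_dimension[OF K dimension_P_numeral(1) uv(3)] uv by simp
  then have "x \<in> Span K [u, v]" using x by simp
  then show thesis using that Span_2[OF P_carrier[OF uv(1)] P_carrier[OF uv(2)]] by blast
qed

text \<open>
  Independent linear forms generate the constant \<open>1\<close> and \<open>T\<close>.  The first makes the common
  factor \<open>z\<close> exist, the second bounds its degree, through \<open>T \<otimes> z\<close>.  Degree bounds take care of
  the point at infinity: \<open>P n\<close> behaves as the space of binary forms of degree \<open>n\<close>, and
  independence in \<open>P 1\<close> is coprimality of linear forms.
\<close>

lemma linear_factor:
  assumes uv: "u \<in> P 1" "v \<in> P 1" "independent K [u, v]"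
    and xy: "x \<in> carrier E" "y \<in> carrier E" "u \<otimes> x = v \<otimes> y"
  obtains z where "z \<in> Span K [x, y]" "T \<otimes> z \<in> Span K [x, y]" "x = v \<otimes> z" "y = u \<otimes> z"
proof -
  obtain a b where ab: "a \<in> K" "b \<in> K" "\<one> = a \<otimes> u \<oplus> b \<otimes> v"
    using independent_forms_span[OF uv, of \<one>] by auto
  obtain c d where cd: "c \<in> K" "d \<in> K" "T = c \<otimes> u \<oplus> d \<otimes> v"
    using independent_forms_span[OF uv, of T] by auto
  have [simp]: "a \<in> carrier E" "b \<in> carrier E" "c \<in> carrier E" "d \<in> carrier E" "u \<in> carrier E" "v \<in> carrier E"
      "x \<in> carrier E" "y \<in> carrier E"
    using K_carrier[OF ab(1)] K_carrier[OF ab(2)] K_carrier[OF cd(1)] K_carrier[OF cd(2)]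
      P_carrier[OF uv(1)] P_carrier[OF uv(2)] xy(1,2) by auto
  define z where "z = b \<otimes> x \<oplus> a \<otimes> y"
  have z1: "x = v \<otimes> z"
  proof -
    have "v \<otimes> z = b \<otimes> v \<otimes> x \<oplus> a \<otimes> (v \<otimes> y)" unfolding z_def by (simp add: ring_nf)
    also have "\<dots> = b \<otimes> v \<otimes> x \<oplus> a \<otimes> (u \<otimes> x)" using xy by simp
    also have "\<dots> = (a \<otimes> u \<oplus> b \<otimes> v) \<otimes> x" by (simp add: ring_nf)
    also have "\<dots> = x" unfolding ab(3)[symmetric] by simp
    finally show ?thesis by simp
  qed
  have z2: "y = u \<otimes> z"
  proof -
    have "u \<otimes> z = b \<otimes> (u \<otimes> x) \<oplus> a \<otimes> u \<otimes> y" unfolding z_def by (simp add: ring_nf)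
    also have "\<dots> = b \<otimes> (v \<otimes> y) \<oplus> a \<otimes> u \<otimes> y" using xy by simp
    also have "\<dots> = (a \<otimes> u \<oplus> b \<otimes> v) \<otimes> y" by (simp add: ring_nf)
    also have "\<dots> = y" unfolding ab(3)[symmetric] by simp
    finally show ?thesis by simp
  qed
  have [simp]: "z \<in> carrier E" by (simp add: z_def)
  have "T \<otimes> z = (c \<otimes> u \<oplus> d \<otimes> v) \<otimes> z" using cd(3) by simp
  also have "\<dots> = d \<otimes> (v \<otimes> z) \<oplus> c \<otimes> (u \<otimes> z)" by (simp add: ring_nf)
  finally have "T \<otimes> z = d \<otimes> x \<oplus> c \<otimes> y" using z1 z2 by simp
  then have "T \<otimes> z \<in> Span K [x, y]" using cd by (auto simp: Span_2)
  moreover have "z \<in> Span K [x, y]" using ab by (auto simp: Span_2 z_def)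
  ultimately show thesis using that z1 z2 by blast
qed

lemma Span_2_P: "\<lbrakk>x \<in> P n; y \<in> P n; z \<in> Span K [x, y]\<rbrakk> \<Longrightarrow> z \<in> P n"
  by (auto simp: Span_2)

lemma linear_factor_P:
  assumes uv: "u \<in> P 1" "v \<in> P 1" "independent K [u, v]"
    and xy: "x \<in> P (Suc n)" "y \<in> P (Suc n)" "u \<otimes> x = v \<otimes> y"
  obtains z where "z \<in> P n" "x = v \<otimes> z" "y = u \<otimes> z"
proof -
  obtain z where z: "z \<in> Span K [x, y]" "T \<otimes> z \<in> Span K [x, y]" "x = v \<otimes> z" "y = u \<otimes> z"
    by (rule linear_factor[OF uv P_carrier[OF xy(1)] P_carrier[OF xy(2)] xy(3)])
  have "z \<in> P (Suc n)" "T \<otimes> z \<in> P (Suc n)" using Span_2_P[OF xy(1,2)] z(1,2) by blast+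
  then have "z \<in> P n" using P_T_cancel P_carrier by blast
  then show thesis using that z by blast
qed

text \<open>
  A space of dimension four inside another one: two coprime quadratics generate all cubics.
\<close>

lemma quad_join: assumes "r \<in> P 2" "s \<in> P 2" "skew r s" shows "join r s = P 3"
proof (rule dimension_eqI)
  show "dimension 4 K (join r s)" using assms by (simp add: dimension_join)
  show "dimension 4 K (P 3)" by (rule dimension_P_numeral)
  show "join r s \<subseteq> P 3"
  proof
    fix x assume "x \<in> join r s"
    then obtain u v where *: "u \<in> P 1" "v \<in> P 1" "x = u \<otimes> r \<oplus> v \<otimes> s" using assms by (auto simp: join_iff)
    have "u \<otimes> r \<in> P (1 + 2)" "v \<otimes> s \<in> P (1 + 2)" using * assms by (blast intro: P_mult)+
    then show "x \<in> P 3" using *(3) by (simp add: numeral_eq_Suc)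
  qed
qed

text \<open>
  The analogue of \<open>linear_factor\<close> for coprime quadratics, which generate both \<open>1\<close> and the cube of \<open>T\<close>.
\<close>

lemma quad_factor:
  assumes rs: "r \<in> P 2" "s \<in> P 2" "skew r s"
    and xy: "x \<in> carrier E" "y \<in> carrier E" "r \<otimes> x = s \<otimes> y"
  obtains z where "z \<in> join x y" "T \<otimes> (T \<otimes> (T \<otimes> z)) \<in> join x y" "x = s \<otimes> z" "y = r \<otimes> z"
proof -
  have "\<one> \<in> join r s" "T \<otimes> (T \<otimes> (T \<otimes> \<one>)) \<in> join r s"
    using quad_join[OF rs] by (simp_all add: numeral_eq_Suc del: r_one)
  then obtain a b c d where ab: "a \<in> P 1" "b \<in> P 1" "\<one> = a \<otimes> r \<oplus> b \<otimes> s"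
    and cd: "c \<in> P 1" "d \<in> P 1" "T \<otimes> (T \<otimes> (T \<otimes> \<one>)) = c \<otimes> r \<oplus> d \<otimes> s"
    using rs by (auto simp: join_iff simp del: r_one)
  have [simp]: "a \<in> carrier E" "b \<in> carrier E" "c \<in> carrier E" "d \<in> carrier E" "r \<in> carrier E" "s \<in> carrier E"
      "x \<in> carrier E" "y \<in> carrier E"
    using ab cd rs xy by auto
  define z where "z = b \<otimes> x \<oplus> a \<otimes> y"
  have z1: "x = s \<otimes> z"
  proof -
    have "s \<otimes> z = b \<otimes> s \<otimes> x \<oplus> a \<otimes> (s \<otimes> y)" unfolding z_def by (simp add: ring_nf)
    also have "\<dots> = b \<otimes> s \<otimes> x \<oplus> a \<otimes> (r \<otimes> x)" using xy by simp
    also have "\<dots> = (a \<otimes> r \<oplus> b \<otimes> s) \<otimes> x" by (simp add: ring_nf)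
    also have "\<dots> = x" unfolding ab(3)[symmetric] by simp
    finally show ?thesis by simp
  qed
  have z2: "y = r \<otimes> z"
  proof -
    have "r \<otimes> z = b \<otimes> (r \<otimes> x) \<oplus> a \<otimes> r \<otimes> y" unfolding z_def by (simp add: ring_nf)
    also have "\<dots> = b \<otimes> (s \<otimes> y) \<oplus> a \<otimes> r \<otimes> y" using xy by simp
    also have "\<dots> = (a \<otimes> r \<oplus> b \<otimes> s) \<otimes> y" by (simp add: ring_nf)
    also have "\<dots> = y" unfolding ab(3)[symmetric] by simp
    finally show ?thesis by simp
  qed
  have [simp]: "z \<in> carrier E" by (simp add: z_def)
  have "T \<otimes> (T \<otimes> (T \<otimes> z)) = (T \<otimes> (T \<otimes> (T \<otimes> \<one>))) \<otimes> z" by (simp add: ring_nf)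
  also have "\<dots> = d \<otimes> (s \<otimes> z) \<oplus> c \<otimes> (r \<otimes> z)" unfolding cd(3) by (simp add: ring_nf)
  finally have "T \<otimes> (T \<otimes> (T \<otimes> z)) = d \<otimes> x \<oplus> c \<otimes> y" using z1 z2 by simp
  then have "T \<otimes> (T \<otimes> (T \<otimes> z)) \<in> join x y" using cd unfolding join_iff[OF xy(1,2)] by blast
  moreover have "z \<in> join x y" using ab unfolding join_iff[OF xy(1,2)] z_def by blast
  ultimately show thesis using that z1 z2 by blast
qed

lemma quad_factor_P:
  assumes rs: "r \<in> P 2" "s \<in> P 2" "skew r s"
    and xy: "x \<in> P (Suc (Suc n))" "y \<in> P (Suc (Suc n))" "r \<otimes> x = s \<otimes> y"
  obtains z where "z \<in> P n" "x = s \<otimes> z" "y = r \<otimes> z"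
proof -
  obtain z where z: "z \<in> join x y" "T \<otimes> (T \<otimes> (T \<otimes> z)) \<in> join x y" "x = s \<otimes> z" "y = r \<otimes> z"
    by (rule quad_factor[OF rs P_carrier[OF xy(1)] P_carrier[OF xy(2)] xy(3)])
  have sub: "w \<in> P (Suc (Suc (Suc n)))" if "w \<in> join x y" for w
  proof -
    obtain u v where *: "u \<in> P 1" "v \<in> P 1" "w = u \<otimes> x \<oplus> v \<otimes> y" using \<open>w \<in> join x y\<close> unfolding join_iff[OF P_carrier[OF xy(1)] P_carrier[OF xy(2)]] by blast
    have "u \<otimes> x \<in> P (1 + Suc (Suc n))" "v \<otimes> y \<in> P (1 + Suc (Suc n))" using * xy by (blast intro: P_mult)+
    then show ?thesis using * by simp
  qed
  have [simp]: "z \<in> carrier E" using sub[OF z(1)] by simp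
  have "z \<in> P n" using P_T_cancel[OF _ P_T_cancel[OF _ P_T_cancel[OF _ sub[OF z(2)]]]] by simp
  then show thesis using that z by blast
qed

lemma mult_cancel: "\<lbrakk>h \<otimes> x = h \<otimes> y; h \<noteq> \<zero>; h \<in> carrier E; x \<in> carrier E; y \<in> carrier E\<rbrakk> \<Longrightarrow> x = y"
  using m_lcancel by blast

lemma skew_factor:
  assumes "skew (h \<otimes> r) (h \<otimes> s)" "h \<in> carrier E" "r \<in> carrier E" "s \<in> carrier E"
  shows "skew r s"
  unfolding skew_def
proof (intro ballI impI)
  fix u v assume *: "u \<in> P 1" "v \<in> P 1" "u \<otimes> r = v \<otimes> s"
  have [simp]: "u \<in> carrier E" "v \<in> carrier E" "h \<in> carrier E" "r \<in> carrier E" "s \<in> carrier E"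
    using assms * P_carrier by blast+
  have "u \<otimes> (h \<otimes> r) = h \<otimes> (u \<otimes> r)" by (simp add: ring_nf)
  also have "\<dots> = h \<otimes> (v \<otimes> s)" using * by simp
  also have "\<dots> = v \<otimes> (h \<otimes> s)" by (simp add: ring_nf)
  finally show "u = \<zero> \<and> v = \<zero>" using skewD[OF assms(1)] * by blast
qed

lemma join_factor:
  assumes fg: "f = h \<otimes> r" "g = h \<otimes> s" "skew f g" and h: "h \<in> carrier E" "r \<in> P 2" "s \<in> P 2"
  shows "join f g = (\<lambda>x. h \<otimes> x) ` P 3"
proof -
  have c [simp]: "h \<in> carrier E" "r \<in> carrier E" "s \<in> carrier E" using h P_carrier by blast+
  have f: "f \<in> carrier E" and g: "g \<in> carrier E" using fg by simp_all
  have eq: "u \<otimes> f \<oplus> v \<otimes> g = h \<otimes> (u \<otimes> r \<oplus> v \<otimes> s)" if "u \<in> P 1" "v \<in> P 1" for u v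
  proof -
    have [simp]: "u \<in> carrier E" "v \<in> carrier E" using that P_carrier by blast+
    show ?thesis unfolding fg by (simp add: ring_nf)
  qed
  have "skew r s" using fg skew_factor[of h r s] by simp
  then have rs: "join r s = P 3" using quad_join h by blast
  have "join f g = {u \<otimes> f \<oplus> v \<otimes> g | u v. u \<in> P 1 \<and> v \<in> P 1}"
    unfolding set_eq_iff join_iff[OF f g] by blast
  also have "\<dots> = {h \<otimes> (u \<otimes> r \<oplus> v \<otimes> s) | u v. u \<in> P 1 \<and> v \<in> P 1}"
    by (intro Collect_cong) (metis eq)
  also have "\<dots> = (\<lambda>x. h \<otimes> x) ` {u \<otimes> r \<oplus> v \<otimes> s | u v. u \<in> P 1 \<and> v \<in> P 1}" by blast
  also have "{u \<otimes> r \<oplus> v \<otimes> s | u v. u \<in> P 1 \<and> v \<in> P 1} = join r s"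
    unfolding set_eq_iff join_iff[OF c(2,3)] by blast
  finally show ?thesis unfolding rs .
qed

lemma mem_join: assumes [simp]: "f \<in> carrier E" "g \<in> carrier E"
  shows "f \<in> join f g" "T \<otimes> f \<in> join f g" "g \<in> join f g" "T \<otimes> g \<in> join f g"
  using Span_base_incl[OF K, of "[f, T \<otimes> f, g, T \<otimes> g]"] by (auto simp: join_def)

text \<open>
  For \<open>f\<close> and \<open>g\<close> that are multiples of \<open>h\<close> by quadratics, the other \<open>x\<close> with the same join lie in
  the plane of all such multiples.
\<close>

lemma join_class_quad:
  assumes fg: "f = h \<otimes> r" "g = h \<otimes> s" "skew f g" and h: "h \<in> carrier E" "r \<in> P 2" "s \<in> P 2"
    and g': "g' \<in> carrier E" "join f g' = join f g"
  shows "g' \<in> (\<lambda>x. h \<otimes> x) ` P 2"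
proof -
  have c: "r \<in> carrier E" "s \<in> carrier E" "f \<in> carrier E" "g \<in> carrier E" using h fg P_carrier by auto
  have h0: "h \<noteq> \<zero>" using skew_nonzero(1)[OF fg(3) c(3,4)] fg(1) c by auto
  have "g' \<in> (\<lambda>x. h \<otimes> x) ` P 3" "T \<otimes> g' \<in> (\<lambda>x. h \<otimes> x) ` P 3"
    using mem_join[OF c(3) g'(1)] unfolding g'(2) join_factor[OF fg h] by blast+
  then obtain a b where ab: "a \<in> P 3" "g' = h \<otimes> a" "b \<in> P 3" "T \<otimes> g' = h \<otimes> b" by auto
  have [simp]: "a \<in> carrier E" "b \<in> carrier E" "h \<in> carrier E" using ab h P_carrier by blast+
  have "h \<otimes> (T \<otimes> a) = T \<otimes> (h \<otimes> a)" by (simp add: ring_nf)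
  also have "\<dots> = h \<otimes> b" using ab by simp
  finally have "T \<otimes> a = b" using mult_cancel[of h "T \<otimes> a" b] h0 by simp
  then have "T \<otimes> a \<in> P (Suc 2)" using ab by (simp add: numeral_eq_Suc)
  then have "a \<in> P 2" using P_T_cancel[of a 2] by simp
  then show ?thesis using ab by blast
qed

lemma quad_relatedI:
  assumes rs: "r \<in> P 2" "s \<in> P 2" "r \<noteq> \<zero>" "s \<noteq> \<zero>" "r \<otimes> f = s \<otimes> g"
    and fg: "f \<in> carrier E" "g \<in> carrier E" "skew f g"
  shows "quad_related f g"
proof -
  have [simp]: "r \<in> carrier E" "s \<in> carrier E" "f \<in> carrier E" "g \<in> carrier E" using rs fg P_carrier by blast+
  have "skew r s" unfolding skew_def
  proof (intro ballI impI)
    fix u v assume *: "u \<in> P 1" "v \<in> P 1" "u \<otimes> r = v \<otimes> s"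
    have [simp]: "u \<in> carrier E" "v \<in> carrier E" using * P_carrier by blast+
    have "s \<otimes> (v \<otimes> f) = v \<otimes> s \<otimes> f" by (simp add: ring_nf)
    also have "\<dots> = u \<otimes> r \<otimes> f" using * by simp
    also have "\<dots> = u \<otimes> (r \<otimes> f)" by (simp add: ring_nf)
    also have "\<dots> = u \<otimes> (s \<otimes> g)" using rs by simp
    also have "\<dots> = s \<otimes> (u \<otimes> g)" by (simp add: ring_nf)
    finally have "v \<otimes> f = u \<otimes> g" using mult_cancel[of s] rs by simp
    then show "u = \<zero> \<and> v = \<zero>" using skewD[OF fg(3)] * by blast
  qed
  then obtain z where z: "z \<in> join f g" "f = s \<otimes> z" "g = r \<otimes> z"
    using quad_factor[OF rs(1,2) _ fg(1,2) rs(5)] by metis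
  have [simp]: "z \<in> carrier E"
    using z(1) Span_subgroup_props(1)[OF K, of "[f, T \<otimes> f, g, T \<otimes> g]"] by (auto simp: join_def)
  have "f = z \<otimes> s" "g = z \<otimes> r" using z m_comm by simp_all
  then show ?thesis unfolding quad_related_def using rs by (intro bexI[of _ z] bexI[of _ s] bexI[of _ r]) auto
qed

lemma P_1_2: "x \<in> P 1 \<Longrightarrow> x \<in> P 2" "x \<in> P 1 \<Longrightarrow> T \<otimes> x \<in> P 2"
  using P_Suc_mono[of x 1] P_T[of x 1] by (simp_all add: numeral_eq_Suc)

lemma P_T_cancel_1: "\<lbrakk>x \<in> P 1; T \<otimes> x \<in> P 1\<rbrakk> \<Longrightarrow> x \<in> K"
  using P_T_cancel[of x 0] P_carrier by auto

text \<open>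
  Writing \<open>g'\<close> and \<open>T \<otimes> g'\<close> in terms of the lines of \<open>f\<close> and \<open>g\<close> and eliminating \<open>g'\<close> gives an equation
  \<open>r \<otimes> f = s \<otimes> g\<close> with \<open>r\<close> and \<open>s\<close> in \<open>P 2\<close>.  Unless it is trivial, \<open>f\<close> and \<open>g\<close> are quadratically
  related; if it is trivial, \<open>g'\<close> is a combination of \<open>f\<close> and \<open>g\<close> with constant coefficients.
\<close>

lemma join_class_not_quad:
  assumes c [simp]: "f \<in> carrier E" "g \<in> carrier E" "g' \<in> carrier E"
    and sk: "skew f g" and eq: "join f g' = join f g" and nq: "\<not> quad_related f g"
  shows "g' \<in> Span K [f, g]"
proof -
  note nz = skew_nonzero[OF sk c(1,2)]
  have "g' \<in> join f g" "T \<otimes> g' \<in> join f g" using mem_join[OF c(1,3)] unfolding eq by blast+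
  then obtain u v u' v' where uv: "u \<in> P 1" "v \<in> P 1" "g' = u \<otimes> f \<oplus> v \<otimes> g"
    and uv': "u' \<in> P 1" "v' \<in> P 1" "T \<otimes> g' = u' \<otimes> f \<oplus> v' \<otimes> g"
    unfolding join_iff[OF c(1,2)] by blast
  have [simp]: "u \<in> carrier E" "v \<in> carrier E" "u' \<in> carrier E" "v' \<in> carrier E"
    using uv(1,2) uv'(1,2) P_carrier by blast+
  define r s where "r = T \<otimes> u \<ominus> u'" and "s = v' \<ominus> T \<otimes> v"
  have rs: "r \<in> P 2" "s \<in> P 2" using uv(1,2) uv'(1,2) P_1_2 by (simp_all add: r_def s_def)
  have [simp]: "r \<in> carrier E" "s \<in> carrier E" using rs P_carrier by blast+
  have "r \<otimes> f = T \<otimes> (u \<otimes> f \<oplus> v \<otimes> g) \<ominus> T \<otimes> v \<otimes> g \<ominus> u' \<otimes> f" unfolding r_def by (simp add: ring_nf)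
  also have "\<dots> = (u' \<otimes> f \<oplus> v' \<otimes> g) \<ominus> T \<otimes> v \<otimes> g \<ominus> u' \<otimes> f" using uv(3) uv'(3) by simp
  also have "\<dots> = s \<otimes> g" unfolding s_def by (simp add: ring_nf)
  finally have rsfg: "r \<otimes> f = s \<otimes> g" .
  show ?thesis
  proof (cases "r = \<zero> \<or> s = \<zero>")
    case True
    then have "r = \<zero>" "s = \<zero>"
      using rsfg nz integral[of s g] integral[of r f] by auto
    then have "T \<otimes> u = u'" "T \<otimes> v = v'" by (simp_all add: r_def s_def)
    then have "u \<in> K" "v \<in> K" using P_T_cancel_1 uv(1,2) uv'(1,2) by simp_all
    then show ?thesis using uv(3) Span_2[OF c(1,2)] by blast
  next
    case False
    then show ?thesis using quad_relatedI[OF rs _ _ rsfg c(1,2) sk] nq by blast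
  qed
qed

lemma not_skew_factor:
  assumes c: "f \<in> carrier E" "g \<in> carrier E" "independent K [f, g]" and ns: "\<not> skew f g"
  obtains u v e where "u \<in> P 1" "v \<in> P 1" "independent K [u, v]" "e \<in> Span K [f, g]" "T \<otimes> e \<in> Span K [f, g]"
    "f = v \<otimes> e" "g = u \<otimes> e"
proof -
  have nz: "f \<noteq> \<zero>" "g \<noteq> \<zero>" and np: "\<And>k. k \<in> K \<Longrightarrow> f \<noteq> k \<otimes> g"
    using c(3) unfolding independent_2[OF c(1,2)] using c by (auto dest: bspec[of _ _ \<zero>])
  obtain u v where uv: "u \<in> P 1" "v \<in> P 1" "u \<noteq> \<zero>" "v \<noteq> \<zero>" "u \<otimes> f = v \<otimes> g"
    by (rule not_skewE[OF ns c(1,2) nz])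
  have [simp]: "u \<in> carrier E" "v \<in> carrier E" "f \<in> carrier E" "g \<in> carrier E" using uv(1,2) c P_carrier by blast+
  have "independent K [v, u]"
    unfolding independent_2[OF \<open>v \<in> carrier E\<close> \<open>u \<in> carrier E\<close>]
  proof (intro conjI ballI notI)
    fix k assume k: "k \<in> K" "v = k \<otimes> u"
    have [simp]: "k \<in> carrier E" using k by simp
    have "u \<otimes> f = (k \<otimes> u) \<otimes> g" using uv(5) k(2) by simp
    also have "\<dots> = u \<otimes> (k \<otimes> g)" by (simp add: ring_nf)
    finally have "f = k \<otimes> g" using mult_cancel[of u] uv(3) by simp
    then show False using np k(1) by blast
  qed (use uv in simp)
  then have ind: "independent K [u, v]" by (rule independent_same_set[OF K, rotated 2]) auto
  show thesis
    by (rule linear_factor[OF uv(1,2) ind c(1,2) uv(5)]) (use that uv ind in blast)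
qed

lemma skew_scale: assumes "skew f g" "k \<in> K" "f \<in> carrier E" "g \<in> carrier E" "h \<in> carrier E" "f = k \<otimes> h"
  shows "skew h g"
  unfolding skew_def
proof (intro ballI impI)
  fix u v assume *: "u \<in> P 1" "v \<in> P 1" "u \<otimes> h = v \<otimes> g"
  have [simp]: "u \<in> carrier E" "v \<in> carrier E" "h \<in> carrier E" "k \<in> carrier E" "g \<in> carrier E"
    using assms * P_carrier K_carrier by blast+
  have "k \<noteq> \<zero>" using skew_nonzero(1)[OF assms(1,3,4)] assms by auto
  have "u \<otimes> f = k \<otimes> (u \<otimes> h)" unfolding assms(6) by (simp add: ring_nf)
  also have "\<dots> = k \<otimes> v \<otimes> g" using * m_assoc by simp
  finally have "u = \<zero> \<and> k \<otimes> v = \<zero>" using skewD[OF assms(1) *(1), of "k \<otimes> v"] * assms(2) by simp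
  then show "u = \<zero> \<and> v = \<zero>" using integral[of k v] \<open>k \<noteq> \<zero>\<close> by simp
qed

lemma not_skew_quad:
  assumes rs: "r \<in> P 2" "s \<in> P 2" "independent K [r, s]" "\<not> skew r s"
  obtains u v l where "u \<in> P 1" "v \<in> P 1" "l \<in> P 1" "r = v \<otimes> l" "s = u \<otimes> l"
proof -
  have c: "r \<in> carrier E" "s \<in> carrier E" using rs P_carrier by blast+
  obtain u v e where *: "u \<in> P 1" "v \<in> P 1" "independent K [u, v]" "e \<in> Span K [r, s]" "T \<otimes> e \<in> Span K [r, s]"
    "r = v \<otimes> e" "s = u \<otimes> e"
    by (rule not_skew_factor[OF c rs(3,4)])
  have "e \<in> P 2" "T \<otimes> e \<in> P 2" using Span_2_P[OF rs(1,2)] * by blast+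
  then have "e \<in> P 1" using P_T_cancel[of e 1] P_carrier by (simp add: numeral_eq_Suc)
  then show thesis using that * by blast
qed

text \<open>
  A quadratic has at most two linear factors, and pairwise skew quadratics that share a factor with it
  use different ones.
\<close>

lemma three_skew_quads:
  assumes r: "r \<in> P 2" "r \<noteq> \<zero>" and abc: "a \<in> P 2" "b \<in> P 2" "c \<in> P 2"
    and sk: "skew a b" "skew a c" "skew b c"
    and ns: "\<not> skew r a" "\<not> skew r b" "\<not> skew r c"
  shows False
proof -
  have [simp]: "r \<in> carrier E" "a \<in> carrier E" "b \<in> carrier E" "c \<in> carrier E" using r abc P_carrier by blast+
  have np: "r \<noteq> k \<otimes> x" if kx: "k \<in> K" "x \<in> {a, b, c}" for k x
  proof
    assume rk: "r = k \<otimes> x"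
    have [simp]: "k \<in> carrier E" using that by simp
    obtain y where y: "y \<in> {a, b, c}" "skew y x"
      using kx(2) sk skew_sym by blast
    have [simp]: "y \<in> carrier E" "x \<in> carrier E" using y that by auto
    have k0: "k \<noteq> \<zero>" using rk r(2) by auto
    obtain d where d: "d \<in> K" "d \<noteq> \<zero>" "d \<otimes> k = \<one>" using K_inv[OF kx(1) k0] by blast
    have [simp]: "d \<in> carrier E" using d by simp
    have "x = d \<otimes> r" unfolding rk using d m_assoc[of d k x] by simp
    then have "skew r y" using skew_scale[OF skew_sym[OF y(2)] d(1)] by simp
    then show False using ns y(1) by blast
  qed
  have ind: "independent K [r, x]" if "x \<in> {a, b, c}" for x
  proof -
    have x: "x \<in> carrier E" "x \<noteq> \<zero>" using that sk skew_nonzero[of a b] skew_nonzero[of b c] by auto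
    show ?thesis unfolding independent_2[OF \<open>r \<in> carrier E\<close> x(1)] using np that x by blast
  qed
  obtain ua va la where A: "ua \<in> P 1" "va \<in> P 1" "la \<in> P 1" "r = va \<otimes> la" "a = ua \<otimes> la"
    by (rule not_skew_quad[OF r(1) abc(1) ind ns(1)]) simp
  obtain ub vb lb where B: "ub \<in> P 1" "vb \<in> P 1" "lb \<in> P 1" "r = vb \<otimes> lb" "b = ub \<otimes> lb"
    by (rule not_skew_quad[OF r(1) abc(2) ind ns(2)]) simp
  obtain uc vc lc where C: "uc \<in> P 1" "vc \<in> P 1" "lc \<in> P 1" "r = vc \<otimes> lc" "c = uc \<otimes> lc"
    by (rule not_skew_quad[OF r(1) abc(3) ind ns(3)]) simp
  have ll: "independent K [l, l']"
    if "u \<in> P 1" "l \<in> P 1" "u' \<in> P 1" "l' \<in> P 1" "skew (u \<otimes> l) (u' \<otimes> l')" for u l u' l'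
  proof -
    have [simp]: "u \<in> carrier E" "l \<in> carrier E" "u' \<in> carrier E" "l' \<in> carrier E" using that P_carrier by blast+
    have nz: "u \<otimes> l \<noteq> \<zero>" "u' \<otimes> l' \<noteq> \<zero>" using skew_nonzero[OF that(5)] by simp_all
    show ?thesis unfolding independent_2[OF \<open>l \<in> carrier E\<close> \<open>l' \<in> carrier E\<close>]
    proof (intro conjI ballI notI)
      fix k assume k: "k \<in> K" "l = k \<otimes> l'"
      have [simp]: "k \<in> carrier E" using k by simp
      have "u' \<otimes> (u \<otimes> l) = k \<otimes> u \<otimes> (u' \<otimes> l')" unfolding k(2) by (simp add: ring_nf)
      then have "u' = \<zero>" using skewD[OF that(5) that(3), of "k \<otimes> u"] k that by simp
      then show False using nz by simp
    qed (use nz in auto)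
  qed
  have lab: "independent K [la, lb]" using ll[of ua la ub lb] A B sk by simp
  have lac: "independent K [la, lc]" using ll[of ua la uc lc] A C sk by simp
  have lbc: "independent K [lb, lc]" using ll[of ub lb uc lc] B C sk by simp
  have [simp]: "la \<in> carrier E" "lb \<in> carrier E" "lc \<in> carrier E" "va \<in> carrier E" "vb \<in> carrier E" "vc \<in> carrier E"
    using A(2,3) B(2,3) C(2,3) P_carrier by blast+
  have "la \<otimes> va = lb \<otimes> vb" "la \<otimes> va = lc \<otimes> vc" using A(4) B(4) C(4) m_comm by simp_all
  then obtain z z' where z: "z \<in> P 0" "va = lb \<otimes> z" and z': "z' \<in> P 0" "va = lc \<otimes> z'"
    using linear_factor_P[OF A(3) B(3) lab, of va 0 vb] linear_factor_P[OF A(3) C(3) lac, of va 0 vc]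
      A(2) B(2) C(2) by (metis One_nat_def)
  have z0: "z \<in> K" "z' \<in> K" "z \<noteq> \<zero>" using z z' r(2) A(4) by auto
  obtain d where d: "d \<in> K" "d \<otimes> z = \<one>" using K_inv[OF z0(1,3)] by blast
  have [simp]: "d \<in> carrier E" "z \<in> carrier E" "z' \<in> carrier E" using d z0 by simp_all
  have "lb = (d \<otimes> z) \<otimes> lb" using d by simp
  also have "\<dots> = d \<otimes> (lb \<otimes> z)" by (simp add: ring_nf)
  also have "\<dots> = d \<otimes> (lc \<otimes> z')" using z z' by simp
  also have "\<dots> = (d \<otimes> z') \<otimes> lc" by (simp add: ring_nf)
  finally have lb: "lb = (d \<otimes> z') \<otimes> lc" .
  have "d \<otimes> z' \<in> K" using d z0 by simp
  then show False using lbc lb unfolding independent_2[OF \<open>lb \<in> carrier E\<close> \<open>lc \<in> carrier E\<close>] by blast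
qed

text \<open>
  Three polynomials that are pairwise quadratically related, the first one being \<open>h \<otimes> s1\<close> and
  \<open>h' \<otimes> s\<close>.  The relation between \<open>f1\<close> and \<open>g\<close> reads \<open>r1 \<otimes> b \<otimes> s = s1 \<otimes> a \<otimes> r\<close> with quadratic
  \<open>a\<close> and \<open>b\<close>.  When \<open>r1\<close> is coprime to \<open>r\<close>, comparing the coprime factors forces \<open>h\<close> and \<open>h'\<close> to be
  proportional, so that all three polynomials lie in one plane.
\<close>

lemma two_quad_relations:
  assumes f0: "f0 = h \<otimes> s1" "f1 = h \<otimes> r1" and g: "f0 = h' \<otimes> s" "g = h' \<otimes> r"
    and P: "s1 \<in> P 2" "r1 \<in> P 2" "s \<in> P 2" "r \<in> P 2" and h: "h \<in> carrier E" "h' \<in> carrier E"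
    and sk: "skew f0 f1" "skew f0 g" and q: "quad_related f1 g" and rr: "skew r1 r"
  shows "join f0 f1 = join f0 g"
proof -
  have [simp]: "s1 \<in> carrier E" "r1 \<in> carrier E" "s \<in> carrier E" "r \<in> carrier E" "h \<in> carrier E" "h' \<in> carrier E"
    using P h P_carrier by blast+
  have fc: "f0 \<in> carrier E" "f1 \<in> carrier E" "g \<in> carrier E" using f0 g by simp_all
  have nz: "f0 \<noteq> \<zero>" "f1 \<noteq> \<zero>" "g \<noteq> \<zero>"
    using skew_nonzero[OF sk(1) fc(1,2)] skew_nonzero[OF sk(2) fc(1,3)] by simp_all
  then have nz': "h \<noteq> \<zero>" "s1 \<noteq> \<zero>" "r1 \<noteq> \<zero>" "h' \<noteq> \<zero>" "s \<noteq> \<zero>" "r \<noteq> \<zero>" using f0 g by auto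
  have sk1: "skew r1 s1" "skew s r"
    using skew_factor[of h s1 r1] skew_factor[of h' s r] sk f0 g skew_sym by auto
  obtain k a b where q': "k \<in> carrier E" "a \<in> P 2" "b \<in> P 2" "f1 = k \<otimes> a" "g = k \<otimes> b"
    using q by (auto simp: quad_related_def)
  have [simp]: "k \<in> carrier E" "a \<in> carrier E" "b \<in> carrier E" using q' P_carrier by blast+
  have b0: "b \<noteq> \<zero>" "a \<noteq> \<zero>" using nz q' by auto
  have 1: "h \<otimes> (r1 \<otimes> (b \<otimes> s)) = h \<otimes> (s1 \<otimes> (a \<otimes> r))"
  proof -
    have "h \<otimes> (r1 \<otimes> (b \<otimes> s)) = b \<otimes> (h \<otimes> r1) \<otimes> s" by (simp add: ring_nf)
    also have "\<dots> = b \<otimes> (k \<otimes> a) \<otimes> s" using f0 q' by simp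
    also have "\<dots> = a \<otimes> (k \<otimes> b) \<otimes> s" by (simp add: ring_nf)
    also have "\<dots> = a \<otimes> (h' \<otimes> r) \<otimes> s" using g q' by simp
    also have "\<dots> = a \<otimes> r \<otimes> (h' \<otimes> s)" by (simp add: ring_nf)
    also have "\<dots> = a \<otimes> r \<otimes> (h \<otimes> s1)" using g f0 by simp
    also have "\<dots> = h \<otimes> (s1 \<otimes> (a \<otimes> r))" by (simp add: ring_nf)
    finally show ?thesis .
  qed
  then have 1: "r1 \<otimes> (b \<otimes> s) = s1 \<otimes> (a \<otimes> r)" using mult_cancel[OF 1 nz'(1)] by simp
  have P4: "b \<otimes> s \<in> P (Suc (Suc 2))" "a \<otimes> r \<in> P (Suc (Suc 2))"
    using P_mult[of b 2 s 2] P_mult[of a 2 r 2] q' P by (simp_all add: numeral_eq_Suc)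
  obtain z where z: "z \<in> P 2" "b \<otimes> s = s1 \<otimes> z" "a \<otimes> r = r1 \<otimes> z"
    by (rule quad_factor_P[OF P(2,1) sk1(1) P4 1])
  have zc [simp]: "z \<in> carrier E" using z P_carrier by blast
  have 2: "r1 \<otimes> z = r \<otimes> a" using z m_comm by simp
  have P2: "z \<in> P (Suc (Suc 0))" "a \<in> P (Suc (Suc 0))" using z q' by (simp_all add: numeral_eq_Suc)
  obtain w where w: "w \<in> P 0" "z = r \<otimes> w" "a = r1 \<otimes> w"
    by (rule quad_factor_P[OF P(2,4) rr P2 2])
  have [simp]: "w \<in> carrier E" "w \<in> K" and w0: "w \<noteq> \<zero>" using w b0 by auto
  have 3: "s \<otimes> b = r \<otimes> (s1 \<otimes> w)"
  proof -
    have "s \<otimes> b = s1 \<otimes> z" using z m_comm by simp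
    also have "\<dots> = r \<otimes> (s1 \<otimes> w)" unfolding w(2) by (simp add: ring_nf)
    finally show ?thesis .
  qed
  have P2': "b \<in> P (Suc (Suc 0))" "s1 \<otimes> w \<in> P (Suc (Suc 0))"
    using q' P P_smult[of w s1 2] m_comm[of s1 w] by (simp_all add: numeral_eq_Suc)
  obtain y where y: "y \<in> P 0" "b = r \<otimes> y" "s1 \<otimes> w = s \<otimes> y"
    by (rule quad_factor_P[OF P(3,4) sk1(2) P2' 3])
  have [simp]: "y \<in> carrier E" "y \<in> K" using y by auto
  have y0: "y \<noteq> \<zero>" using y b0 by auto
  have "s \<otimes> (h \<otimes> y) = h \<otimes> (s \<otimes> y)" by (simp add: ring_nf)
  also have "\<dots> = h \<otimes> (s1 \<otimes> w)" using y by simp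
  also have "\<dots> = (h \<otimes> s1) \<otimes> w" by (simp add: ring_nf)
  also have "\<dots> = (h' \<otimes> s) \<otimes> w" using f0 g by simp
  also have "\<dots> = s \<otimes> (h' \<otimes> w)" by (simp add: ring_nf)
  finally have hy: "h \<otimes> y = h' \<otimes> w" using mult_cancel[of s] nz' by simp
  obtain d where d: "d \<in> K" "d \<otimes> y = \<one>" using K_inv[of y] y0 by auto
  have [simp]: "d \<in> carrier E" using d by simp
  have "f1 = h \<otimes> (d \<otimes> y) \<otimes> r1" unfolding f0 d by simp
  also have "\<dots> = d \<otimes> r1 \<otimes> (h \<otimes> y)" by (simp add: ring_nf)
  also have "\<dots> = h' \<otimes> (d \<otimes> w \<otimes> r1)" unfolding hy by (simp add: ring_nf)
  finally have f1: "f1 = h' \<otimes> (d \<otimes> w \<otimes> r1)" .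
  have "d \<otimes> w \<otimes> r1 \<in> P 2" using P d by simp
  then have "join f0 f1 = (\<lambda>x. h' \<otimes> x) ` P 3" using join_factor[OF g(1) f1 sk(1) h(2) P(3)] by simp
  also have "\<dots> = join f0 g" using join_factor[OF g sk(2) h(2) P(3,4)] by simp
  finally show ?thesis .
qed

text \<open>
  In a class of polynomials with a common join with \<open>f0\<close>, other than the class of \<open>f1\<close>, there are at most
  two pairwise skew ones that are quadratically related to both \<open>f0\<close> and \<open>f1\<close>: their quadratic
  cofactors all share a factor with the quadratic \<open>r1\<close> of \<open>f1\<close>.
\<close>

lemma quad_related_class_bound:
  assumes c: "f0 \<in> carrier E" "f1 \<in> carrier E" "a \<in> carrier E" "b \<in> carrier E" "c \<in> carrier E"
    and sk01: "skew f0 f1" and sk0: "skew f0 a" "skew f0 b" "skew f0 c"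
    and sk: "skew a b" "skew a c" "skew b c"
    and q01: "quad_related f0 f1" and q0: "quad_related f0 a"
    and q1: "quad_related f1 a" "quad_related f1 b" "quad_related f1 c"
    and cl: "join f0 b = join f0 a" "join f0 c = join f0 a" and ne: "join f0 f1 \<noteq> join f0 a"
  shows False
proof -
  obtain h s1 r1 where h: "h \<in> carrier E" "s1 \<in> P 2" "r1 \<in> P 2" "f0 = h \<otimes> s1" "f1 = h \<otimes> r1"
    using q01 by (auto simp: quad_related_def)
  obtain h' s ra where h': "h' \<in> carrier E" "s \<in> P 2" "ra \<in> P 2" "f0 = h' \<otimes> s" "a = h' \<otimes> ra"
    using q0 by (auto simp: quad_related_def)
  obtain rb where rb: "rb \<in> P 2" "b = h' \<otimes> rb"
    using join_class_quad[OF h'(4,5) sk0(1) h'(1-3) c(4) cl(1)] by blast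
  obtain rc where rc: "rc \<in> P 2" "c = h' \<otimes> rc"
    using join_class_quad[OF h'(4,5) sk0(1) h'(1-3) c(5) cl(2)] by blast
  have [simp]: "r1 \<in> carrier E" "ra \<in> carrier E" "rb \<in> carrier E" "rc \<in> carrier E" using h h' rb rc P_carrier by blast+
  have r1: "r1 \<noteq> \<zero>" using skew_nonzero(2)[OF sk01 c(1,2)] h by auto
  have "skew ra rb" "skew ra rc" "skew rb rc"
    using sk skew_factor[of h' ra rb] skew_factor[of h' ra rc] skew_factor[of h' rb rc] h' rb rc by simp_all
  moreover have "\<not> skew r1 ra"
    using two_quad_relations[OF h(4,5) h'(4,5) h(2,3) h'(2,3) h(1) h'(1) sk01 sk0(1) q1(1)] ne by blast
  moreover have "\<not> skew r1 rb"
    using two_quad_relations[OF h(4,5) h'(4) rb(2) h(2,3) h'(2) rb(1) h(1) h'(1) sk01 sk0(2) q1(2)] ne cl by metis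
  moreover have "\<not> skew r1 rc"
    using two_quad_relations[OF h(4,5) h'(4) rc(2) h(2,3) h'(2) rc(1) h(1) h'(1) sk01 sk0(3) q1(3)] ne cl by metis
  ultimately show False using three_skew_quads[OF h(3) r1 h'(3) rb(1) rc(1)] by blast
qed

section \<open>Points of the projective space of polynomials\<close>

text \<open>
  The nonzero constant multiples of a polynomial.
\<close>

definition ray :: "'a \<Rightarrow> 'a set" where
  "ray x = {c \<otimes> x | c. c \<in> K - {\<zero>}}"

text \<open>
  A representative of each class of proportional polynomials, in place of the monic one; it depends only
  on the ray.
\<close>

definition rep :: "'a \<Rightarrow> 'a" where
  "rep x = (SOME y. y \<in> ray x)"

text \<open>
  The points of the projective space of \<open>W\<close>, each given by its representative.
\<close>

definition points :: "'a set \<Rightarrow> 'a set" where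
  "points W = rep ` (W - {\<zero>})"

lemma self_ray: "x \<in> carrier E \<Longrightarrow> x \<in> ray x"
  unfolding ray_def using K_props(3) by (auto intro!: exI[of _ \<one>])

lemma rep_ray: "x \<in> carrier E \<Longrightarrow> rep x \<in> ray x"
  unfolding rep_def using self_ray by (metis someI)

lemma ray_smult: assumes "c \<in> K" "c \<noteq> \<zero>" "x \<in> carrier E" shows "ray (c \<otimes> x) = ray x"
proof -
  obtain d where d: "d \<in> K" "d \<noteq> \<zero>" "d \<otimes> c = \<one>" using K_inv[OF assms(1,2)] by blast
  have "k \<otimes> (c \<otimes> x) \<in> ray x" if "k \<in> K - {\<zero>}" for k
  proof -
    have "k \<otimes> (c \<otimes> x) = (k \<otimes> c) \<otimes> x" using that assms m_assoc by simp
    moreover have "k \<otimes> c \<in> K - {\<zero>}" using that assms integral[of k c] by auto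
    ultimately show ?thesis unfolding ray_def by blast
  qed
  moreover have "k \<otimes> x \<in> ray (c \<otimes> x)" if "k \<in> K - {\<zero>}" for k
  proof -
    have [simp]: "k \<in> carrier E" "d \<in> carrier E" "c \<in> carrier E" "x \<in> carrier E" using that d assms by auto
    have "(k \<otimes> d) \<otimes> (c \<otimes> x) = k \<otimes> (d \<otimes> c) \<otimes> x" by (simp add: ring_nf)
    then have "k \<otimes> x = (k \<otimes> d) \<otimes> (c \<otimes> x)" using d by simp
    moreover have "k \<otimes> d \<in> K - {\<zero>}" using that d integral[of k d] by auto
    ultimately show ?thesis unfolding ray_def by blast
  qed
  ultimately show ?thesis unfolding ray_def[of x] ray_def[of "c \<otimes> x"] by (auto simp: ray_def)
qed

lemma ray_eq: "\<lbrakk>y \<in> ray x; x \<in> carrier E\<rbrakk> \<Longrightarrow> ray y = ray x"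
  using ray_smult by (auto simp: ray_def[of x])

lemma rep_eq: "\<lbrakk>y \<in> ray x; x \<in> carrier E\<rbrakk> \<Longrightarrow> rep y = rep x"
  using ray_eq by (simp add: rep_def)

lemma rep_rep: "x \<in> carrier E \<Longrightarrow> rep (rep x) = rep x"
  using rep_eq rep_ray by blast

lemma ray_nonzero: "\<lbrakk>y \<in> ray x; x \<in> carrier E; x \<noteq> \<zero>\<rbrakk> \<Longrightarrow> y \<noteq> \<zero>"
  by (auto simp: ray_def dest: integral)

lemma card_ray: assumes "x \<in> carrier E" "x \<noteq> \<zero>" shows "card (ray x) = q - 1" "finite (ray x)"
proof -
  have eq: "ray x = (\<lambda>c. c \<otimes> x) ` (K - {\<zero>})" by (auto simp: ray_def)
  have "inj_on (\<lambda>c. c \<otimes> x) (K - {\<zero>})"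
    using assms by (auto intro!: inj_onI simp: m_rcancel)
  then show "card (ray x) = q - 1" "finite (ray x)"
    unfolding eq using finite_K by (simp_all add: card_image)
qed

lemma rep_in_space:
  assumes W: "dimension n K W" and x: "x \<in> W"
  shows "rep x \<in> W"
proof -
  have "x \<in> carrier E" using space_subgroup_props(1)[OF K W] x by blast
  then obtain c where "c \<in> K" "rep x = c \<otimes> x" using rep_ray[of x] by (auto simp: ray_def)
  then show ?thesis using space_subgroup_props(5)[OF K W] x by simp
qed

lemma points_props:
  assumes W: "dimension n K W" and x: "x \<in> points W"
  shows "x \<in> W" "x \<in> carrier E" "x \<noteq> \<zero>" "rep x = x"
proof -
  obtain y where y: "y \<in> W" "y \<noteq> \<zero>" "x = rep y" using x by (auto simp: points_def)
  have yc: "y \<in> carrier E" using y(1) space_subgroup_props(1)[OF K W] by blast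
  show "x \<in> W" using rep_in_space[OF W y(1)] y by simp
  then show "x \<in> carrier E" using space_subgroup_props(1)[OF K W] by blast
  show "x \<noteq> \<zero>" using ray_nonzero[OF rep_ray[OF yc] yc] y by simp
  show "rep x = x" using rep_rep[OF yc] y by simp
qed

lemma points_I: "\<lbrakk>x \<in> W; x \<noteq> \<zero>; rep x = x\<rbrakk> \<Longrightarrow> x \<in> points W"
  unfolding points_def by (metis DiffI image_eqI singletonD)

lemma card_points:
  assumes W: "dimension n K W"
  shows "card (points W) * (q - 1) = q ^ n - 1" "finite (points W)"
proof -
  note WW = card_dimension[OF W]
  have sub: "W \<subseteq> carrier E" and zero: "\<zero> \<in> W" and sm: "\<And>k v. \<lbrakk>k \<in> K; v \<in> W\<rbrakk> \<Longrightarrow> k \<otimes> v \<in> W"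
    using space_subgroup_props(1,2,5)[OF K W] by blast+
  show fin: "finite (points W)" using WW by (simp add: points_def)
  have un: "W - {\<zero>} = (\<Union>y\<in>points W. ray y)"
  proof (intro equalityI subsetI)
    fix x assume x: "x \<in> W - {\<zero>}"
    then have xc: "x \<in> carrier E" using sub by blast
    then have "x \<in> ray (rep x)" using ray_eq[OF rep_ray] self_ray by blast
    then show "x \<in> (\<Union>y\<in>points W. ray y)" using x by (auto simp: points_def)
  next
    fix x assume "x \<in> (\<Union>y\<in>points W. ray y)"
    then obtain y where y: "y \<in> points W" "x \<in> ray y" by blast
    then have "x \<noteq> \<zero>" using ray_nonzero points_props[OF W] by blast
    moreover have "x \<in> W" using y points_props[OF W y(1)] sm by (auto simp: ray_def)
    ultimately show "x \<in> W - {\<zero>}" by simp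
  qed
  have "card (\<Union>y\<in>points W. ray y) = (\<Sum>y\<in>points W. card (ray y))"
  proof (intro card_UN_disjoint fin ballI impI)
    fix x y assume xy: "x \<in> points W" "y \<in> points W" "x \<noteq> y"
    show "ray x \<inter> ray y = {}"
    proof (rule ccontr)
      assume "ray x \<inter> ray y \<noteq> {}"
      then obtain z where "z \<in> ray x" "z \<in> ray y" by blast
      then have "rep x = rep y" using rep_eq points_props[OF W] xy by metis
      then show False using points_props[OF W] xy by metis
    qed
  qed (use card_ray(2) points_props(2,3)[OF W] in simp)
  also have "\<dots> = card (points W) * (q - 1)"
    using card_ray(1) points_props[OF W] by simp
  finally show "card (points W) * (q - 1) = q ^ n - 1"
    using un[symmetric] WW zero by simp
qed

lemma card_points_3: assumes "dimension 3 K W" shows "card (points W) = q\<^sup>2 + q + 1"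
proof -
  obtain p where p: "q = p + 2" using q_ge_2 le_Suc_ex by (metis add.commute)
  have "card (points W) * (p + 1) = (p + 2) ^ 3 - 1" using card_points(1)[OF assms] p by simp
  also have "\<dots> = ((p + 2)\<^sup>2 + (p + 2) + 1) * (p + 1)" by (simp add: eval_nat_numeral algebra_simps)
  finally show ?thesis unfolding p using mult_right_cancel[of "p + 1"] by (metis add_is_0 one_neq_zero)
qed

lemma card_points_2: assumes "dimension 2 K W" shows "card (points W) = q + 1"
proof -
  obtain p where p: "q = p + 2" using q_ge_2 le_Suc_ex by (metis add.commute)
  have "card (points W) * (p + 1) = (p + 2) ^ 2 - 1" using card_points(1)[OF assms] p by simp
  also have "\<dots> = ((p + 2) + 1) * (p + 1)" by (simp add: eval_nat_numeral algebra_simps)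
  finally show ?thesis unfolding p using mult_right_cancel[of "p + 1"] by (metis add_is_0 one_neq_zero)
qed

lemma rep_independent:
  assumes "x \<in> carrier E" "y \<in> carrier E" "x \<noteq> \<zero>" "y \<noteq> \<zero>" "rep x = x" "rep y = y" "x \<noteq> y"
  shows "independent K [x, y]"
  unfolding independent_2[OF assms(1,2)]
proof (intro conjI ballI notI)
  fix k assume k: "k \<in> K" "x = k \<otimes> y"
  then have "k \<noteq> \<zero>" using assms by auto
  then have "x \<in> ray y" using k by (auto simp: ray_def)
  then show False using rep_eq[of x y] assms by simp
qed (use assms in simp)

section \<open>Lines that meet a given line\<close>

lemma independent_shifts: assumes [simp]: "e \<in> carrier E" and e: "e \<noteq> \<zero>"
  shows "independent K [e, T \<otimes> e, T \<otimes> (T \<otimes> e)]" "independent K [e, T \<otimes> e]"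
proof -
  have nz: "T \<otimes> e \<noteq> \<zero>" "T \<otimes> (T \<otimes> e) \<noteq> \<zero>" using integral[of T e] integral[of T "T \<otimes> e"] e by auto
  have 2: "x \<noteq> k \<otimes> (T \<otimes> x)" if "k \<in> K" "x \<in> carrier E" "x \<noteq> \<zero>" for k x
  proof
    assume eq: "x = k \<otimes> (T \<otimes> x)"
    have [simp]: "k \<in> carrier E" "x \<in> carrier E" using that by simp_all
    have "(\<one> \<ominus> T \<otimes> k) \<otimes> x = x \<ominus> k \<otimes> (T \<otimes> x)" by (simp add: ring_nf)
    also have "\<dots> = \<zero>" using eq by simp
    finally show False using integral[of "\<one> \<ominus> T \<otimes> k" x] one_minus_T_nonzero[OF that(1)] that by simp
  qed
  show "independent K [e, T \<otimes> e]" unfolding independent_2[OF assms(1) m_closed[OF T_closed assms(1)]]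
    using 2 nz e by auto
  have 3: "independent K [T \<otimes> e, T \<otimes> (T \<otimes> e)]"
    unfolding independent_2[OF m_closed[OF T_closed assms(1)] m_closed[OF T_closed m_closed[OF T_closed assms(1)]]]
    using 2[of _ "T \<otimes> e"] nz by auto
  have "e \<notin> Span K [T \<otimes> e, T \<otimes> (T \<otimes> e)]"
  proof
    assume "e \<in> Span K [T \<otimes> e, T \<otimes> (T \<otimes> e)]"
    then obtain k l where kl: "k \<in> K" "l \<in> K" "e = k \<otimes> (T \<otimes> e) \<oplus> l \<otimes> (T \<otimes> (T \<otimes> e))" by (auto simp: Span_2)
    have [simp]: "k \<in> carrier E" "l \<in> carrier E" using kl by simp_all
    have "(\<one> \<oplus> T \<otimes> (\<ominus> (k \<oplus> T \<otimes> l))) \<otimes> e = e \<ominus> (k \<otimes> (T \<otimes> e) \<oplus> l \<otimes> (T \<otimes> (T \<otimes> e)))" by (simp add: ring_nf)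
    also have "\<dots> = \<zero>" unfolding kl(3)[symmetric] by simp
    finally have "\<one> \<oplus> T \<otimes> (\<ominus> (k \<oplus> T \<otimes> l)) = \<zero>"
      using integral[of "\<one> \<oplus> T \<otimes> (\<ominus> (k \<oplus> T \<otimes> l))" e] e by simp
    then have "\<one> = \<zero>" by (intro T_not_unit[of \<one> "\<ominus> (k \<oplus> T \<otimes> l)"]) auto
    then show False by simp
  qed
  then show "independent K [e, T \<otimes> e, T \<otimes> (T \<otimes> e)]" using 3 by (subst independent_Cons_iff) simp
qed

lemma dimension_quads: assumes h: "h \<in> carrier E" "h \<noteq> \<zero>"
  shows "dimension 3 K ((\<lambda>x. h \<otimes> x) ` P 2)"
proof -
  have [simp]: "h \<in> carrier E" using h by simp
  have eq: "h \<otimes> (k \<oplus> T \<otimes> (l \<oplus> T \<otimes> m)) = k \<otimes> h \<oplus> (l \<otimes> (T \<otimes> h) \<oplus> m \<otimes> (T \<otimes> (T \<otimes> h)))"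
    if "k \<in> K" "l \<in> K" "m \<in> K" for k l m
  proof -
    have [simp]: "k \<in> carrier E" "l \<in> carrier E" "m \<in> carrier E" using that by auto
    show ?thesis by (simp add: ring_nf)
  qed
  have P2: "P 2 = {k \<oplus> T \<otimes> (l \<oplus> T \<otimes> m) | k l m. k \<in> K \<and> l \<in> K \<and> m \<in> K}"
    by (auto simp: numeral_eq_Suc P.simps(2))
  have "(\<lambda>x. h \<otimes> x) ` P 2 = {h \<otimes> (k \<oplus> T \<otimes> (l \<oplus> T \<otimes> m)) | k l m. k \<in> K \<and> l \<in> K \<and> m \<in> K}"
    unfolding P2 by blast
  also have "\<dots> = {k \<otimes> h \<oplus> (l \<otimes> (T \<otimes> h) \<oplus> m \<otimes> (T \<otimes> (T \<otimes> h))) | k l m. k \<in> K \<and> l \<in> K \<and> m \<in> K}"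
    by (intro Collect_cong) (metis eq)
  also have "\<dots> = Span K [h, T \<otimes> h, T \<otimes> (T \<otimes> h)]"
    unfolding set_eq_iff Span_3[OF h(1) m_closed[OF T_closed h(1)] m_closed[OF T_closed m_closed[OF T_closed h(1)]]] by blast
  finally show ?thesis using dimension_independent[OF independent_shifts(1)[OF h]] by (simp add: numeral_eq_Suc)
qed

text \<open>
  Partial fractions: the quotients of \<open>g\<close>, \<open>x\<close>, \<open>y\<close> and \<open>z\<close> by \<open>f\<close> have linear denominators, of
  which \<open>a\<close> is coprime to its numerator \<open>b\<close> and to the other three.  In a linear relation \<open>a\<close> would
  divide the product of \<open>b\<close>, \<open>ax\<close>, \<open>ay\<close> and \<open>az\<close>.
\<close>

lemma not_skew_span:
  assumes c: "f \<in> carrier E" "g \<in> carrier E" "x \<in> carrier E" "y \<in> carrier E" "z \<in> carrier E"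
    and f0: "f \<noteq> \<zero>"
    and P: "a \<in> P 1" "b \<in> P 1" "ax \<in> P 1" "bx \<in> P 1" "ay \<in> P 1" "b_y \<in> P 1" "az \<in> P 1" "bz \<in> P 1"
    and eq: "a \<otimes> g = b \<otimes> f" "ax \<otimes> x = bx \<otimes> f" "ay \<otimes> y = b_y \<otimes> f" "az \<otimes> z = bz \<otimes> f"
    and ind: "independent K [b, a]" "independent K [ax, a]" "independent K [ay, a]" "independent K [az, a]"
  shows "g \<notin> Span K [x, y, z]"
proof
  assume "g \<in> Span K [x, y, z]"
  then obtain k l m where kl: "k \<in> K" "l \<in> K" "m \<in> K" "g = k \<otimes> x \<oplus> (l \<otimes> y \<oplus> m \<otimes> z)"
    using Span_3[OF c(3-5)] by blast
  have [simp]: "k \<in> carrier E" "l \<in> carrier E" "m \<in> carrier E" "a \<in> carrier E" "b \<in> carrier E"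
    "ax \<in> carrier E" "bx \<in> carrier E" "ay \<in> carrier E" "b_y \<in> carrier E" "az \<in> carrier E" "bz \<in> carrier E"
    "f \<in> carrier E" "g \<in> carrier E" "x \<in> carrier E" "y \<in> carrier E" "z \<in> carrier E"
    using kl(1-3)[THEN K_carrier] P[THEN P_carrier] c by simp_all
  define s where "s = k \<otimes> (ay \<otimes> az \<otimes> bx) \<oplus> (l \<otimes> (ax \<otimes> az \<otimes> b_y) \<oplus> m \<otimes> (ax \<otimes> ay \<otimes> bz))"
  have trip: "u \<otimes> v \<otimes> w \<in> P (Suc 2)" if "u \<in> P 1" "v \<in> P 1" "w \<in> P 1" for u v w
    using P_mult[OF P_mult[OF that(1,2)] that(3)] by (simp add: numeral_eq_Suc)
  have sP: "s \<in> P (Suc 2)" unfolding s_def using kl P trip by simp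
  have [simp]: "s \<in> carrier E" using sP P_carrier by blast
  have "f \<otimes> (b \<otimes> (ax \<otimes> ay \<otimes> az)) = ax \<otimes> ay \<otimes> az \<otimes> (b \<otimes> f)" by (simp add: ring_nf)
  also have "\<dots> = a \<otimes> ax \<otimes> ay \<otimes> az \<otimes> (k \<otimes> x \<oplus> (l \<otimes> y \<oplus> m \<otimes> z))"
    unfolding eq(1)[symmetric] kl(4) by (simp add: ring_nf)
  also have "\<dots> = a \<otimes> (k \<otimes> (ay \<otimes> az \<otimes> (ax \<otimes> x)) \<oplus> (l \<otimes> (ax \<otimes> az \<otimes> (ay \<otimes> y)) \<oplus> m \<otimes> (ax \<otimes> ay \<otimes> (az \<otimes> z))))" by (simp add: ring_nf)
  also have "\<dots> = f \<otimes> (a \<otimes> s)" unfolding eq s_def by (simp add: ring_nf)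
  finally have 1: "b \<otimes> (ax \<otimes> ay \<otimes> az) = a \<otimes> s" using mult_cancel[of f] f0 by simp
  obtain z1 where z1: "z1 \<in> P 2" "ax \<otimes> ay \<otimes> az = a \<otimes> z1"
    by (rule linear_factor_P[OF P(2,1) ind(1) trip[OF P(3,5,7)] sP 1])
  have 2: "ax \<otimes> (ay \<otimes> az) = a \<otimes> z1" using z1 m_assoc by simp
  have "ay \<otimes> az \<in> P (Suc 1)" "z1 \<in> P (Suc 1)" using P_mult[OF P(5,7)] z1(1) by (simp_all add: numeral_eq_Suc)
  then obtain z2 where z2: "z2 \<in> P 1" "ay \<otimes> az = a \<otimes> z2"
    by (rule linear_factor_P[OF P(3,1) ind(2) _ _ 2])
  have "az \<in> P (Suc 0)" "z2 \<in> P (Suc 0)" using P(7) z2 by simp_all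
  then obtain z3 where z3: "z3 \<in> P 0" "az = a \<otimes> z3"
    by (rule linear_factor_P[OF P(5,1) ind(3) _ _ z2(2)])
  have "az = z3 \<otimes> a" using z3 m_comm by simp
  moreover have "z3 \<in> K" using z3(1) by simp
  ultimately show False using ind(4) unfolding independent_2[OF \<open>az \<in> carrier E\<close> \<open>a \<in> carrier E\<close>] by blast
qed

text \<open>
  Proportional denominators would put \<open>f\<close> into the span of \<open>g\<close> and \<open>x\<close>, or make these two
  proportional.
\<close>

lemma forms_independent_of_points:
  assumes W: "dimension n K W" and f: "f \<in> carrier E" "f \<notin> W" "f \<noteq> \<zero>"
    and gx: "g \<in> points W" "x \<in> points W" "g \<noteq> x"
    and P: "a \<in> P 1" "b \<in> P 1" "ax \<in> P 1" "bx \<in> P 1" and nz: "a \<noteq> \<zero>" "ax \<noteq> \<zero>"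
    and eq: "a \<otimes> g = b \<otimes> f" "ax \<otimes> x = bx \<otimes> f"
  shows "independent K [ax, a]"
proof (rule ccontr)
  assume "\<not> independent K [ax, a]"
  note gp = points_props[OF W gx(1)] and xp = points_props[OF W gx(2)]
  have [simp]: "a \<in> carrier E" "b \<in> carrier E" "ax \<in> carrier E" "bx \<in> carrier E" "f \<in> carrier E" "g \<in> carrier E" "x \<in> carrier E"
    using P[THEN P_carrier] f gp(2) xp(2) by simp_all
  obtain k where k: "k \<in> K" "ax = k \<otimes> a"
    using \<open>\<not> independent K [ax, a]\<close> nz unfolding independent_2[OF \<open>ax \<in> carrier E\<close> \<open>a \<in> carrier E\<close>] by blast
  have [simp]: "k \<in> carrier E" using k by simp
  have k0: "k \<noteq> \<zero>" using k nz by auto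
  have indgx: "independent K [g, x]" using rep_independent gp xp gx by blast
  have b0: "bx \<noteq> \<zero>" using eq(2) integral[of ax x] nz xp by auto
  show False
  proof (cases "independent K [b, bx]")
    case True
    obtain c d where cd: "c \<in> K" "d \<in> K" "a = c \<otimes> b \<oplus> d \<otimes> bx"
      using independent_forms_span[OF P(2,4) True P(1)] by blast
    have [simp]: "c \<in> carrier E" "d \<in> carrier E" using cd by simp_all
    have "a \<otimes> f = c \<otimes> (b \<otimes> f) \<oplus> d \<otimes> (bx \<otimes> f)"
    proof -
      have "(c \<otimes> b \<oplus> d \<otimes> bx) \<otimes> f = c \<otimes> (b \<otimes> f) \<oplus> d \<otimes> (bx \<otimes> f)" by (simp add: ring_nf)
      then show ?thesis using cd(3) by simp
    qed
    also have "\<dots> = c \<otimes> (a \<otimes> g) \<oplus> d \<otimes> (k \<otimes> a \<otimes> x)" using eq k by simp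
    also have "\<dots> = a \<otimes> (c \<otimes> g \<oplus> (d \<otimes> k) \<otimes> x)" by (simp add: ring_nf)
    finally have "f = c \<otimes> g \<oplus> (d \<otimes> k) \<otimes> x" using mult_cancel[of a] nz by simp
    also have "\<dots> \<in> W" using space_subgroup_props(3,5)[OF K W] gp(1) xp(1) cd k by simp
    finally show False using f by simp
  next
    case False
    then obtain c where c: "c \<in> K" "b = c \<otimes> bx"
      using b0 unfolding independent_2[OF \<open>b \<in> carrier E\<close> \<open>bx \<in> carrier E\<close>] by blast
    have [simp]: "c \<in> carrier E" using c by simp
    have "a \<otimes> g = c \<otimes> (ax \<otimes> x)" using eq c m_assoc by simp
    also have "\<dots> = a \<otimes> ((c \<otimes> k) \<otimes> x)" unfolding k(2) by (simp add: ring_nf)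
    finally have "g = (c \<otimes> k) \<otimes> x" using mult_cancel[of a] nz by simp
    moreover have "c \<otimes> k \<in> K" using c k by simp
    ultimately show False using indgx unfolding independent_2[OF \<open>g \<in> carrier E\<close> \<open>x \<in> carrier E\<close>] by blast
  qed
qed

text \<open>
  The line of an \<open>f\<close> outside \<open>W\<close> meets the lines of at most three points of \<open>W\<close>, since four of them
  would be independent.
\<close>

lemma card_not_skew:
  assumes W: "dimension n K W" "n \<le> 3" and f: "f \<in> carrier E" "f \<notin> W" "f \<noteq> \<zero>"
  shows "card {g \<in> points W. \<not> skew f g} \<le> 3"
proof (rule ccontr)
  let ?S = "{g \<in> points W. \<not> skew f g}"
  assume "\<not> card ?S \<le> 3"
  then obtain S' where S': "S' \<subseteq> ?S" "card S' = 4" "finite S'"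
    using obtain_subset_with_card_n[of 4 ?S] by auto
  then obtain gs where gs: "distinct gs" "set gs = S'" "length gs = 4"
    using finite_distinct_list by (metis distinct_card)
  then obtain g1 g2 g3 g4 where g: "gs = [g1, g2, g3, g4]" by (auto simp: numeral_eq_Suc length_Suc_conv)
  have mem: "g \<in> points W \<and> \<not> skew f g" if "g \<in> S'" for g using S' that by blast
  have key: "g \<notin> Span K [x, y, z]"
    if S: "g \<in> S'" "x \<in> S'" "y \<in> S'" "z \<in> S'" and ne: "g \<noteq> x" "g \<noteq> y" "g \<noteq> z" for g x y z
  proof -
    have c: "u \<in> carrier E" "u \<noteq> \<zero>" "u \<in> W" if "u \<in> S'" for u using mem[OF that] points_props[OF W(1)] by blast+
    have ex: "\<exists>a b. a \<in> P 1 \<and> b \<in> P 1 \<and> a \<noteq> \<zero> \<and> a \<otimes> u = b \<otimes> f \<and> b \<noteq> \<zero>" if "u \<in> S'" for u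
      using not_skewE[of f u] mem[OF that] c[OF that] f by metis
    obtain a b where A: "a \<in> P 1" "b \<in> P 1" "a \<noteq> \<zero>" "a \<otimes> g = b \<otimes> f" "b \<noteq> \<zero>" using ex[OF S(1)] by blast
    obtain ax bx where X: "ax \<in> P 1" "bx \<in> P 1" "ax \<noteq> \<zero>" "ax \<otimes> x = bx \<otimes> f" using ex[OF S(2)] by blast
    obtain ay b_y where Y: "ay \<in> P 1" "b_y \<in> P 1" "ay \<noteq> \<zero>" "ay \<otimes> y = b_y \<otimes> f" using ex[OF S(3)] by blast
    obtain az bz where Z: "az \<in> P 1" "bz \<in> P 1" "az \<noteq> \<zero>" "az \<otimes> z = bz \<otimes> f" using ex[OF S(4)] by blast
    have "independent K [b, a]"
    proof (rule ccontr)
      have [simp]: "a \<in> carrier E" "b \<in> carrier E" "g \<in> carrier E" "f \<in> carrier E" using A(1,2) c(1)[OF S(1)] f P_carrier by blast+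
      assume "\<not> ?thesis"
      then obtain k where k: "k \<in> K" "b = k \<otimes> a" using A unfolding independent_2[OF \<open>b \<in> carrier E\<close> \<open>a \<in> carrier E\<close>] by blast
      have [simp]: "k \<in> carrier E" using k by simp
      have k0: "k \<noteq> \<zero>" using k A(5) by auto
      have "a \<otimes> g = k \<otimes> a \<otimes> f" using A k by simp
      also have "\<dots> = a \<otimes> (k \<otimes> f)" by (simp add: ring_nf)
      finally have "g = k \<otimes> f" using mult_cancel[of a] A by simp
      then have "k \<otimes> f \<in> W" using c(3)[OF S(1)] by simp
      then have "f \<in> W" using space_subgroup_props(6)[OF K W(1), of k f] k k0 by simp
      then show False using f by simp
    qed
    moreover have "independent K [ax, a]"
      by (rule forms_independent_of_points[OF W(1) f _ _ ne(1) A(1,2) X(1,2) A(3) X(3) A(4) X(4)])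
         (use mem S in blast)+
    moreover have "independent K [ay, a]"
      by (rule forms_independent_of_points[OF W(1) f _ _ ne(2) A(1,2) Y(1,2) A(3) Y(3) A(4) Y(4)])
         (use mem S in blast)+
    moreover have "independent K [az, a]"
      by (rule forms_independent_of_points[OF W(1) f _ _ ne(3) A(1,2) Z(1,2) A(3) Z(3) A(4) Z(4)])
         (use mem S in blast)+
    ultimately show ?thesis
      by (intro not_skew_span[OF f(1) c(1)[OF S(1)] c(1)[OF S(2)] c(1)[OF S(3)] c(1)[OF S(4)] f(3)
            A(1,2) X(1,2) Y(1,2) Z(1,2) A(4) X(4) Y(4) Z(4)])
  qed
  have gS: "g1 \<in> S'" "g2 \<in> S'" "g3 \<in> S'" "g4 \<in> S'" using gs g by auto
  have gc: "g1 \<in> carrier E" "g2 \<in> carrier E" "g3 \<in> carrier E" "g4 \<in> carrier E" "g4 \<noteq> \<zero>"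
    and gW: "g1 \<in> W" "g2 \<in> W" "g3 \<in> W" "g4 \<in> W"
    using gS mem points_props[OF W(1)] by blast+
  have d: "g1 \<noteq> g2" "g1 \<noteq> g3" "g1 \<noteq> g4" "g2 \<noteq> g3" "g2 \<noteq> g4" "g3 \<noteq> g4" using gs g by auto
  have "g1 \<notin> Span K [g2, g3, g4]" using key gS d by blast
  moreover have "g2 \<notin> Span K [g3, g4]"
    using key[of g2 g1 g3 g4] gS d mono_Span[OF K, of "[g3, g4]" g1] gc by auto
  moreover have "g3 \<notin> Span K [g4]"
    using key[of g3 g1 g2 g4] gS d mono_Span[OF K, of "[g2, g4]" g1] mono_Span[OF K, of "[g4]" g2] gc by auto
  moreover have "g4 \<notin> Span K []" using gc by (simp add: Span_Nil)
  ultimately have "independent K [g1, g2, g3, g4]" using gc by (auto intro!: li_Cons)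
  then have "length [g1, g2, g3, g4] \<le> n"
    by (rule independent_length_le_dimension[OF K W(1)]) (use gW in simp)
  then show False using W(2) by simp
qed

end

section \<open>Counting linear functionals\<close>

text \<open>
  A finite \<open>K\<close>-space \<open>A\<close> of linear functionals on \<open>E\<close>, with values in \<open>K\<close>, that separates the points of a
  subspace \<open>V\<close>.
\<close>

locale functional_space = poly_domain +
  fixes V :: "'a set" and A :: "('a \<Rightarrow> 'a) set"
  assumes V_carrier: "V \<subseteq> carrier E"
    and V_add: "\<lbrakk>x \<in> V; y \<in> V\<rbrakk> \<Longrightarrow> x \<oplus> y \<in> V" and V_smult: "\<lbrakk>k \<in> K; x \<in> V\<rbrakk> \<Longrightarrow> k \<otimes> x \<in> V"
    and finite_A: "finite A" and A_nonempty: "A \<noteq> {}" and A_ext: "A \<subseteq> extensional (carrier E)"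
    and A_closed: "\<lbrakk>a \<in> A; x \<in> carrier E\<rbrakk> \<Longrightarrow> a x \<in> K"
    and A_add: "\<lbrakk>a \<in> A; x \<in> carrier E; y \<in> carrier E\<rbrakk> \<Longrightarrow> a (x \<oplus> y) = a x \<oplus> a y"
    and A_smult: "\<lbrakk>a \<in> A; k \<in> K; x \<in> carrier E\<rbrakk> \<Longrightarrow> a (k \<otimes> x) = k \<otimes> a x"
    and A_comb: "\<lbrakk>a \<in> A; b \<in> A; k \<in> K\<rbrakk> \<Longrightarrow> (\<lambda>x\<in>carrier E. a x \<oplus> k \<otimes> b x) \<in> A"
    and A_separates: "\<lbrakk>x \<in> V; x \<noteq> \<zero>\<rbrakk> \<Longrightarrow> \<exists>a\<in>A. a x \<noteq> \<zero>"
begin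

definition annihilator :: "'a list \<Rightarrow> ('a \<Rightarrow> 'a) set" where
  "annihilator xs = {a \<in> A. \<forall>x\<in>set xs. a x = \<zero>}"

text \<open>
  The functionals that vanish on the line of \<open>f\<close>.
\<close>

definition kill :: "'a \<Rightarrow> ('a \<Rightarrow> 'a) set" where
  "kill f = {a \<in> A. a f = \<zero> \<and> a (T \<otimes> f) = \<zero>}"

lemma A_zero: assumes "a \<in> A" shows "a \<zero> = \<zero>"
  using A_smult[OF assms, of \<zero> \<zero>] A_closed[OF assms, of \<zero>] by simp

lemma V_minus: assumes "x \<in> V" "y \<in> V" "k \<in> K" shows "x \<ominus> k \<otimes> y \<in> V"
proof -
  have [simp]: "x \<in> carrier E" "y \<in> carrier E" "k \<in> carrier E" using assms V_carrier by auto
  have "x \<ominus> k \<otimes> y = x \<oplus> (\<ominus> k) \<otimes> y" by (simp add: ring_nf)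
  then show ?thesis using V_add V_smult assms by simp
qed

lemma annihilator_Span:
  assumes "a \<in> A" "set xs \<subseteq> carrier E" "\<forall>x\<in>set xs. a x = \<zero>" "y \<in> Span K xs"
  shows "a y = \<zero>"
  using assms(2-)
proof (induction xs arbitrary: y)
  case Nil then show ?case using A_zero[OF assms(1)] by (simp add: Span_Nil)
next
  case (Cons u us)
  then obtain k v where kv: "k \<in> K" "v \<in> Span K us" "y = k \<otimes> u \<oplus> v" by (auto simp: Span_Cons)
  have "v \<in> carrier E" using kv Span_subgroup_props(1)[OF K, of us] Cons.prems by auto
  then show ?case using kv Cons A_add[OF assms(1)] A_smult[OF assms(1)] by simp
qed

text \<open>
  The extension argument for functionals, by induction on the list.  In the main case there is a functional
  \<open>b\<close> with \<open>b u \<noteq> \<zero>\<close>; let \<open>p'\<close> be \<open>p\<close> corrected by a multiple of \<open>u\<close> so that \<open>b p' = \<zero>\<close>.  If \<open>a\<close> does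
  not vanish at \<open>p'\<close>, then \<open>a\<close> corrected by a multiple of \<open>b\<close> vanishes at \<open>u\<close> and not at \<open>p\<close>.
\<close>

lemma annihilator_separates:
  assumes "set xs \<subseteq> V" "p \<in> V" "p \<notin> Span K xs"
  shows "\<exists>a\<in>annihilator xs. a p \<noteq> \<zero>"
  using assms
proof (induction xs arbitrary: p)
  case Nil then show ?case using A_separates by (auto simp: annihilator_def Span_Nil)
next
  case (Cons u us)
  have c [simp]: "u \<in> carrier E" "p \<in> carrier E" and usc: "set us \<subseteq> carrier E" using Cons.prems V_carrier by auto
  have p: "p \<notin> Span K us" using mono_Span[OF K usc, of u] Cons.prems by auto
  show ?case
  proof (cases "u \<in> Span K us")
    case True
    obtain a where a: "a \<in> annihilator us" "a p \<noteq> \<zero>" using Cons p by auto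
    then have "a u = \<zero>" using annihilator_Span[OF _ usc _ True] by (auto simp: annihilator_def)
    then show ?thesis using a by (auto simp: annihilator_def)
  next
    case False
    obtain b where b: "b \<in> annihilator us" "b u \<noteq> \<zero>" using Cons.IH[of u] Cons.prems False by auto
    then have bA: "b \<in> A" by (simp add: annihilator_def)
    obtain d where d: "d \<in> K" "d \<otimes> b u = \<one>" using K_inv[OF A_closed[OF bA c(1)] b(2)] by blast
    have [simp]: "b u \<in> carrier E" "b p \<in> carrier E" "d \<in> carrier E" "b p \<in> K" "d \<in> K" using A_closed[OF bA] d by simp_all
    define p' where "p' = p \<ominus> (d \<otimes> b p) \<otimes> u"
    have p'V: "p' \<in> V" unfolding p'_def using Cons.prems by (intro V_minus) auto
    have p'c [simp]: "p' \<in> carrier E" using p'V V_carrier by blast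
    have pp: "p = (d \<otimes> b p) \<otimes> u \<oplus> p'"
    proof -
      have [simp]: "(d \<otimes> b p) \<in> carrier E" by simp
      show ?thesis unfolding p'_def using minus_closed[of p "(d \<otimes> b p) \<otimes> u"]
        by (simp add: a_minus_def a_ac(2) a_assoc a_lcomm r_neg)
    qed
    have bp': "b p' = \<zero>"
    proof -
      have "b p = (d \<otimes> b p) \<otimes> b u \<oplus> b p'"
        using A_add[OF bA, of "(d \<otimes> b p) \<otimes> u" p'] A_smult[OF bA, of "d \<otimes> b p" u] pp by simp
      also have "(d \<otimes> b p) \<otimes> b u = b p"
      proof -
        have "(d \<otimes> b p) \<otimes> b u = b p \<otimes> (d \<otimes> b u)" by (simp add: m_ac)
        then show ?thesis using d by simp
      qed
      finally show ?thesis using A_closed[OF bA p'c] by (simp add: K_carrier)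
    qed
    have "p' \<notin> Span K us"
    proof
      assume "p' \<in> Span K us"
      then have "p \<in> Span K (u # us)" unfolding Span_Cons using pp by (intro bexI[of _ "d \<otimes> b p"] bexI[of _ p']) auto
      then show False using Cons.prems by simp
    qed
    then obtain a where a: "a \<in> annihilator us" "a p' \<noteq> \<zero>" using Cons.IH[of p'] p'V Cons.prems by auto
    then have aA: "a \<in> A" by (simp add: annihilator_def)
    have [simp]: "a u \<in> carrier E" "a u \<in> K" using A_closed[OF aA] by simp_all
    define e where "e = (\<lambda>x\<in>carrier E. a x \<oplus> (\<ominus> (a u \<otimes> d)) \<otimes> b x)"
    have eA: "e \<in> A" unfolding e_def by (intro A_comb aA bA) simp
    have "e u = a u \<ominus> a u \<otimes> (d \<otimes> b u)"
      unfolding e_def by (simp add: l_minus m_assoc a_minus_def)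
    then have eu: "e u = \<zero>" using d by simp
    have ep': "e p' = a p'" using bp' A_closed[OF aA p'c] by (simp add: e_def)
    have "e x = \<zero>" if "x \<in> set us" for x
      using that a b usc by (auto simp: e_def annihilator_def)
    then have "e \<in> annihilator (u # us)" using eA eu by (simp add: annihilator_def)
    moreover have "e p = e p'"
      using A_add[OF eA, of "(d \<otimes> b p) \<otimes> u" p'] A_smult[OF eA, of "d \<otimes> b p" u] pp eu A_closed[OF eA p'c] by simp
    ultimately show ?thesis using ep' a(2) by (intro bexI[of _ e]) simp_all
  qed
qed

text \<open>
  Independent conditions have the expected number of solutions.
\<close>

lemma card_annihilator:
  assumes "independent K xs" "set xs \<subseteq> V"
  shows "card (annihilator xs) * q ^ length xs = card A"
  using assms
proof (induction xs rule: list.induct)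
  case Nil then show ?case by (simp add: annihilator_def)
next
  case (Cons p xs)
  have ind: "independent K xs" "p \<notin> Span K xs" "p \<in> V" "set xs \<subseteq> V"
    using Cons.prems by (auto simp: independent_Cons_iff)
  then have pc [simp]: "p \<in> carrier E" using V_carrier by blast
  have xsc: "set xs \<subseteq> carrier E" using ind V_carrier by blast
  obtain a where a: "a \<in> annihilator xs" "a p \<noteq> \<zero>" using annihilator_separates[OF ind(4,3,2)] by blast
  then have aA: "a \<in> A" by (simp add: annihilator_def)
  obtain d where d: "d \<in> K" "d \<otimes> a p = \<one>" using K_inv[OF A_closed[OF aA pc] a(2)] by blast
  have ac [simp]: "x \<in> carrier E \<Longrightarrow> a x \<in> carrier E" for x using A_closed[OF aA] by simp
  have dc [simp]: "d \<in> carrier E" using d by simp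
  define \<phi> where "\<phi> = (\<lambda>(k, b). \<lambda>x\<in>carrier E. b x \<oplus> k \<otimes> a x)"
  have "bij_betw \<phi> (K \<times> annihilator (p # xs)) (annihilator xs)"
    unfolding bij_betw_def
  proof (intro conjI)
    show "inj_on \<phi> (K \<times> annihilator (p # xs))"
    proof (rule inj_onI, clarify)
      fix k b k' b' assume *: "k \<in> K" "b \<in> annihilator (p # xs)" "k' \<in> K" "b' \<in> annihilator (p # xs)" "\<phi> (k, b) = \<phi> (k', b')"
      have bA: "b \<in> A" "b' \<in> A" and b0: "b p = \<zero>" "b' p = \<zero>" using * by (auto simp: annihilator_def)
      have eq: "b x \<oplus> k \<otimes> a x = b' x \<oplus> k' \<otimes> a x" if "x \<in> carrier E" for x
        using fun_cong[OF *(5), of x] that by (simp add: \<phi>_def)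
      have "k \<otimes> a p = k' \<otimes> a p" using eq[OF pc] b0 * by simp
      then have kk: "k = k'" using m_rcancel[OF a(2)] * by simp
      have "b x = b' x" if "x \<in> carrier E" for x
        using eq[OF that] kk * A_closed[OF bA(1) that] A_closed[OF bA(2) that] that by simp
      then have "b = b'" using A_ext bA by (intro extensionalityI[of b "carrier E" b']) auto
      then show "k = k' \<and> b = b'" using kk by simp
    qed
    show "\<phi> ` (K \<times> annihilator (p # xs)) = annihilator xs"
    proof (intro equalityI subsetI)
      fix e assume "e \<in> \<phi> ` (K \<times> annihilator (p # xs))"
      then obtain k b where *: "k \<in> K" "b \<in> annihilator (p # xs)" "e = (\<lambda>x\<in>carrier E. b x \<oplus> k \<otimes> a x)" by (auto simp: \<phi>_def)
      then show "e \<in> annihilator xs" using A_comb[of b a k] aA a xsc by (auto simp: annihilator_def)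
    next
      fix e assume e: "e \<in> annihilator xs"
      then have eA: "e \<in> A" by (simp add: annihilator_def)
      have ec [simp]: "x \<in> carrier E \<Longrightarrow> e x \<in> carrier E" for x using A_closed[OF eA] by simp
      define k where "k = e p \<otimes> d"
      have kK: "k \<in> K" using A_closed[OF eA pc] d by (simp add: k_def)
      then have kc [simp]: "k \<in> carrier E" by simp
      define b where "b = (\<lambda>x\<in>carrier E. e x \<oplus> (\<ominus> k) \<otimes> a x)"
      have bA: "b \<in> A" unfolding b_def using kK by (intro A_comb eA aA) simp
      have "k \<otimes> a p = e p" using d pc by (simp add: k_def m_assoc)
      then have "b p = \<zero>" by (simp add: b_def l_minus r_neg)
      moreover have "b x = \<zero>" if "x \<in> set xs" for x using that e a xsc by (auto simp: b_def annihilator_def)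
      ultimately have bann: "b \<in> annihilator (p # xs)" using bA by (simp add: annihilator_def)
      have "e x = b x \<oplus> k \<otimes> a x" if "x \<in> carrier E" for x
        using that by (simp add: b_def l_minus a_assoc l_neg)
      then have "e = \<phi> (k, b)" using eA A_ext unfolding \<phi>_def
        by (intro extensionalityI[of e "carrier E"]) auto
      then show "e \<in> \<phi> ` (K \<times> annihilator (p # xs))" using kK bann by blast
    qed
  qed
  then have "card (annihilator xs) = q * card (annihilator (p # xs))"
    using bij_betw_same_card by (metis card_cartesian_product)
  then show ?case using Cons.IH ind by (simp add: mult.assoc mult.left_commute)
qed

text \<open>
  The polynomials whose line lies in \<open>V\<close>.
\<close>

abbreviation V' :: "'a set" where "V' \<equiv> {f \<in> V. T \<otimes> f \<in> V}"

lemma V'_carrier: "f \<in> V' \<Longrightarrow> f \<in> carrier E"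
  using V_carrier by blast

lemma finite_kill: "finite (kill f)"
  using finite_A by (simp add: kill_def)

lemma card_kill: assumes "f \<in> V'" "f \<noteq> \<zero>" shows "card (kill f) * q\<^sup>2 = card A"
proof -
  have "f \<in> carrier E" using assms V'_carrier by blast
  moreover have "kill f = annihilator [f, T \<otimes> f]" by (auto simp: kill_def annihilator_def)
  ultimately show ?thesis
    using card_annihilator[OF independent_shifts(2)[of f]] assms by (simp add: numeral_eq_Suc)
qed

lemma card_kill_skew: assumes "f \<in> V'" "g \<in> V'" "skew f g" shows "card (kill f \<inter> kill g) * q ^ 4 = card A"
proof -
  have "f \<in> carrier E" "g \<in> carrier E" using assms V'_carrier by blast+
  moreover have "kill f \<inter> kill g = annihilator [f, T \<otimes> f, g, T \<otimes> g]" by (auto simp: kill_def annihilator_def)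
  ultimately show ?thesis
    using card_annihilator[OF skew_independent[of f g]] assms by (simp add: numeral_eq_Suc)
qed

text \<open>
  Two lines that meet span a space of dimension three, the multiples of some \<open>e\<close> by \<open>P 2\<close>.
\<close>

lemma card_kill_not_skew:
  assumes V': "f \<in> V'" "g \<in> V'" and ind: "independent K [f, g]" and ns: "\<not> skew f g"
  shows "card (kill f \<inter> kill g) * q ^ 3 = card A"
proof -
  have c [simp]: "f \<in> carrier E" "g \<in> carrier E" using V' V'_carrier by blast+
  obtain u v e where *: "u \<in> P 1" "v \<in> P 1" "independent K [u, v]" "e \<in> Span K [f, g]" "T \<otimes> e \<in> Span K [f, g]"
    "f = v \<otimes> e" "g = u \<otimes> e"
    by (rule not_skew_factor[OF c ind ns])
  obtain k l where kl: "k \<in> K" "l \<in> K" "e = k \<otimes> f \<oplus> l \<otimes> g" using *(4) Span_2[OF c] by blast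
  obtain m n where mn: "m \<in> K" "n \<in> K" "T \<otimes> e = m \<otimes> f \<oplus> n \<otimes> g" using *(5) Span_2[OF c] by blast
  have ec [simp]: "e \<in> carrier E" using kl by simp
  have [simp]: "k \<in> carrier E" "l \<in> carrier E" "m \<in> carrier E" "n \<in> carrier E" using kl mn by simp_all
  have TTe: "T \<otimes> (T \<otimes> e) = m \<otimes> (T \<otimes> f) \<oplus> n \<otimes> (T \<otimes> g)" unfolding mn(3) by (simp add: ring_nf)
  have e0: "e \<noteq> \<zero>" using *(6) skew_nonzero ind *(1,2) unfolding independent_2[OF c] by (auto dest: bspec[of _ _ \<zero>])
  have eV: "e \<in> V" "T \<otimes> e \<in> V" "T \<otimes> (T \<otimes> e) \<in> V"
    unfolding TTe unfolding mn(3) unfolding kl(3) using V' kl(1,2) mn(1,2) by (auto intro!: V_add V_smult)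
  have sub: "a (w \<otimes> e) = \<zero> \<and> a (T \<otimes> (w \<otimes> e)) = \<zero>"
    if w: "w \<in> P 1" and a: "a \<in> A" "a e = \<zero>" "a (T \<otimes> e) = \<zero>" "a (T \<otimes> (T \<otimes> e)) = \<zero>" for a w
  proof -
    obtain i j where ij: "i \<in> K" "j \<in> K" "w = i \<oplus> T \<otimes> j" using P1_E[OF w] by blast
    have [simp]: "i \<in> carrier E" "j \<in> carrier E" using ij by simp_all
    have 1: "w \<otimes> e = i \<otimes> e \<oplus> j \<otimes> (T \<otimes> e)" unfolding ij(3) by (simp add: ring_nf)
    have 2: "T \<otimes> (w \<otimes> e) = i \<otimes> (T \<otimes> e) \<oplus> j \<otimes> (T \<otimes> (T \<otimes> e))" unfolding ij(3) by (simp add: ring_nf)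
    have "a (w \<otimes> e) = \<zero>" unfolding 1 using A_add[OF a(1)] A_smult[OF a(1)] ij(1,2) a by simp
    moreover have "a (T \<otimes> (w \<otimes> e)) = \<zero>" unfolding 2 using A_add[OF a(1)] A_smult[OF a(1)] ij(1,2) a by simp
    ultimately show ?thesis ..
  qed
  have "a e = \<zero> \<and> a (T \<otimes> e) = \<zero> \<and> a (T \<otimes> (T \<otimes> e)) = \<zero>" if "a \<in> kill f \<inter> kill g" for a
  proof -
    have a: "a \<in> A" "a f = \<zero>" "a g = \<zero>" "a (T \<otimes> f) = \<zero>" "a (T \<otimes> g) = \<zero>" using that by (auto simp: kill_def)
    show ?thesis unfolding TTe unfolding mn(3) unfolding kl(3)
      using A_add[OF a(1)] A_smult[OF a(1)] kl(1,2) mn(1,2) a by simp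
  qed
  then have 1: "kill f \<inter> kill g \<subseteq> annihilator [e, T \<otimes> e, T \<otimes> (T \<otimes> e)]"
    by (fastforce simp: annihilator_def kill_def)
  have "annihilator [e, T \<otimes> e, T \<otimes> (T \<otimes> e)] \<subseteq> kill f \<inter> kill g"
  proof
    fix a assume "a \<in> annihilator [e, T \<otimes> e, T \<otimes> (T \<otimes> e)]"
    then have a: "a \<in> A" "a e = \<zero>" "a (T \<otimes> e) = \<zero>" "a (T \<otimes> (T \<otimes> e)) = \<zero>" by (simp_all add: annihilator_def)
    show "a \<in> kill f \<inter> kill g"
      using sub[OF *(2) a] sub[OF *(1) a] a(1) unfolding *(6,7)[symmetric] by (simp add: kill_def)
  qed
  with 1 have "kill f \<inter> kill g = annihilator [e, T \<otimes> e, T \<otimes> (T \<otimes> e)]" by (rule equalityI)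
  then show ?thesis
    using card_annihilator[OF independent_shifts(1)[OF ec e0]] eV by (simp add: numeral_eq_Suc)
qed

text \<open>
  The line of \<open>g'\<close> is not inside the join of \<open>f\<close> and \<open>g\<close>, so it adds a fifth condition.
\<close>

lemma card_kill_three:
  assumes V': "f \<in> V'" "g \<in> V'" "g' \<in> V'" and sk: "skew f g" "skew f g'" and ne: "join f g' \<noteq> join f g"
  shows "card (kill f \<inter> kill g \<inter> kill g') * q ^ 5 \<le> card A"
proof -
  have c [simp]: "f \<in> carrier E" "g \<in> carrier E" "g' \<in> carrier E" using V' V'_carrier by blast+
  have "\<exists>x. x \<notin> join f g \<and> x \<in> {g', T \<otimes> g'}"
  proof (rule ccontr)
    assume "\<not> ?thesis"
    then have sub: "g' \<in> join f g" "T \<otimes> g' \<in> join f g" by auto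
    have "join f g' \<subseteq> join f g" unfolding join_def[of f g']
      using sub mem_join[OF c(1,2)] unfolding join_def
      by (intro mono_Span_subset[OF K]) auto
    then show False using dimension_eqI[OF dimension_join dimension_join] sk ne c by blast
  qed
  then obtain x where x: "x \<notin> join f g" "x \<in> {g', T \<otimes> g'}" by blast
  then have "independent K [x, f, T \<otimes> f, g, T \<otimes> g]"
    using skew_independent[OF c(1,2) sk(1)] by (subst independent_Cons_iff) (auto simp: join_def)
  then have "card (annihilator [x, f, T \<otimes> f, g, T \<otimes> g]) * q ^ length [x, f, T \<otimes> f, g, T \<otimes> g] = card A"
    by (rule card_annihilator) (use x V' in auto)
  then have "card (annihilator [x, f, T \<otimes> f, g, T \<otimes> g]) * q ^ 5 = card A" by (simp add: numeral_eq_Suc)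
  moreover have "card (kill f \<inter> kill g \<inter> kill g') \<le> card (annihilator [x, f, T \<otimes> f, g, T \<otimes> g])"
    using x(2) finite_A by (intro card_mono) (auto simp: kill_def annihilator_def)
  ultimately show ?thesis by (metis mult_le_mono1)
qed

lemma kill_smult: assumes "k \<in> K" "k \<noteq> \<zero>" "f \<in> carrier E" shows "kill (k \<otimes> f) = kill f"
proof -
  have "a (k \<otimes> f) = k \<otimes> a f \<and> a (T \<otimes> (k \<otimes> f)) = k \<otimes> a (T \<otimes> f)" if "a \<in> A" for a
    using A_smult[OF that assms(1)] m_lcomm[of T k f] assms by simp
  moreover have "k \<otimes> x = \<zero> \<longleftrightarrow> x = \<zero>" if "x \<in> carrier E" for x
    using integral[of k x] that assms by auto
  moreover have "a f \<in> carrier E" "a (T \<otimes> f) \<in> carrier E" if "a \<in> A" for a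
    using A_closed[OF that] assms by simp_all
  ultimately show ?thesis unfolding kill_def by (intro Collect_cong conj_cong refl) metis+
qed

lemma kill_rep: assumes "f \<in> carrier E" shows "kill (rep f) = kill f"
  using rep_ray[OF assms] kill_smult[OF _ _ assms] by (auto simp: ray_def)

lemma kill_add: assumes "a \<in> kill f" "a \<in> kill g" "k \<in> K" "l \<in> K" "f \<in> carrier E" "g \<in> carrier E"
  shows "a \<in> kill (k \<otimes> f \<oplus> l \<otimes> g)"
proof -
  have [simp]: "k \<in> carrier E" "l \<in> carrier E" "f \<in> carrier E" "g \<in> carrier E" using assms by simp_all
  have a: "a \<in> A" using assms by (simp add: kill_def)
  have "T \<otimes> (k \<otimes> f \<oplus> l \<otimes> g) = k \<otimes> (T \<otimes> f) \<oplus> l \<otimes> (T \<otimes> g)" by (simp add: ring_nf)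
  then show ?thesis using assms A_add[OF a] A_smult[OF a] by (simp add: kill_def)
qed

end

section \<open>Coverings by the functionals that kill a line\<close>

lemma sum_card_swap:
  assumes "finite A" "finite B"
  shows "(\<Sum>a\<in>A. card {b \<in> B. R a b}) = (\<Sum>b\<in>B. card {a \<in> A. R a b})"
proof -
  have c: "card {x \<in> X. S x} = (\<Sum>x\<in>X. if S x then 1 else 0)" if "finite X" for X :: "'x set" and S
    using that by (simp add: sum.If_cases Int_def)
  show ?thesis unfolding c[OF assms(1)] c[OF assms(2)] by (rule sum.swap)
qed

lemma real_sum_card_swap:
  assumes "finite A" "finite B"
  shows "(\<Sum>a\<in>A. real (card {b \<in> B. R a b})) = (\<Sum>b\<in>B. real (card {a \<in> A. R a b}))"
  using arg_cong[OF sum_card_swap[OF assms, of R], of real] by simp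

lemma real_card_UN_le: "finite I \<Longrightarrow> real (card (\<Union>i\<in>I. B i)) \<le> (\<Sum>i\<in>I. real (card (B i)))"
  using of_nat_mono[OF card_UN_le[of I B], where 'a = real] by simp

lemma card_fibres:
  assumes "finite S" shows "card S = (\<Sum>y\<in>f ` S. card {x \<in> S. f x = y})"
  using sum.image_gen[OF assms, of "\<lambda>_. 1 :: nat" f] by simp

text \<open>
  A finite set of points such that each functional vanishes on the line of one of them.
\<close>

locale covering = functional_space +
  fixes F :: "'a set"
  assumes finite_F: "finite F" and F_V': "F \<subseteq> V'" and F_nonzero: "f \<in> F \<Longrightarrow> f \<noteq> \<zero>"
    and F_rep: "f \<in> F \<Longrightarrow> rep f = f"
    and cover: "a \<in> A \<Longrightarrow> \<exists>f\<in>F. a \<in> kill f"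
begin

text \<open>
  The number of functionals; dividing by it turns cardinalities into probabilities.
\<close>

abbreviation M :: real where "M \<equiv> real (card A)"

lemma M_pos: "M > 0"
  using finite_A A_nonempty by (simp add: card_gt_0_iff)

lemma q_pos: "real q > 0" "real q \<noteq> 0"
  using q_ge_2 by simp_all

lemma real_card_kill: assumes "f \<in> V'" "f \<noteq> \<zero>" shows "real (card (kill f)) = M / real q ^ 2"
  using arg_cong[OF card_kill[OF assms], of real] q_pos by (simp add: field_simps)

lemma real_card_kill_skew: assumes "f \<in> V'" "g \<in> V'" "skew f g"
  shows "real (card (kill f \<inter> kill g)) = M / real q ^ 4"
  using arg_cong[OF card_kill_skew[OF assms], of real] q_pos by (simp add: field_simps)

lemma real_card_kill_not_skew: assumes "f \<in> V'" "g \<in> V'" "independent K [f, g]" "\<not> skew f g"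
  shows "real (card (kill f \<inter> kill g)) = M / real q ^ 3"
  using arg_cong[OF card_kill_not_skew[OF assms], of real] q_pos by (simp add: field_simps)

lemma real_card_kill_three: assumes "f \<in> V'" "g \<in> V'" "g' \<in> V'" "skew f g" "skew f g'" "join f g' \<noteq> join f g"
  shows "real (card (kill f \<inter> kill g \<inter> kill g')) \<le> M / real q ^ 5"
proof -
  have "real (card (kill f \<inter> kill g \<inter> kill g') * q ^ 5) \<le> M"
    using card_kill_three[OF assms] of_nat_le_iff by blast
  then show ?thesis using q_pos by (simp add: field_simps)
qed

lemma F_carrier: "f \<in> F \<Longrightarrow> f \<in> carrier E"
  using F_V' V'_carrier by blast

text \<open>
  Given that a functional kills \<open>f\<close>, it kills a point of \<open>W\<close> that is skew to \<open>f\<close> with probability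
  \<open>1 / q^2\<close>, and each of the at most three others with probability \<open>1 / q\<close>.
\<close>

lemma pair_sum_bound:
  assumes f: "f \<in> V'" "f \<noteq> \<zero>" "f \<notin> W" and W: "dimension n K W" "n \<le> 3" "W \<subseteq> V'" and D: "D \<subseteq> points W"
  shows "(\<Sum>g\<in>D. real (card (kill f \<inter> kill g))) \<le> M * (card D / real q ^ 4 + 3 / real q ^ 3)"
proof -
  have finD: "finite D" using D card_points(2)[OF W(1)] finite_subset by blast
  have fc: "f \<in> carrier E" using f(1) V'_carrier by blast
  have ns: "card {g \<in> D. \<not> skew f g} \<le> 3"
  proof -
    have "card {g \<in> D. \<not> skew f g} \<le> card {g \<in> points W. \<not> skew f g}"
      using D card_points(2)[OF W(1)] by (intro card_mono) auto
    also have "\<dots> \<le> 3" by (rule card_not_skew[OF W(1,2) fc f(3,2)])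
    finally show ?thesis .
  qed
  have "(\<Sum>g\<in>D. real (card (kill f \<inter> kill g))) \<le> (\<Sum>g\<in>D. M / real q ^ 4 + (if \<not> skew f g then M / real q ^ 3 else 0))"
  proof (rule sum_mono)
    fix g assume g: "g \<in> D"
    then have gp: "g \<in> points W" using D by blast
    note gg = points_props[OF W(1) gp]
    have gV: "g \<in> V'" using gg W by blast
    have "independent K [f, g]" unfolding independent_2[OF fc gg(2)]
      using gg f(3) space_subgroup_props(5)[OF K W(1)] by metis
    then show "real (card (kill f \<inter> kill g)) \<le> M / real q ^ 4 + (if \<not> skew f g then M / real q ^ 3 else 0)"
      using real_card_kill_skew[OF f(1) gV] real_card_kill_not_skew[OF f(1) gV] by (cases "skew f g") auto
  qed
  also have "\<dots> = card D * (M / real q ^ 4) + card {g \<in> D. \<not> skew f g} * (M / real q ^ 3)"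
    using finD by (simp add: sum.distrib sum.If_cases Int_def)
  also have "\<dots> \<le> card D * (M / real q ^ 4) + 3 * (M / real q ^ 3)"
    using ns M_pos q_pos by (intro add_left_mono mult_right_mono) auto
  also have "\<dots> = M * (card D / real q ^ 4 + 3 / real q ^ 3)" by (simp add: algebra_simps)
  finally show ?thesis .
qed

text \<open>
  In a plane, most functionals that kill a point kill no other one: killing a second point means killing
  a point of a fixed projective line \<open>C\<close> that misses the given point, and \<open>C\<close> has only \<open>q + 1\<close> points.
\<close>

lemma lonely_point_bound:
  assumes U: "dimension 3 K U" "U \<subseteq> V'" and g: "g \<in> points U"
  shows "real (card {a \<in> kill g. \<forall>g'\<in>points U - {g}. a \<notin> kill g'}) \<ge> M * (1 / real q ^ 2 - (q + 1) / real q ^ 4 - 3 / real q ^ 3)"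
proof -
  let ?X = "{a \<in> kill g. \<forall>g'\<in>points U - {g}. a \<notin> kill g'}"
  note gg = points_props[OF U(1) g]
  have gV: "g \<in> V'" using gg U by blast
  have "independent K [g]" using gg independent_1 by simp
  then obtain Vs where Vs: "length (Vs @ [g]) = 3" "independent K (Vs @ [g])" "Span K (Vs @ [g]) = U"
    using complete_base[OF K U(1), of "[g]"] gg by auto
  have V2: "length Vs = 2" "independent K Vs" using Vs independent_split(2)[OF K Vs(2)] by auto
  have Vsc: "set Vs \<subseteq> carrier E" using independent_in_carrier[OF V2(2)] .
  define C where "C = Span K Vs"
  have C: "dimension 2 K C" using dimension_independent[OF V2(2)] V2(1) by (simp add: C_def)
  have CU: "C \<subseteq> U" unfolding C_def Vs(3)[symmetric] using mono_Span_append(1)[OF K Vsc, of "[g]"] gg by simp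
  have gC: "g \<notin> C"
  proof
    assume "g \<in> C"
    moreover have "g \<in> Span K [g]" using Span_base_incl[OF K, of "[g]"] gg by auto
    ultimately show False using independent_split(3)[OF K Vs(2)] gg by (auto simp: C_def)
  qed
  have sub: "kill g - ?X \<subseteq> (\<Union>c\<in>points C. kill g \<inter> kill c)"
  proof
    fix a assume a: "a \<in> kill g - ?X"
    then obtain g' where g': "g' \<in> points U" "g' \<noteq> g" "a \<in> kill g'" by auto
    note g'' = points_props[OF U(1) g'(1)]
    have "g' \<in> Span K (g # Vs)" using g''(1) Vs(3) Span_same_set[OF K, of "g # Vs" "Vs @ [g]"] Vsc gg by auto
    then obtain k c where kc: "k \<in> K" "c \<in> C" "g' = k \<otimes> g \<oplus> c" unfolding Span_Cons C_def by blast
    have cc [simp]: "c \<in> carrier E" "k \<in> carrier E" "g \<in> carrier E" "g' \<in> carrier E"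
      using kc gg g'' space_subgroup_props(1)[OF K C] by auto
    have c0: "c \<noteq> \<zero>"
    proof
      assume "c = \<zero>"
      then have "g' = k \<otimes> g" using kc by simp
      then show False
        using rep_independent[OF g''(2) gg(2) g''(3) gg(3) g''(4) gg(4) g'(2)] kc(1)
        unfolding independent_2[OF g''(2) gg(2)] by blast
    qed
    have "c = \<one> \<otimes> g' \<oplus> (\<ominus> k) \<otimes> g" unfolding kc(3) by (simp add: ring_nf)
    then have "a \<in> kill c" using kill_add[OF g'(3), of g \<one> "\<ominus> k"] a kc(1) by simp
    then have "a \<in> kill (rep c)" using kill_rep by simp
    moreover have "rep c \<in> points C" using kc(2) c0 by (auto simp: points_def)
    ultimately show "a \<in> (\<Union>c\<in>points C. kill g \<inter> kill c)" using a by blast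
  qed
  have "real (card (kill g - ?X)) \<le> real (card (\<Union>c\<in>points C. kill g \<inter> kill c))"
    using sub finite_kill card_points(2)[OF C] by (intro of_nat_mono card_mono) auto
  also have "\<dots> \<le> (\<Sum>c\<in>points C. real (card (kill g \<inter> kill c)))"
    by (rule real_card_UN_le[OF card_points(2)[OF C]])
  also have "\<dots> \<le> M * (card (points C) / real q ^ 4 + 3 / real q ^ 3)"
    by (rule pair_sum_bound[OF gV gg(3) gC C]) (use CU U in auto)
  also have "card (points C) = q + 1" by (rule card_points_2[OF C])
  finally have "real (card (kill g - ?X)) \<le> M * ((q + 1) / real q ^ 4 + 3 / real q ^ 3)" by simp
  moreover have "card (kill g - ?X) = card (kill g) - card ?X" using finite_kill[of g] by (intro card_Diff_subset) auto
  moreover have "card ?X \<le> card (kill g)" using finite_kill by (intro card_mono) auto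
  ultimately have "real (card (kill g)) - real (card ?X) \<le> M * ((q + 1) / real q ^ 4 + 3 / real q ^ 3)" by simp
  then show ?thesis unfolding real_card_kill[OF gV gg(3)] by (simp add: algebra_simps)
qed

text \<open>
  Let \<open>m\<close> points of the plane be missing from \<open>F\<close> and let \<open>r\<close> points of \<open>F\<close> lie outside it.  The bound on
  the size of \<open>F\<close> gives \<open>r < m\<close>.  Most functionals that kill a missing point kill no other point of the
  plane, so one of the \<open>r\<close> outer points has to be killed as well.  But a functional that kills a given
  outer point kills one of the missing points with probability at most \<open>m / q^2 + 3 / q\<close>.  Hence \<open>m\<close> is
  nearly \<open>q^2\<close>.
\<close>

lemma plane_bound:
  assumes U: "dimension 3 K U" "U \<subseteq> V'" and k: "card F \<le> q\<^sup>2 + q"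
  shows "card (F \<inter> U) \<le> 8 * q + 2"
proof (rule ccontr)
  assume big: "\<not> card (F \<inter> U) \<le> 8 * q + 2"
  let ?Q = "points U" and ?D = "points U - F" and ?R = "F - U"
  have finQ: "finite ?Q" using card_points(2)[OF U(1)] .
  have FUQ: "F \<inter> U \<subseteq> ?Q" using F_nonzero F_rep points_I by blast
  have FUQ': "F \<inter> ?Q = F \<inter> U" using FUQ points_props(1)[OF U(1)] by blast
  have cD: "card ?D = q\<^sup>2 + q + 1 - card (F \<inter> U)"
    using card_Diff_subset_Int[of ?Q F] finite_F card_points_3[OF U(1)] FUQ' by (simp add: Int_commute)
  have cFU: "card (F \<inter> U) \<le> q\<^sup>2 + q + 1" using card_mono[OF finQ FUQ] card_points_3[OF U(1)] by simp
  have cR: "card F = card (F \<inter> U) + card ?R" using finite_F by (metis Diff_disjoint Int_Diff_Un Int_Diff_disjoint card_Un_disjoint finite_Diff finite_Int)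
  define m where "m = card ?D"
  define r where "r = card ?R"
  \<comment> \<open>Here the assumed bound on the cardinality of \<open>F\<close> enters.\<close>
  have rm: "r + 1 \<le> m" using cD cFU cR k by (simp add: m_def r_def)
  define X where "X = (\<lambda>g. {a \<in> kill g. \<forall>g'\<in>?Q - {g}. a \<notin> kill g'})"
  define Y where "Y = (\<lambda>f. \<Union>g\<in>?D. kill f \<inter> kill g)"
  have "(\<Sum>g\<in>?D. card (X g)) = card (\<Union>g\<in>?D. X g)"
  proof (rule card_UN_disjoint[symmetric])
    show "finite ?D" using finQ by simp
    show "\<forall>i\<in>?D. finite (X i)" using finite_kill by (auto simp: X_def)
    show "\<forall>i\<in>?D. \<forall>j\<in>?D. i \<noteq> j \<longrightarrow> X i \<inter> X j = {}" by (auto simp: X_def)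
  qed
  also have "\<dots> \<le> card (\<Union>f\<in>?R. Y f)"
  proof (rule card_mono)
    show "finite (\<Union>f\<in>?R. Y f)" using finite_F finQ finite_kill by (auto simp: Y_def)
    show "(\<Union>g\<in>?D. X g) \<subseteq> (\<Union>f\<in>?R. Y f)"
    proof
      fix a assume "a \<in> (\<Union>g\<in>?D. X g)"
      then obtain g where g: "g \<in> ?D" "a \<in> X g" by blast
      then have "a \<in> A" by (simp add: X_def kill_def)
      then obtain f where f: "f \<in> F" "a \<in> kill f" using cover by blast
      have "f \<notin> U" using f g FUQ by (auto simp: X_def)
      then show "a \<in> (\<Union>f\<in>?R. Y f)" using f g by (auto simp: X_def Y_def)
    qed
  qed
  also have "\<dots> \<le> (\<Sum>f\<in>?R. card (Y f))" using finite_F by (intro card_UN_le) auto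
  finally have le: "(\<Sum>g\<in>?D. real (card (X g))) \<le> (\<Sum>f\<in>?R. real (card (Y f)))"
    using of_nat_mono[where 'a = real] by fastforce
  have lower: "m * (M * (1 / real q ^ 2 - (q + 1) / real q ^ 4 - 3 / real q ^ 3)) \<le> (\<Sum>g\<in>?D. real (card (X g)))"
  proof -
    have "(\<Sum>g\<in>?D. M * (1 / real q ^ 2 - (q + 1) / real q ^ 4 - 3 / real q ^ 3)) \<le> (\<Sum>g\<in>?D. real (card (X g)))"
      using lonely_point_bound[OF U] by (intro sum_mono) (auto simp: X_def)
    then show ?thesis by (simp add: m_def)
  qed
  have upper: "(\<Sum>f\<in>?R. real (card (Y f))) \<le> r * (M * (m / real q ^ 4 + 3 / real q ^ 3))"
  proof -
    have "real (card (Y f)) \<le> M * (m / real q ^ 4 + 3 / real q ^ 3)" if f: "f \<in> ?R" for f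
    proof -
      have "real (card (Y f)) \<le> (\<Sum>g\<in>?D. real (card (kill f \<inter> kill g)))"
        unfolding Y_def using finQ by (intro real_card_UN_le) simp
      also have "\<dots> \<le> M * (m / real q ^ 4 + 3 / real q ^ 3)" unfolding m_def
        by (rule pair_sum_bound[OF _ _ _ U(1) _ U(2)]) (use f F_V' F_nonzero in auto)
      finally show ?thesis .
    qed
    then have "(\<Sum>f\<in>?R. real (card (Y f))) \<le> (\<Sum>f\<in>?R. M * (m / real q ^ 4 + 3 / real q ^ 3))" by (rule sum_mono)
    then show ?thesis by (simp add: r_def)
  qed
  have "m * (M * (1 / real q ^ 2 - (q + 1) / real q ^ 4 - 3 / real q ^ 3)) \<le> r * (M * (m / real q ^ 4 + 3 / real q ^ 3))"
    using lower le upper by linarith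
  also have "\<dots> \<le> m * (M * (m / real q ^ 4 + 3 / real q ^ 3))"
    using rm M_pos by (intro mult_right_mono) auto
  finally have "1 / real q ^ 2 - (q + 1) / real q ^ 4 - 3 / real q ^ 3 \<le> m / real q ^ 4 + 3 / real q ^ 3"
    using rm M_pos by simp
  then have "(1 / real q ^ 2 - (q + 1) / real q ^ 4 - 3 / real q ^ 3) * real q ^ 4 \<le> (m / real q ^ 4 + 3 / real q ^ 3) * real q ^ 4"
    by (rule mult_right_mono) simp
  moreover have "1 / real q ^ 2 * real q ^ 4 = real q ^ 2" "x / real q ^ 4 * real q ^ 4 = x"
    "3 / real q ^ 3 * real q ^ 4 = 3 * real q" for x
    using q_pos by (simp_all add: eval_nat_numeral)
  ultimately have "real q ^ 2 - (q + 1) - 3 * real q \<le> m + 3 * real q"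
    unfolding left_diff_distrib distrib_right by simp
  then have "real (q\<^sup>2) \<le> real (m + 7 * q + 1)" by simp
  then have "q\<^sup>2 \<le> m + 7 * q + 1" using of_nat_le_iff by blast
  then show False using big cD cFU by (simp add: m_def)
qed

text \<open>
  The number of members of \<open>F\<close> that a functional kills.
\<close>

definition cover_count :: "('a \<Rightarrow> 'a) \<Rightarrow> nat" where
  "cover_count a = card {f \<in> F. a \<in> kill f}"

text \<open>
  The functionals that kill \<open>f\<close> and another member of \<open>F\<close>.
\<close>

definition excess :: "'a \<Rightarrow> ('a \<Rightarrow> 'a) set" where
  "excess f = {a \<in> kill f. 2 \<le> cover_count a}"

text \<open>
  The members of \<open>F\<close> for which the excess is, by a constant factor less than one, smaller than the
  \<open>M / q^3\<close> functionals that kill two lines that meet.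
\<close>

definition good :: "'a set" where
  "good = {f \<in> F. real (card (excess f)) < 0.99 * M / real q ^ 3}"

lemma cover_count_pos: assumes "a \<in> A" shows "1 \<le> cover_count a"
proof -
  obtain f where "f \<in> F" "a \<in> kill f" using cover[OF assms] by blast
  then have "{f \<in> F. a \<in> kill f} \<noteq> {}" by blast
  then show ?thesis using finite_F by (simp add: cover_count_def Suc_le_eq card_gt_0_iff)
qed

lemma sum_cover_count: "(\<Sum>a\<in>A. real (cover_count a)) = card F * M / real q ^ 2"
proof -
  have "(\<Sum>a\<in>A. real (cover_count a)) = (\<Sum>f\<in>F. real (card {a \<in> A. a \<in> kill f}))"
    unfolding cover_count_def by (rule real_sum_card_swap[OF finite_A finite_F])
  also have "\<dots> = (\<Sum>f\<in>F. real (card (kill f)))"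
    by (intro sum.cong refl arg_cong[of _ _ "\<lambda>X. real (card X)"]) (auto simp: kill_def)
  also have "\<dots> = (\<Sum>f\<in>F. M / real q ^ 2)" using F_V' F_nonzero real_card_kill by (intro sum.cong refl) blast
  finally show ?thesis by simp
qed

lemma card_F_ge: "real q ^ 2 \<le> card F"
proof -
  have "M = (\<Sum>a\<in>A. 1)" by simp
  also have "\<dots> \<le> (\<Sum>a\<in>A. real (cover_count a))" using cover_count_pos by (intro sum_mono) (metis of_nat_1 of_nat_mono)
  also have "\<dots> = card F * M / real q ^ 2" by (rule sum_cover_count)
  finally show ?thesis using M_pos q_pos by (simp add: field_simps)
qed

text \<open>
  A functional that kills \<open>n \<ge> 2\<close> members of \<open>F\<close> is counted \<open>n \<le> 2 * (n - 1)\<close> times on the left.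
\<close>

lemma sum_excess: "(\<Sum>f\<in>F. real (card (excess f))) \<le> 2 * (card F * M / real q ^ 2 - M)"
proof -
  have "(\<Sum>f\<in>F. real (card (excess f))) = (\<Sum>f\<in>F. real (card {a \<in> A. a \<in> excess f}))"
    by (intro sum.cong refl arg_cong[of _ _ "\<lambda>X. real (card X)"]) (auto simp: kill_def excess_def)
  also have "\<dots> = (\<Sum>a\<in>A. real (card {f \<in> F. a \<in> excess f}))" by (rule real_sum_card_swap[OF finite_F finite_A])
  also have "\<dots> \<le> (\<Sum>a\<in>A. 2 * (real (cover_count a) - 1))"
  proof (rule sum_mono)
    fix a assume "a \<in> A"
    then have 1: "1 \<le> cover_count a" by (rule cover_count_pos)
    show "real (card {f \<in> F. a \<in> excess f}) \<le> 2 * (real (cover_count a) - 1)"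
    proof (cases "2 \<le> cover_count a")
      case True
      then have "{f \<in> F. a \<in> excess f} = {f \<in> F. a \<in> kill f}" by (auto simp: excess_def)
      then show ?thesis using True by (simp add: cover_count_def)
    next
      case False
      then have "{f \<in> F. a \<in> excess f} = {}" by (auto simp: excess_def)
      then show ?thesis using 1 by (simp only: card.empty) simp
    qed
  qed
  also have "\<dots> = 2 * (card F * M / real q ^ 2 - M)"
    by (simp add: sum_distrib_left[symmetric] sum_subtractf sum_cover_count)
  finally show ?thesis .
qed

lemma finite_good: "finite good"
  using finite_F by (simp add: good_def)

text \<open>
  The inequality \<open>2 * 0.4877 < 0.99\<close> leaves a positive proportion of good points.
\<close>

lemma card_good:
  assumes k: "real (card F) \<le> real q ^ 2 + 0.4877 * real q"
  shows "0.01 * real q ^ 2 \<le> card good"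
proof -
  have "real (card (F - good)) * (0.99 * M / real q ^ 3) = (\<Sum>f\<in>F - good. 0.99 * M / real q ^ 3)" by simp
  also have "\<dots> \<le> (\<Sum>f\<in>F - good. real (card (excess f)))" by (intro sum_mono) (auto simp: good_def)
  also have "\<dots> \<le> (\<Sum>f\<in>F. real (card (excess f)))" using finite_F by (intro sum_mono2) auto
  also have "\<dots> \<le> 2 * (card F * M / real q ^ 2 - M)" by (rule sum_excess)
  also have "\<dots> \<le> 2 * ((real q ^ 2 + 0.4877 * real q) * M / real q ^ 2 - M)"
    using k M_pos q_pos by (intro mult_left_mono diff_right_mono divide_right_mono mult_right_mono) auto
  also have "\<dots> = 0.9754 * M / real q" using q_pos by (simp add: field_simps eval_nat_numeral)
  finally have "real (card (F - good)) * (0.99 * M / real q ^ 3) * (real q ^ 3 / M) \<le> 0.9754 * M / real q * (real q ^ 3 / M)"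
    using M_pos q_pos by (intro mult_right_mono) auto
  then have 1: "real (card (F - good)) * 0.99 \<le> 0.9754 * real q ^ 2"
    using M_pos q_pos by (simp add: field_simps eval_nat_numeral)
  have "good \<subseteq> F" by (auto simp: good_def)
  then have "card (F - good) = card F - card good" "card good \<le> card F"
    using finite_F by (auto intro: card_Diff_subset card_mono finite_subset)
  then have "real (card (F - good)) = real (card F) - real (card good)" by simp
  moreover have "0.01 * x \<le> c" if "b = a - c" "b * 0.99 \<le> 0.9754 * x" "x \<le> a" "0 \<le> x" for a b c x :: real
    using that by simp
  ultimately show ?thesis using 1 card_F_ge zero_le_power2 by blast
qed

lemma good_F: "f \<in> good \<Longrightarrow> f \<in> F"
  by (simp add: good_def)

lemma two_killed: assumes "f \<in> F" "g \<in> F" "f \<noteq> g" "a \<in> kill f" "a \<in> kill g" shows "a \<in> excess f"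
proof -
  have "card {f, g} \<le> cover_count a" unfolding cover_count_def using assms finite_F by (intro card_mono) auto
  then show ?thesis using assms by (simp add: excess_def)
qed

lemma F_independent: assumes "f \<in> F" "g \<in> F" "f \<noteq> g" shows "independent K [f, g]"
  using rep_independent[OF F_carrier F_carrier] F_nonzero F_rep assms by blast

lemma good_skew: assumes f: "f \<in> good" and g: "g \<in> F" "g \<noteq> f" shows "skew f g"
proof (rule ccontr)
  assume "\<not> skew f g"
  then have "M / real q ^ 3 = real (card (kill f \<inter> kill g))"
    using real_card_kill_not_skew[of f g] F_V' F_independent[OF good_F[OF f] g(1)] good_F[OF f] g by (simp add: subset_iff)
  also have "\<dots> \<le> real (card (excess f))"
  proof (intro of_nat_mono card_mono)
    show "finite (excess f)" using finite_kill[of f] by (simp add: excess_def)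
    show "kill f \<inter> kill g \<subseteq> excess f" using two_killed good_F[OF f] g by blast
  qed
  also have "\<dots> < 0.99 * M / real q ^ 3" using f by (simp add: good_def)
  finally show False using M_pos q_pos by (simp add: field_simps)
qed

text \<open>
  A second moment estimate.  Among the functionals that kill \<open>f\<close>, the number \<open>X\<close> of members of \<open>D\<close> that
  are killed has mean \<open>t / q^2\<close> and second moment at most \<open>t / q^2 + t^2 / q^3\<close>, because different joins
  impose at least one further condition.  Hence \<open>X > 0\<close> has probability at least
  \<open>(t / (q + t)) / q\<close>, which exceeds the excess of a good point unless \<open>t\<close> is less than \<open>99 * q\<close>.
\<close>

lemma class_bound_inj:
  assumes f: "f \<in> good" and D: "D \<subseteq> F - {f}" and inj: "inj_on (join f) D"
  shows "real (card D) < 99 * q"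
proof -
  have finD: "finite D" using D finite_F finite_subset by blast
  define t where "t = real (card D)"
  \<comment> \<open>The value of \<open>l\<close> that maximises \<open>2 l m - l^2 v\<close> for the two moments \<open>m\<close> and \<open>v\<close>.\<close>
  define l where "l = real q / (real q + t)"
  define X where "X = (\<lambda>a. real (card {g \<in> D. a \<in> kill g}))"
  have t0: "t \<ge> 0" by (simp add: t_def)
  have fV: "f \<in> V'" using F_V' good_F[OF f] by blast
  have gV: "g \<in> V'" "skew f g" if "g \<in> D" for g using that D F_V' good_skew[OF f] by auto
  have S1: "(\<Sum>a\<in>kill f. X a) = t * M / real q ^ 4"
  proof -
    have "(\<Sum>a\<in>kill f. X a) = (\<Sum>g\<in>D. real (card {a \<in> kill f. a \<in> kill g}))"
      unfolding X_def by (rule real_sum_card_swap[OF finite_kill finD])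
    also have "\<dots> = (\<Sum>g\<in>D. M / real q ^ 4)"
      using real_card_kill_skew[OF fV] gV by (intro sum.cong refl) (simp add: Int_def)
    finally show ?thesis by (simp add: t_def)
  qed
  have S2: "(\<Sum>a\<in>kill f. (X a)\<^sup>2) \<le> t * M / real q ^ 4 + t\<^sup>2 * M / real q ^ 5"
  proof -
    have sq: "(X a)\<^sup>2 = real (card {p \<in> D \<times> D. a \<in> kill (fst p) \<and> a \<in> kill (snd p)})" for a
    proof -
      have "{p \<in> D \<times> D. a \<in> kill (fst p) \<and> a \<in> kill (snd p)} = {g \<in> D. a \<in> kill g} \<times> {g \<in> D. a \<in> kill g}" by auto
      then show ?thesis unfolding X_def by (simp only: card_cartesian_product of_nat_mult power2_eq_square)
    qed
    have "(\<Sum>a\<in>kill f. (X a)\<^sup>2) = (\<Sum>p\<in>D \<times> D. real (card {a \<in> kill f. a \<in> kill (fst p) \<and> a \<in> kill (snd p)}))"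
      unfolding sq by (rule real_sum_card_swap) (use finite_kill finD in auto)
    also have "\<dots> = (\<Sum>g\<in>D. \<Sum>g'\<in>D. real (card {a \<in> kill f. a \<in> kill g \<and> a \<in> kill g'}))"
      by (simp add: sum.cartesian_product case_prod_unfold)
    also have "\<dots> \<le> (\<Sum>g\<in>D. \<Sum>g'\<in>D. M / real q ^ 5 + (if g' = g then M / real q ^ 4 else 0))"
    proof (intro sum_mono)
      fix g g' assume gg: "g \<in> D" "g' \<in> D"
      have eq: "{a \<in> kill f. a \<in> kill g \<and> a \<in> kill g'} = kill f \<inter> kill g \<inter> kill g'" by auto
      show "real (card {a \<in> kill f. a \<in> kill g \<and> a \<in> kill g'}) \<le> M / real q ^ 5 + (if g' = g then M / real q ^ 4 else 0)"
      proof (cases "g' = g")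
        case True
        then show ?thesis unfolding eq using real_card_kill_skew[OF fV gV(1)[OF gg(1)] gV(2)[OF gg(1)]] M_pos by (simp add: Int_assoc)
      next
        case False
        then have "join f g' \<noteq> join f g" using inj gg by (auto dest: inj_onD)
        then show ?thesis unfolding eq using real_card_kill_three[OF fV] gV gg False by simp
      qed
    qed
    also have "\<dots> = t * (t * (M / real q ^ 5) + M / real q ^ 4)" using finD by (simp add: sum.distrib t_def)
    also have "\<dots> = t * M / real q ^ 4 + t\<^sup>2 * M / real q ^ 5" by (simp add: algebra_simps power2_eq_square)
    finally show ?thesis .
  qed
  have "2 * l * (t * M / real q ^ 4) - l\<^sup>2 * (t * M / real q ^ 4 + t\<^sup>2 * M / real q ^ 5)
      \<le> 2 * l * (\<Sum>a\<in>kill f. X a) - l\<^sup>2 * (\<Sum>a\<in>kill f. (X a)\<^sup>2)"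
    unfolding S1 using S2 by (intro diff_left_mono mult_left_mono) auto
  also have "\<dots> = (\<Sum>a\<in>kill f. 2 * l * X a - l\<^sup>2 * (X a)\<^sup>2)"
    by (simp add: sum_distrib_left sum_subtractf)
  also have "\<dots> \<le> (\<Sum>a\<in>kill f. if a \<in> excess f then 1 else 0)"
  proof (rule sum_mono)
    fix a assume a: "a \<in> kill f"
    show "2 * l * X a - l\<^sup>2 * (X a)\<^sup>2 \<le> (if a \<in> excess f then 1 else 0)"
    proof (cases "\<exists>g\<in>D. a \<in> kill g")
      case True
      then have "a \<in> excess f" using two_killed[OF good_F[OF f]] a D by blast
      moreover have "0 \<le> (1 - l * X a)\<^sup>2" by simp
      ultimately show ?thesis by (simp add: power2_eq_square algebra_simps)
    next
      case False
      then have e: "{g \<in> D. a \<in> kill g} = {}" by blast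
      have "X a = 0" unfolding X_def e by simp
      then show ?thesis by simp
    qed
  qed
  also have "\<dots> = real (card (excess f))"
    using finite_kill[of f] by (simp add: sum.If_cases Int_def excess_def)
  also have "\<dots> < 0.99 * M / real q ^ 3" using f by (simp add: good_def)
  finally have lt: "2 * l * (t * M / real q ^ 4) - l\<^sup>2 * (t * M / real q ^ 4 + t\<^sup>2 * M / real q ^ 5) < 0.99 * M / real q ^ 3" .
  have qt: "real q + t > 0" using q_pos t0 by simp
  have "2 * l * (t * M / real q ^ 4) - l\<^sup>2 * (t * M / real q ^ 4 + t\<^sup>2 * M / real q ^ 5)
     = l * (t * M / real q ^ 4) * (2 - l * ((real q + t) / real q))"
    using q_pos by (simp add: field_simps eval_nat_numeral)
  also have "l * ((real q + t) / real q) = 1" using q_pos qt by (simp add: l_def)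
  finally have "l * (t * M / real q ^ 4) < 0.99 * M / real q ^ 3" using lt by simp
  then have "t / (real q + t) * (M / real q ^ 3) < 0.99 * (M / real q ^ 3)"
    using q_pos by (simp add: l_def eval_nat_numeral divide_simps)
  then have "t / (real q + t) < 0.99" by (rule mult_right_less_imp_less) (use M_pos q_pos in simp)
  then have "t < 0.99 * (real q + t)" using qt by (simp add: divide_less_eq)
  then show ?thesis by (simp add: t_def)
qed

lemma class_bound:
  assumes f: "f \<in> good" and D: "D \<subseteq> F - {f}"
  shows "real (card (join f ` D)) < 99 * q"
proof -
  obtain D' where "D' \<subseteq> D" "inj_on (join f) D'" "join f ` D = join f ` D'"
    using subset_image_inj[of "join f ` D" "join f" D] by auto
  then show ?thesis using class_bound_inj[OF f, of D'] D by (auto simp: card_image)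
qed

section \<open>Geometry of the good polynomials\<close>

lemma V_Span: assumes "set xs \<subseteq> V" "xs \<noteq> []" shows "Span K xs \<subseteq> V"
  using assms
proof (induction xs)
  case (Cons u us)
  have c: "u \<in> carrier E" using Cons.prems V_carrier by auto
  show ?case
  proof (cases "us = []")
    case True
    then show ?thesis using Cons.prems Span_1[OF c] V_smult by auto
  next
    case False
    then have "Span K us \<subseteq> V" "u \<in> V" using Cons by simp_all
    then show ?thesis using V_add V_smult unfolding subset_iff Span_Cons by blast
  qed
qed simp

lemma V'_Span:
  assumes "set xs \<subseteq> V'" "xs \<noteq> []" shows "Span K xs \<subseteq> V'"
proof
  fix y assume y: "y \<in> Span K xs"
  have xs: "set xs \<subseteq> V" "set (map (\<lambda>x. T \<otimes> x) xs) \<subseteq> V" "set xs \<subseteq> carrier E" using assms V_carrier by auto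
  have "T \<otimes> y \<in> Span K (map (\<lambda>x. T \<otimes> x) xs)" using y xs(3)
  proof (induction xs arbitrary: y)
    case Nil then show ?case by (simp add: Span_Nil)
  next
    case (Cons u us)
    then obtain k v where kv: "k \<in> K" "v \<in> Span K us" "y = k \<otimes> u \<oplus> v" by (auto simp: Span_Cons)
    have [simp]: "k \<in> carrier E" "u \<in> carrier E" "v \<in> carrier E"
      using kv Cons.prems Span_subgroup_props(1)[OF K, of us] by auto
    have "T \<otimes> y = k \<otimes> (T \<otimes> u) \<oplus> T \<otimes> v" unfolding kv(3) by (simp add: ring_nf)
    moreover have "T \<otimes> v \<in> Span K (map (\<lambda>x. T \<otimes> x) us)" using Cons.IH[OF kv(2)] Cons.prems by simp
    ultimately show ?case using kv(1) by (auto simp: Span_Cons)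
  qed
  then show "y \<in> V'" using y V_Span[OF xs(1) assms(2)] V_Span[OF xs(2)] assms(2) by auto
qed

lemma quad_plane_V':
  assumes fV: "f \<in> V'" "g \<in> V'" and sk: "skew f g" and fg: "f = h \<otimes> r" "g = h \<otimes> s"
    and h: "h \<in> carrier E" "r \<in> P 2" "s \<in> P 2"
  shows "(\<lambda>x. h \<otimes> x) ` P 2 \<subseteq> V'"
proof -
  have "join f g \<subseteq> V" unfolding join_def using fV by (intro V_Span) auto
  then have V3: "(\<lambda>x. h \<otimes> x) ` P 3 \<subseteq> V" unfolding join_factor[OF fg sk h] .
  have "h \<otimes> x \<in> V \<and> T \<otimes> (h \<otimes> x) \<in> V" if "x \<in> P 2" for x
  proof -
    have "x \<in> P 3" "T \<otimes> x \<in> P 3" using that P_Suc_mono[of x 2] P_T[of x 2] by (simp_all add: numeral_eq_Suc)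
    moreover have "T \<otimes> (h \<otimes> x) = h \<otimes> (T \<otimes> x)" using that h by (intro m_lcomm) auto
    ultimately show ?thesis using V3 by auto
  qed
  then show ?thesis by blast
qed

lemma good_carrier: "f \<in> good \<Longrightarrow> f \<in> carrier E" "f \<in> good \<Longrightarrow> f \<in> V'"
  using good_F F_carrier F_V' by blast+

text \<open>
  The class of \<open>f1\<close> lies in a plane, so it has at most \<open>8 * q + 2\<close> members.  Each of the fewer than
  \<open>99 * q\<close> other classes contributes at most two.
\<close>

lemma card_both_quad_related:
  assumes k: "card F \<le> q\<^sup>2 + q"
    and f: "f0 \<in> good" "f1 \<in> good" "f0 \<noteq> f1" and q01: "quad_related f0 f1"
  shows "real (card {g \<in> good - {f0, f1}. quad_related f0 g \<and> quad_related f1 g}) \<le> 206 * real q + 2"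
proof -
  let ?S = "{g \<in> good - {f0, f1}. quad_related f0 g \<and> quad_related f1 g}"
  let ?S1 = "{g \<in> ?S. join f0 g = join f0 f1}" and ?S2 = "{g \<in> ?S. join f0 g \<noteq> join f0 f1}"
  have fin: "finite ?S" using finite_good by simp
  have sk: "skew g g'" if "g \<in> good" "g' \<in> good" "g \<noteq> g'" for g g' using good_skew[of g g'] good_F that by blast
  have sk01: "skew f0 f1" using sk f by blast
  have 1: "card ?S1 \<le> 8 * q + 2"
  proof -
    obtain h r s where h: "h \<in> carrier E" "r \<in> P 2" "s \<in> P 2" "f0 = h \<otimes> r" "f1 = h \<otimes> s"
      using q01 by (auto simp: quad_related_def)
    let ?U = "(\<lambda>x. h \<otimes> x) ` P 2"
    have h0: "h \<noteq> \<zero>" using h F_nonzero good_F f by (metis P_carrier l_null)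
    have "?S1 \<subseteq> F \<inter> ?U"
      using join_class_quad[OF h(4,5) sk01 h(1-3)] good_carrier good_F by auto
    then have "card ?S1 \<le> card (F \<inter> ?U)" using finite_F by (intro card_mono) auto
    also have "\<dots> \<le> 8 * q + 2"
      using quad_plane_V'[OF _ _ sk01 h(4,5) h(1-3)] good_carrier f
      by (intro plane_bound[OF dimension_quads[OF h(1) h0] _ k]) blast
    finally show ?thesis .
  qed
  have fib: "card {g \<in> ?S2. join f0 g = y} \<le> 2" for y
  proof (rule ccontr)
    assume "\<not> ?thesis"
    then obtain B where B: "B \<subseteq> {g \<in> ?S2. join f0 g = y}" "card B = 3"
      using obtain_subset_with_card_n[of 3 "{g \<in> ?S2. join f0 g = y}"] by auto
    then obtain a b c where abc: "B = {a, b, c}" "a \<noteq> b" "a \<noteq> c" "b \<noteq> c" by (auto simp: card_3_iff)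
    have G: "a \<in> good" "b \<in> good" "c \<in> good" and ne: "a \<noteq> f0" "b \<noteq> f0" "c \<noteq> f0"
      and j: "join f0 a = y" "join f0 b = y" "join f0 c = y" "join f0 f1 \<noteq> y"
      and qr: "quad_related f0 a" "quad_related f1 a" "quad_related f1 b" "quad_related f1 c"
      using B abc by auto
    show False
      by (rule quad_related_class_bound[of f0 f1 a b c])
        (use G ne j qr abc sk f q01 good_carrier(1) in auto)
  qed
  have 2: "real (card ?S2) \<le> 198 * real q"
  proof -
    have fin2: "finite ?S2" using finite_good by simp
    have "card ?S2 = (\<Sum>y\<in>join f0 ` ?S2. card {g \<in> ?S2. join f0 g = y})" by (rule card_fibres[OF fin2])
    also have "\<dots> \<le> (\<Sum>y\<in>join f0 ` ?S2. 2)" by (intro sum_mono fib)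
    finally have "card ?S2 \<le> 2 * card (join f0 ` ?S2)" by simp
    moreover have "real (card (join f0 ` ?S2)) < 99 * q" using good_F by (intro class_bound[OF f(1)]) auto
    ultimately show ?thesis by linarith
  qed
  have "?S = ?S1 \<union> ?S2" by blast
  then have "card ?S \<le> card ?S1 + card ?S2" by (rule ord_eq_le_trans[OF arg_cong[of _ _ card] card_Un_le])
  then show ?thesis using 1 2 by linarith
qed

text \<open>
  The joins with \<open>f0\<close> and with \<open>f1\<close> determine a point \<open>g\<close> that is not quadratically related to them, as
  the intersection of two projective lines.  Both joins also determine the plane through \<open>f0\<close>,
  \<open>f1\<close> and \<open>g\<close>.  A plane with \<open>x\<close> joins of the first kind and \<open>y\<close> of the second therefore
  contains at most \<open>x * y\<close> of the points, and at most \<open>8 * q + 2\<close> by \<open>plane_bound\<close>, while the sums of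
  all \<open>x\<close> and of all \<open>y\<close> are less than \<open>99 * q\<close>.  The parameter \<open>s\<close> separates planes with few
  and with many joins.
\<close>

lemma card_neither_quad_related:
  assumes k: "card F \<le> q\<^sup>2 + q"
    and f: "f0 \<in> good" "f1 \<in> good" "f0 \<noteq> f1" and s: "s > 0"
  shows "real (card {g \<in> good - {f0, f1}. \<not> quad_related f0 g \<and> \<not> quad_related f1 g})
    \<le> q + 1 + 99 * real q * (s + (8 * q + 2) / s)"
proof -
  let ?S = "{g \<in> good - {f0, f1}. \<not> quad_related f0 g \<and> \<not> quad_related f1 g}"
  define L where "L = Span K [f0, f1]"
  define D where "D = ?S - L"
  define pl where "pl = (\<lambda>g. Span K [g, f0, f1])"
  have fin: "finite ?S" "finite D" using finite_good by (simp_all add: D_def)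
  have c [simp]: "f0 \<in> carrier E" "f1 \<in> carrier E" using f good_carrier by blast+
  have Dp: "g \<in> good" "g \<noteq> f0" "g \<noteq> f1" "\<not> quad_related f0 g" "\<not> quad_related f1 g" "g \<notin> L" "g \<in> carrier E"
    if "g \<in> D" for g using that good_carrier by (auto simp: D_def)
  have ind: "independent K [f0, f1]" using F_independent good_F f by blast
  have sk: "skew f g" if "f \<in> {f0, f1}" "g \<in> D" for f g
    using that Dp[OF that(2)] f good_skew[of f g] good_F by auto
  have L: "card (?S \<inter> L) \<le> q + 1"
  proof -
    have dim: "dimension 2 K L" using dimension_independent[OF ind] by (simp add: L_def numeral_eq_Suc)
    have "?S \<inter> L \<subseteq> points L" using good_F F_nonzero F_rep points_I by blast
    then show ?thesis using card_mono[OF card_points(2)[OF dim]] card_points_2[OF dim] by metis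
  qed
  have in_pl: "set [g, f0, f1] \<subseteq> pl g" if "g \<in> D" for g
    unfolding pl_def using Span_base_incl[OF K, of "[g, f0, f1]"] Dp[OF that] by simp
  have pl: "dimension 3 K (pl g)" "pl g \<subseteq> V'" if "g \<in> D" for g
  proof -
    have "independent K [g, f0, f1]" using ind Dp[OF that] by (subst independent_Cons_iff) (auto simp: L_def)
    then show "dimension 3 K (pl g)" using dimension_independent[of K "[g, f0, f1]"] by (simp add: pl_def numeral_eq_Suc)
    show "pl g \<subseteq> V'" unfolding pl_def using Dp[OF that] good_carrier(2) f by (intro V'_Span) auto
  qed
  have line: "g' \<in> Span K [f, g]" if "f \<in> {f0, f1}" "g \<in> D" "g' \<in> D" "join f g' = join f g" for f g g'
    using join_class_not_quad[of f g g'] Dp[OF that(2)] Dp[OF that(3)] sk[OF that(1,2)] that by auto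
  have same_pl: "pl g' = pl g" if "f \<in> {f0, f1}" "g \<in> D" "g' \<in> D" "join f g' = join f g" for f g g'
  proof (rule dimension_eqI[OF pl(1)[OF that(3)] pl(1)[OF that(2)]])
    have gsub: "set [g, f0, f1] \<subseteq> carrier E" using Dp[OF that(2)] by simp
    have "Span K [f, g] \<subseteq> Span K [g, f0, f1]"
      by (rule mono_Span_sublist[OF K]) (use that(1) gsub in auto)
    then have "set [g', f0, f1] \<subseteq> Span K [g, f0, f1]"
      using line[OF that] in_pl[OF that(2)] by (auto simp: pl_def)
    then show "pl g' \<subseteq> pl g" unfolding pl_def by (rule mono_Span_subset[OF K _ gsub])
  qed
  have inj: "g' = g" if gD: "g \<in> D" "g' \<in> D" "join f0 g' = join f0 g" "join f1 g' = join f1 g" for g g'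
  proof (rule ccontr)
    assume ne: "g' \<noteq> g"
    have [simp]: "g \<in> carrier E" "g' \<in> carrier E" using Dp gD by blast+
    obtain i j where ij: "i \<in> K" "j \<in> K" "g' = i \<otimes> f0 \<oplus> j \<otimes> g"
      using iffD1[OF Span_2[OF c(1) \<open>g \<in> carrier E\<close>] line[of f0 g g']] gD by blast
    obtain m n where mn: "m \<in> K" "n \<in> K" "g' = m \<otimes> f1 \<oplus> n \<otimes> g"
      using iffD1[OF Span_2[OF c(2) \<open>g \<in> carrier E\<close>] line[of f1 g g']] gD by blast
    have [simp]: "i \<in> carrier E" "j \<in> carrier E" "m \<in> carrier E" "n \<in> carrier E" using ij mn by simp_all
    have "(j \<ominus> n) \<otimes> g = (i \<otimes> f0 \<oplus> j \<otimes> g) \<ominus> i \<otimes> f0 \<ominus> n \<otimes> g" by (simp add: ring_nf)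
    also have "\<dots> = (m \<otimes> f1 \<oplus> n \<otimes> g) \<ominus> i \<otimes> f0 \<ominus> n \<otimes> g" using ij(3) mn(3) by simp
    also have "\<dots> = (\<ominus> i) \<otimes> f0 \<oplus> m \<otimes> f1" by (simp add: ring_nf)
    also have "\<dots> \<in> L" unfolding L_def Span_2[OF c] using K_props(5)[OF ij(1)] mn(1) by blast
    finally have mem: "(j \<ominus> n) \<otimes> g \<in> L" .
    have "j \<ominus> n = \<zero>"
    proof (rule ccontr)
      assume "j \<ominus> n \<noteq> \<zero>"
      then have "g \<in> L" using Span_m_inv_simprule[OF K, of "[f0, f1]" "j \<ominus> n" g] mem ij mn by (simp add: L_def)
      then show False using Dp gD by blast
    qed
    then have jn: "j = n" by simp
    have "i = \<zero>"
    proof (rule ccontr)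
      assume i0: "i \<noteq> \<zero>"
      obtain d where d: "d \<in> K" "d \<otimes> i = \<one>" using K_inv[OF ij(1) i0] by blast
      have [simp]: "d \<in> carrier E" using d by simp
      have "i \<otimes> f0 = (i \<otimes> f0 \<oplus> j \<otimes> g) \<ominus> j \<otimes> g" by (simp add: ring_nf)
      also have "\<dots> = (m \<otimes> f1 \<oplus> n \<otimes> g) \<ominus> n \<otimes> g" using ij(3) mn(3) jn by simp
      also have "\<dots> = m \<otimes> f1" by (simp add: ring_nf)
      finally have "i \<otimes> f0 = m \<otimes> f1" .
      then have "d \<otimes> (i \<otimes> f0) = d \<otimes> (m \<otimes> f1)" by simp
      then have "f0 = (d \<otimes> m) \<otimes> f1" using d m_assoc[of d i f0] m_assoc[of d m f1] by simp
      moreover have "d \<otimes> m \<in> K" using d mn by simp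
      ultimately show False using ind unfolding independent_2[OF c] by blast
    qed
    then have "g' = j \<otimes> g" using ij by simp
    then show False using F_independent[of g' g] ne good_F Dp(1) gD ij(2)
      unfolding independent_2[OF \<open>g' \<in> carrier E\<close> \<open>g \<in> carrier E\<close>] by blast
  qed
  define Dp where "Dp = (\<lambda>p. {g \<in> D. pl g = p})"
  define x where "x = (\<lambda>p. card (join f0 ` Dp p))"
  define y where "y = (\<lambda>p. card (join f1 ` Dp p))"
  have finDp: "finite (Dp p)" for p using fin by (simp add: Dp_def)
  have classes: "(\<Sum>p\<in>pl ` D. card (join f ` Dp p)) = card (join f ` D)" if "f \<in> {f0, f1}" for f
  proof -
    have "card (\<Union>p\<in>pl ` D. join f ` Dp p) = (\<Sum>p\<in>pl ` D. card (join f ` Dp p))"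
    proof (rule card_UN_disjoint)
      show "\<forall>p\<in>pl ` D. \<forall>p'\<in>pl ` D. p \<noteq> p' \<longrightarrow> join f ` Dp p \<inter> join f ` Dp p' = {}"
      proof (intro ballI impI equals0I)
        fix p p' z assume "p \<noteq> p'" "z \<in> join f ` Dp p \<inter> join f ` Dp p'"
        then obtain g g' where "g \<in> D" "pl g = p" "g' \<in> D" "pl g' = p'" "join f g' = join f g"
          by (auto simp: Dp_def)
        then show False using same_pl[OF that, of g g'] \<open>p \<noteq> p'\<close> by simp
      qed
    qed (use fin finDp in auto)
    moreover have "(\<Union>p\<in>pl ` D. join f ` Dp p) = join f ` D" by (auto simp: Dp_def)
    ultimately show ?thesis by simp
  qed
  have cl: "real (card (join f ` D)) < 99 * q" if "f \<in> {f0, f1}" for f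
    using that f good_F by (intro class_bound) (auto simp: D_def)
  have sx: "(\<Sum>p\<in>pl ` D. real (x p)) \<le> 99 * real q" and sy: "(\<Sum>p\<in>pl ` D. real (y p)) \<le> 99 * real q"
    using classes[of f0] classes[of f1] cl[of f0] cl[of f1] unfolding x_def y_def of_nat_sum[symmetric] by auto
  have xy: "card (Dp p) \<le> x p * y p" for p
  proof -
    have "inj_on (\<lambda>g. (join f0 g, join f1 g)) (Dp p)" using inj by (auto intro!: inj_onI simp: Dp_def)
    then have "card (Dp p) = card ((\<lambda>g. (join f0 g, join f1 g)) ` Dp p)" by (simp add: card_image)
    also have "\<dots> \<le> card (join f0 ` Dp p \<times> join f1 ` Dp p)" using finDp by (intro card_mono) auto
    finally show ?thesis by (simp add: x_def y_def card_cartesian_product)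
  qed
  have pb: "card (Dp p) \<le> 8 * q + 2" if "p \<in> pl ` D" for p
  proof -
    obtain g where g: "g \<in> D" "p = pl g" using \<open>p \<in> pl ` D\<close> by blast
    have "Dp p \<subseteq> F \<inter> p" using in_pl good_F by (auto simp: Dp_def D_def)
    then have "card (Dp p) \<le> card (F \<inter> p)" using finite_F by (intro card_mono) auto
    also have "\<dots> \<le> 8 * q + 2" unfolding g(2) by (rule plane_bound[OF pl[OF g(1)] k])
    finally show ?thesis .
  qed
  have bnd: "real (card (Dp p)) \<le> s * y p + (8 * q + 2) / s * x p" if "p \<in> pl ` D" for p
  proof (cases "real (x p) \<le> s")
    case True
    have "real (card (Dp p)) \<le> real (x p * y p)" using xy of_nat_mono by blast
    also have "\<dots> \<le> s * y p" using True by (simp add: mult_right_mono)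
    also have "\<dots> \<le> s * y p + (8 * q + 2) / s * x p" using s by simp
    finally show ?thesis .
  next
    case False
    have "real (card (Dp p)) \<le> real (8 * q + 2)" using pb[OF that] of_nat_mono by blast
    also have "\<dots> = (8 * q + 2) / s * s" using s by simp
    also have "\<dots> \<le> (8 * q + 2) / s * x p" using False s by (intro mult_left_mono) auto
    also have "\<dots> \<le> s * y p + (8 * q + 2) / s * x p" using s by simp
    finally show ?thesis .
  qed
  have "card D = (\<Sum>p\<in>pl ` D. card (Dp p))" unfolding Dp_def by (rule card_fibres[OF fin(2)])
  then have "real (card D) = (\<Sum>p\<in>pl ` D. real (card (Dp p)))" by simp
  also have "\<dots> \<le> (\<Sum>p\<in>pl ` D. s * y p + (8 * q + 2) / s * x p)" using bnd by (rule sum_mono)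
  also have "\<dots> = s * (\<Sum>p\<in>pl ` D. real (y p)) + (8 * q + 2) / s * (\<Sum>p\<in>pl ` D. real (x p))"
    by (simp add: sum.distrib sum_distrib_left)
  also have "\<dots> \<le> s * (99 * real q) + (8 * q + 2) / s * (99 * real q)"
    using s sx sy by (intro add_mono mult_left_mono) auto
  finally have "real (card D) \<le> 99 * real q * (s + (8 * q + 2) / s)" by (simp add: algebra_simps)
  moreover have "card ?S = card (?S \<inter> L) + card D"
    unfolding D_def using fin(1) by (metis (no_types, lifting) Int_Diff_disjoint Int_Diff_Un card_Un_disjoint finite_Diff finite_Int)
  ultimately show ?thesis using L by linarith
qed

text \<open>
  Let \<open>n\<close> be the number of good points, which is at least \<open>q^2 / 100\<close>.  If three good points are each
  unrelated to at least \<open>40\<close> percent of the good ones, some two of them have at least \<open>n / 15\<close> good points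
  unrelated to both.  Otherwise some pair of related good points has about \<open>n / 5\<close> good points or more
  related to both.  For large \<open>q\<close> the previous bounds exclude both cases.
\<close>

theorem card_F_gt:
  assumes q: "10 ^ 13 \<le> q"
  shows "real (card F) > real q ^ 2 + 0.4877 * real q"
proof (rule ccontr)
  assume "\<not> ?thesis"
  then have k: "real (card F) \<le> real q ^ 2 + 0.4877 * real q" by simp
  have "real (card F) \<le> real (q\<^sup>2 + q)" using k q_pos by simp
  then have k': "card F \<le> q\<^sup>2 + q" using of_nat_le_iff by blast
  define n where "n = real (card good)"
  have n: "0.01 * real q ^ 2 \<le> n" unfolding n_def by (rule card_good[OF k])
  define x where "x = real q"
  have x: "10 ^ 13 \<le> x" using q of_nat_mono[OF q, where 'a = real] by (simp add: x_def)
  have xx: "10 ^ 13 * x \<le> x ^ 2" using x by (simp add: power2_eq_square)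
  have nx: "10 ^ 11 * x \<le> n" using n xx by (simp add: x_def)
  have n_big: "n > 100" using nx x by simp
  define N where "N = (\<lambda>f. {g \<in> good - {f}. \<not> quad_related f g})"
  have finN: "finite (N f)" "N f \<subseteq> good" for f using finite_good by (auto simp: N_def)
  define H where "H = {f \<in> good. 0.4 * n \<le> card (N f)}"
  have finH: "finite H" using finite_good by (simp add: H_def)
  show False
  proof (cases "3 \<le> card H")
    case True
    \<comment> \<open>With \<open>s\<close> equal to three million, the quadratic term of \<open>15 * b\<close> is less than half of
      \<open>0.01 * q^2\<close>.\<close>
    define b where "b = real q + 1 + 99 * real q * (3 * 10 ^ 6 + (8 * q + 2) / (3 * 10 ^ 6))"
    have pair: "real (card (N f \<inter> N g)) \<le> b" if "f \<in> H" "g \<in> H" "f \<noteq> g" for f g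
    proof -
      have eq: "N f \<inter> N g = {h \<in> good - {f, g}. \<not> quad_related f h \<and> \<not> quad_related g h}" by (auto simp: N_def)
      show ?thesis unfolding eq b_def
        using card_neither_quad_related[OF k', of f g "3 * 10 ^ 6"] that by (simp add: H_def)
    qed
    obtain B where B: "B \<subseteq> H" "card B = 3" using obtain_subset_with_card_n[OF True] by blast
    then obtain f g h where fgh: "B = {f, g, h}" "f \<noteq> g" "f \<noteq> h" "g \<noteq> h" by (auto simp: card_3_iff)
    have inH: "f \<in> H" "g \<in> H" "h \<in> H" using B fgh by auto
    have un: "card (N f \<union> N g \<union> N h) \<le> card good"
      using finN finite_good by (intro card_mono) auto
    have "card (N f) + card (N g) = card (N f \<union> N g) + card (N f \<inter> N g)"
      by (rule card_Un_Int[OF finN(1) finN(1)])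
    moreover have "card (N f \<union> N g) + card (N h) = card (N f \<union> N g \<union> N h) + card ((N f \<union> N g) \<inter> N h)"
      by (rule card_Un_Int[OF finite_UnI[OF finN(1) finN(1)] finN(1)])
    moreover have "card ((N f \<union> N g) \<inter> N h) \<le> card (N f \<inter> N h) + card (N g \<inter> N h)"
      using card_Un_le[of "N f \<inter> N h" "N g \<inter> N h"] by (simp add: Int_Un_distrib2)
    ultimately have "card (N f) + card (N g) + card (N h) \<le> card good + card (N f \<inter> N g) + card (N f \<inter> N h) + card (N g \<inter> N h)"
      using un by linarith
    then have "real (card (N f) + card (N g) + card (N h)) \<le> real (card good + card (N f \<inter> N g) + card (N f \<inter> N h) + card (N g \<inter> N h))"
      by (rule of_nat_mono)
    moreover have "0.4 * n \<le> card (N f)" "0.4 * n \<le> card (N g)" "0.4 * n \<le> card (N h)" using inH by (simp_all add: H_def)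
    moreover have "real (card (N f \<inter> N g)) \<le> b" "real (card (N f \<inter> N h)) \<le> b" "real (card (N g \<inter> N h)) \<le> b"
      using pair inH fgh by blast+
    ultimately have "1.2 * n \<le> n + 3 * b" by (simp add: n_def)
    then have nb: "n \<le> 15 * b" by simp
    have "b = x + 1 + 99 * x * (3 * 10 ^ 6 + (8 * x + 2) / (3 * 10 ^ 6))" by (simp add: b_def x_def)
    also have "\<dots> = x + 1 + (297000000 * x + (264 / 1000000 * x ^ 2 + 66 / 1000000 * x))"
      by (simp add: field_simps power2_eq_square)
    finally have "b = x + 1 + (297000000 * x + (264 / 1000000 * x ^ 2 + 66 / 1000000 * x))" .
    then have "15 * b \<le> 0.00396 * x ^ 2 + 4455000020 * x + 15" using x by simp
    then have "0.01 * x ^ 2 \<le> 0.00396 * x ^ 2 + 4455000020 * x + 15" using nb n by (simp add: x_def)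
    then have "0.00604 * x ^ 2 \<le> 4455000020 * x + 15" by simp
    then show False using xx x by simp
  next
    case False
    \<comment> \<open>At most two good points are in \<open>H\<close>, so any three points include one that is not.\<close>
    have sub: "\<exists>f\<in>S. f \<notin> H" if "finite S" "3 \<le> card S" for S
    proof (rule ccontr)
      assume "\<not> ?thesis"
      then have "card S \<le> card H" using finH by (intro card_mono) auto
      then show False using that False by simp
    qed
    have "real 3 \<le> real (card good)" using n_big by (simp add: n_def)
    then have "3 \<le> card good" using of_nat_le_iff by blast
    then obtain f where f: "f \<in> good" "f \<notin> H" using sub[OF finite_good] by blast
    have fN: "real (card (N f)) < 0.4 * n" using f by (simp add: H_def)
    let ?B = "good - insert f (N f)"
    have "card (insert f (N f)) \<le> card (N f) + 1" using finN by (simp add: card_insert_if)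
    moreover have "card good - card (insert f (N f)) \<le> card ?B" by (rule diff_card_le_card_Diff) (use finN in simp)
    ultimately have "real (card ?B) \<ge> n - (card (N f) + 1)" unfolding n_def by linarith
    then have "real 3 \<le> real (card ?B)" using fN n_big by simp
    then have "3 \<le> card ?B" using of_nat_le_iff by blast
    then obtain g where g: "g \<in> ?B" "g \<notin> H" using sub[of ?B] finite_good by blast
    then have gg: "g \<in> good" "f \<noteq> g" "quad_related f g" by (auto simp: N_def)
    have gN: "real (card (N g)) < 0.4 * n" using gg g by (simp add: H_def)
    let ?S = "{h \<in> good - {f, g}. quad_related f h \<and> quad_related g h}"
    have "good \<subseteq> (?S \<union> {f, g}) \<union> (N f \<union> N g)" by (auto simp: N_def)
    then have "card good \<le> card ((?S \<union> {f, g}) \<union> (N f \<union> N g))" using finite_good finN by (intro card_mono) auto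
    also have "\<dots> \<le> card (?S \<union> {f, g}) + card (N f \<union> N g)" by (rule card_Un_le)
    also have "\<dots> \<le> (card ?S + card {f, g}) + (card (N f) + card (N g))" by (intro add_mono card_Un_le)
    also have "card {f, g} = 2" using gg by simp
    finally have "n \<le> real (card ?S + 2 + (card (N f) + card (N g)))" unfolding n_def by (rule of_nat_mono)
    moreover have "real (card ?S) \<le> 206 * x + 2" unfolding x_def
      by (rule card_both_quad_related[OF k' f(1) gg])
    ultimately have "0.2 * n \<le> 206 * x + 4" using fN gN by simp
    then show False using nx x by simp
  qed
qed

end

section \<open>From Laurent series to functionals\<close>

lemma laurent_abs_ge:
  assumes R: "1 < order R" and nz: "\<beta> i \<noteq> \<zero>\<^bsub>R\<^esub>" and bd: "\<And>j. j > n \<Longrightarrow> \<beta> j = \<zero>\<^bsub>R\<^esub>"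
  shows "real (order R) powi i \<le> laurent_abs R \<beta>"
proof -
  define B where "B = {j. \<beta> j \<noteq> \<zero>\<^bsub>R\<^esub> \<and> i \<le> j}"
  have fin: "finite B"
    by (rule finite_subset[of _ "{i..n}"]) (use bd in \<open>auto simp: B_def not_less[symmetric]\<close>)
  have iB: "i \<in> B" by (simp add: B_def nz)
  have MB: "Max B \<in> B" using fin iB Max_in by blast
  have le: "j \<le> Max B" if "\<beta> j \<noteq> \<zero>\<^bsub>R\<^esub>" for j
  proof (cases "i \<le> j")
    case True then show ?thesis using that fin by (intro Max_ge) (auto simp: B_def)
  next
    case False then show ?thesis using Max_ge[OF fin iB] by linarith
  qed
  have ord: "laurent_ord R \<beta> = Max B"
    unfolding laurent_ord_def by (rule Greatest_equality) (use MB le in \<open>auto simp: B_def\<close>)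
  have "\<beta> \<noteq> \<zero>\<^bsub>laurent R\<^esub>" using nz by (auto simp: laurent_def)
  then have "laurent_abs R \<beta> = real (order R) powi Max B" by (simp add: laurent_abs_def ord)
  moreover have "i \<le> Max B" using Max_ge[OF fin iB] .
  ultimately show ?thesis using R by (simp add: power_int_increasing)
qed

lemma frac_abs_less_coeffs:
  assumes R: "1 < order R" and less: "frac_abs R \<gamma> < 1 / real (order R) ^ 2"
  shows "\<gamma> (-1) = \<zero>\<^bsub>R\<^esub>" "\<gamma> (-2) = \<zero>\<^bsub>R\<^esub>"
proof -
  have "\<gamma> i = \<zero>\<^bsub>R\<^esub>" if i: "i < 0" "-2 \<le> i" for i
  proof (rule ccontr)
    assume "\<gamma> i \<noteq> \<zero>\<^bsub>R\<^esub>"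
    then have "real (order R) powi i \<le> frac_abs R \<gamma>"
      unfolding frac_abs_def using i by (intro laurent_abs_ge[OF R, of _ _ "-1"]) (auto simp: frac_part_def)
    moreover have "real (order R) powi (-2) \<le> real (order R) powi i" using R i by (intro power_int_increasing) auto
    moreover have "real (order R) powi (-2) = 1 / real (order R) ^ 2" by (simp add: power_int_minus divide_inverse)
    ultimately show False using less by linarith
  qed
  then show "\<gamma> (-1) = \<zero>\<^bsub>R\<^esub>" "\<gamma> (-2) = \<zero>\<^bsub>R\<^esub>" by simp_all
qed

lemma (in abelian_monoid) finsum_mono_neutral_cong_left:
  assumes "finite B" "A \<subseteq> B" "\<And>i. i \<in> B - A \<Longrightarrow> h i = \<zero>" "\<And>x. x \<in> A \<Longrightarrow> g x = h x" "h \<in> B \<rightarrow> carrier G"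
  shows "finsum G g A = finsum G h B"
  using add.finprod_mono_neutral_cong_left[OF assms(1,2)] assms(3-5) unfolding finsum_def by simp

lemma coeff_UP: "f \<in> carrier (UP R) \<Longrightarrow> coeff (UP R) f i = f i"
  by (simp add: UP_def)

text \<open>
  The polynomial ring \<open>P\<close> over a finite field as an instance of the previous setting.  The coefficients
  \<open>c 0, \<dots>, c m\<close> of \<open>T^-1, \<dots>, T^-(m+1)\<close> in a series turn a polynomial \<open>f\<close> into the coefficient of \<open>T^-1\<close> of
  the product, a linear functional in \<open>f\<close>; the coefficient of \<open>T^-2\<close> is its value at \<open>T\<close> times \<open>f\<close>.
\<close>

locale finite_field_poly = UP_domain R P + R: field R for R :: "('a, 'm) ring_scheme" (structure) and P (structure) +
  assumes finite_R: "finite (carrier R)"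
begin

text \<open>
  The copy of the coefficient field in the polynomial ring, and the indeterminate.
\<close>

definition "constants = (\<lambda>a. monom P a 0) ` carrier R"
definition "X = monom P \<one> 1"

text \<open>
  The functional with coefficients \<open>c\<close>; its value is a constant polynomial because functionals take
  their values in the subfield of constants.
\<close>

definition functional :: "nat \<Rightarrow> (nat \<Rightarrow> 'a) \<Rightarrow> (nat \<Rightarrow> 'a) \<Rightarrow> (nat \<Rightarrow> 'a)" where
  "functional m c = (\<lambda>f\<in>carrier P. monom P (\<Oplus>i\<in>{..m}. c i \<otimes> coeff P f i) 0)"

text \<open>
  The polynomials of degree at most \<open>m\<close>, and the functionals on them.
\<close>

definition "bounded_polys m = {f \<in> carrier P. \<forall>i>m. coeff P f i = \<zero>}"
definition "functionals m = functional m ` ({..m} \<rightarrow>\<^sub>E carrier R)"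

lemma X_closed: "X \<in> carrier P" by (simp add: X_def)

lemma coeff_X_mult: assumes "f \<in> carrier P"
  shows "coeff P (X \<otimes>\<^bsub>P\<^esub> f) 0 = \<zero>" "coeff P (X \<otimes>\<^bsub>P\<^esub> f) (Suc n) = coeff P f n"
proof -
  have "coeff P (X \<otimes>\<^bsub>P\<^esub> f) 0 = (\<Oplus>i\<in>{..0}. coeff P X i \<otimes> coeff P f (0 - i))"
    by (rule coeff_mult[OF X_closed assms])
  also have "\<dots> = \<zero>" using assms by (simp add: X_def)
  finally show "coeff P (X \<otimes>\<^bsub>P\<^esub> f) 0 = \<zero>" .
  show "coeff P (X \<otimes>\<^bsub>P\<^esub> f) (Suc n) = coeff P f n"
    using coeff_monom_mult[of \<one> f 1 n] assms by (simp add: X_def)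
qed

lemma coeff_const_mult: "\<lbrakk>a \<in> carrier R; f \<in> carrier P\<rbrakk> \<Longrightarrow> coeff P (monom P a 0 \<otimes>\<^bsub>P\<^esub> f) n = a \<otimes> coeff P f n"
  using coeff_monom_mult[of a f 0 n] by simp

lemma subfield_constants: "subfield constants P"
proof -
  interpret h: ring_hom_ring R P "\<lambda>a. monom P a 0"
    by (intro ring_hom_ringI2 const_ring_hom R.ring_axioms P.ring_axioms)
  show ?thesis unfolding constants_def
    by (rule h.img_is_subfield(2)[OF R.carrier_is_subfield]) simp
qed

lemma card_constants: "card constants = order R" "finite constants"
proof -
  have "inj_on (\<lambda>a. monom P a 0) (carrier R)" by (rule monom_inj)
  then show "card constants = order R" "finite constants"
    using finite_R by (simp_all add: constants_def card_image order_def)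
qed

lemma poly_domain: "poly_domain P constants X"
proof (intro poly_domain.intro poly_domain_axioms.intro)
  show "domain P" by (rule UP_domain)
  show "X \<noteq> \<zero>\<^bsub>P\<^esub>"
  proof
    assume "X = \<zero>\<^bsub>P\<^esub>"
    then have "coeff P X 1 = \<zero>" by simp
    then show False by (simp add: X_def)
  qed
  fix a x assume a: "a \<in> constants" and x: "x \<in> carrier P" and eq: "a \<oplus>\<^bsub>P\<^esub> X \<otimes>\<^bsub>P\<^esub> x = \<zero>\<^bsub>P\<^esub>"
  obtain b where b: "b \<in> carrier R" "a = monom P b 0" using a by (auto simp: constants_def)
  have "coeff P (a \<oplus>\<^bsub>P\<^esub> X \<otimes>\<^bsub>P\<^esub> x) 0 = b" using b x X_closed coeff_X_mult(1)[OF x] by simp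
  then have "b = \<zero>" unfolding eq by simp
  then show "a = \<zero>\<^bsub>P\<^esub>" unfolding b(2) by simp
qed (use subfield_constants card_constants X_closed in auto)

lemma functional_eq: "f \<in> carrier P \<Longrightarrow> functional m c f = monom P (\<Oplus>i\<in>{..m}. c i \<otimes> coeff P f i) 0"
  by (simp add: functional_def)

lemma functional_space: "functional_space P constants X (bounded_polys m) (functionals m)"
proof (intro functional_space.intro functional_space_axioms.intro poly_domain)
  have cs: "(\<Oplus>i\<in>{..m}. c i \<otimes> coeff P f i) \<in> carrier R" if "c \<in> {..m} \<rightarrow>\<^sub>E carrier R" "f \<in> carrier P" for c f
    using that by (intro R.finsum_closed) auto
  show "bounded_polys m \<subseteq> carrier P" by (auto simp: bounded_polys_def)
  show "x \<oplus>\<^bsub>P\<^esub> y \<in> bounded_polys m" if "x \<in> bounded_polys m" "y \<in> bounded_polys m" for x y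
    using that by (auto simp: bounded_polys_def)
  show "k \<otimes>\<^bsub>P\<^esub> x \<in> bounded_polys m" if "k \<in> constants" "x \<in> bounded_polys m" for k x
    using that coeff_const_mult by (auto simp: bounded_polys_def constants_def)
  show "finite (functionals m)" unfolding functionals_def using finite_R by (intro finite_imageI finite_PiE) auto
  have "(\<lambda>i\<in>{..m}. \<zero>) \<in> {..m} \<rightarrow>\<^sub>E carrier R" by simp
  then show "functionals m \<noteq> {}" unfolding functionals_def by blast
  show "functionals m \<subseteq> extensional (carrier P)" by (auto simp: functionals_def functional_def)
  show "a x \<in> constants" if "a \<in> functionals m" "x \<in> carrier P" for a x
    using that cs by (auto simp: functionals_def functional_eq constants_def)
  show "a (x \<oplus>\<^bsub>P\<^esub> y) = a x \<oplus>\<^bsub>P\<^esub> a y" if a: "a \<in> functionals m" and xy: "x \<in> carrier P" "y \<in> carrier P" for a x y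
  proof -
    obtain c where c: "c \<in> {..m} \<rightarrow>\<^sub>E carrier R" "a = functional m c" using a by (auto simp: functionals_def)
    have ci: "c i \<in> carrier R" if "i \<le> m" for i using c that by auto
    have "(\<Oplus>i\<in>{..m}. c i \<otimes> coeff P (x \<oplus>\<^bsub>P\<^esub> y) i) = (\<Oplus>i\<in>{..m}. c i \<otimes> coeff P x i \<oplus> c i \<otimes> coeff P y i)"
      using xy ci by (intro R.finsum_cong') (auto simp: R.r_distr)
    also have "\<dots> = (\<Oplus>i\<in>{..m}. c i \<otimes> coeff P x i) \<oplus> (\<Oplus>i\<in>{..m}. c i \<otimes> coeff P y i)"
      using xy ci by (intro R.finsum_addf) auto
    finally show ?thesis using xy cs[OF c(1)] by (simp add: c(2) functional_eq)
  qed
  show "a (k \<otimes>\<^bsub>P\<^esub> x) = k \<otimes>\<^bsub>P\<^esub> a x" if a: "a \<in> functionals m" and k: "k \<in> constants" and x: "x \<in> carrier P" for a k x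
  proof -
    obtain c where c: "c \<in> {..m} \<rightarrow>\<^sub>E carrier R" "a = functional m c" using a by (auto simp: functionals_def)
    have ci: "c i \<in> carrier R" if "i \<le> m" for i using c that by auto
    obtain b where b: "b \<in> carrier R" "k = monom P b 0" using k by (auto simp: constants_def)
    have "(\<Oplus>i\<in>{..m}. c i \<otimes> coeff P (k \<otimes>\<^bsub>P\<^esub> x) i) = (\<Oplus>i\<in>{..m}. b \<otimes> (c i \<otimes> coeff P x i))"
      using x ci b by (intro R.finsum_cong') (auto simp: coeff_const_mult R.m_lcomm simp del: coeff_mult)
    also have "\<dots> = b \<otimes> (\<Oplus>i\<in>{..m}. c i \<otimes> coeff P x i)"
      using x ci b by (intro R.finsum_rdistr[symmetric]) auto
    finally show ?thesis using x b cs[OF c(1) x] monom_mult[of b "\<Oplus>i\<in>{..m}. c i \<otimes> coeff P x i" 0 0]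
      by (simp add: c(2) functional_eq)
  qed
  show "(\<lambda>x\<in>carrier P. a x \<oplus>\<^bsub>P\<^esub> k \<otimes>\<^bsub>P\<^esub> b x) \<in> functionals m"
    if ab: "a \<in> functionals m" "b \<in> functionals m" and k: "k \<in> constants" for a b k
  proof -
    obtain c where c: "c \<in> {..m} \<rightarrow>\<^sub>E carrier R" "a = functional m c" using ab by (auto simp: functionals_def)
    obtain d where d: "d \<in> {..m} \<rightarrow>\<^sub>E carrier R" "b = functional m d" using ab by (auto simp: functionals_def)
    obtain l where l: "l \<in> carrier R" "k = monom P l 0" using k by (auto simp: constants_def)
    have ci: "c i \<in> carrier R" "d i \<in> carrier R" if "i \<le> m" for i using c d that by auto
    define e where "e = (\<lambda>i\<in>{..m}. c i \<oplus> l \<otimes> d i)"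
    have e: "e \<in> {..m} \<rightarrow>\<^sub>E carrier R" using ci l by (auto simp: e_def)
    have "functional m e x = a x \<oplus>\<^bsub>P\<^esub> k \<otimes>\<^bsub>P\<^esub> b x" if x: "x \<in> carrier P" for x
    proof -
      have "(\<Oplus>i\<in>{..m}. e i \<otimes> coeff P x i) = (\<Oplus>i\<in>{..m}. c i \<otimes> coeff P x i \<oplus> l \<otimes> (d i \<otimes> coeff P x i))"
        using x ci l by (intro R.finsum_cong') (auto simp: e_def R.l_distr R.m_assoc)
      also have "\<dots> = (\<Oplus>i\<in>{..m}. c i \<otimes> coeff P x i) \<oplus> (\<Oplus>i\<in>{..m}. l \<otimes> (d i \<otimes> coeff P x i))"
        using x ci l by (intro R.finsum_addf) auto
      also have "(\<Oplus>i\<in>{..m}. l \<otimes> (d i \<otimes> coeff P x i)) = l \<otimes> (\<Oplus>i\<in>{..m}. d i \<otimes> coeff P x i)"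
        using x ci l by (intro R.finsum_rdistr[symmetric]) auto
      finally show ?thesis using x l cs[OF c(1) x] cs[OF d(1) x] monom_mult[of l "\<Oplus>i\<in>{..m}. d i \<otimes> coeff P x i" 0 0]
        by (simp add: c(2) d(2) functional_eq)
    qed
    then have "(\<lambda>x\<in>carrier P. a x \<oplus>\<^bsub>P\<^esub> k \<otimes>\<^bsub>P\<^esub> b x) = functional m e"
      by (auto simp: fun_eq_iff functional_def)
    then show ?thesis unfolding functionals_def using e by blast
  qed
  show "\<exists>a\<in>functionals m. a x \<noteq> \<zero>\<^bsub>P\<^esub>" if x: "x \<in> bounded_polys m" and x0: "x \<noteq> \<zero>\<^bsub>P\<^esub>" for x
  proof -
    have xc: "x \<in> carrier P" using x by (simp add: bounded_polys_def)
    obtain j where j: "coeff P x j \<noteq> \<zero>" using up_eqI[of x "\<zero>\<^bsub>P\<^esub>"] xc x0 by auto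
    then have jm: "j \<le> m" using x by (auto simp: bounded_polys_def not_less[symmetric])
    define c where "c = (\<lambda>i\<in>{..m}. if j = i then \<one> else \<zero>)"
    have c: "c \<in> {..m} \<rightarrow>\<^sub>E carrier R" by (auto simp: c_def)
    have "(\<Oplus>i\<in>{..m}. c i \<otimes> coeff P x i) = (\<Oplus>i\<in>{..m}. if j = i then coeff P x i else \<zero>)"
      using xc by (intro R.finsum_cong') (auto simp: c_def)
    also have "\<dots> = coeff P x j" using jm xc by (intro R.finsum_singleton) auto
    finally have eq: "functional m c x = monom P (coeff P x j) 0" using xc by (simp add: functional_eq)
    have "monom P (coeff P x j) 0 \<noteq> \<zero>\<^bsub>P\<^esub>"
    proof
      assume "monom P (coeff P x j) 0 = \<zero>\<^bsub>P\<^esub>"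
      then have "coeff P (monom P (coeff P x j) 0) 0 = \<zero>" by simp
      then show False using j xc by simp
    qed
    then show ?thesis using c eq unfolding functionals_def by (metis imageI)
  qed
qed

lemma coeff_eq: "f \<in> carrier P \<Longrightarrow> coeff P f i = f i"
  unfolding P_def by (rule coeff_UP)

text \<open>
  Off the index set of the sum in the product the summands vanish, so the sum may be taken over all
  coefficients of \<open>\<alpha>\<close> that can be nonzero.
\<close>

lemma laurent_coeff:
  assumes c: "c \<in> {..m} \<rightarrow>\<^sub>E carrier R" and f: "f \<in> carrier P"
    and \<alpha>: "\<alpha> = (\<lambda>i. if - int m - 1 \<le> i \<and> i < 0 then c (nat (- 1 - i)) else \<zero>)"
  shows "(\<alpha> \<otimes>\<^bsub>laurent R\<^esub> poly_to_laurent R f) k = (\<Oplus>j\<in>{..m}. c j \<otimes> poly_to_laurent R f (k + 1 + int j))"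
proof -
  let ?g = "poly_to_laurent R f"
  let ?S = "{i. \<alpha> i \<noteq> \<zero> \<and> ?g (k - i) \<noteq> \<zero>}" and ?h = "\<lambda>j. - 1 - int j"
  have fc: "f i \<in> carrier R" for i using coeff_closed[OF f, of i] by (simp only: coeff_eq[OF f])
  have gc: "?g i \<in> carrier R" for i using fc by (simp add: poly_to_laurent_def)
  have ac: "\<alpha> i \<in> carrier R" for i using c by (auto simp: \<alpha>)
  have "(\<alpha> \<otimes>\<^bsub>laurent R\<^esub> ?g) k = (\<Oplus>i\<in>?S. \<alpha> i \<otimes> ?g (k - i))" by (simp add: laurent_def)
  also have "\<dots> = (\<Oplus>i\<in>?h ` {..m}. \<alpha> i \<otimes> ?g (k - i))"
  proof (rule R.finsum_mono_neutral_cong_left)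
    show "?S \<subseteq> ?h ` {..m}"
    proof
      fix i assume "i \<in> ?S"
      then have "- int m - 1 \<le> i" "i < 0" by (auto simp: \<alpha> split: if_splits)
      then show "i \<in> ?h ` {..m}" by (intro image_eqI[of _ _ "nat (- 1 - i)"]) auto
    qed
  qed (use ac gc in auto)
  also have "\<dots> = (\<Oplus>j\<in>{..m}. \<alpha> (?h j) \<otimes> ?g (k - ?h j))"
    using ac gc by (intro R.finsum_reindex) (auto intro: inj_onI)
  also have "\<dots> = (\<Oplus>j\<in>{..m}. c j \<otimes> ?g (k + 1 + int j))"
    using ac gc c by (intro R.finsum_cong') (auto simp: \<alpha> algebra_simps)
  finally show ?thesis .
qed

text \<open>
  If every series in the torus has some \<open>f\<close> in \<open>F\<close> with \<open>|\<alpha> f| < q^-2\<close>, the two leading fractional coefficients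
  of that product vanish, so the representatives of \<open>F\<close> form a covering.
\<close>

lemma card_bound:
  assumes q: "10 ^ 13 \<le> order R" and F: "F \<subseteq> carrier P - {\<zero>\<^bsub>P\<^esub>}" and fin: "finite F"
    and cov: "\<And>\<alpha>. \<alpha> \<in> unit_torus R \<Longrightarrow>
      \<exists>f\<in>F. frac_abs R (\<alpha> \<otimes>\<^bsub>laurent R\<^esub> poly_to_laurent R f) < 1 / real (order R) ^ 2"
  shows "real (card F) > real (order R) ^ 2 + 0.4877 * real (order R)"
proof -
  have "\<exists>m. \<forall>f\<in>F. \<forall>i\<ge>m. coeff P f i = \<zero>"
    using fin F
  proof (induction F rule: finite_induct)
    case (insert f F)
    then obtain m where m: "\<forall>f\<in>F. \<forall>i\<ge>m. coeff P f i = \<zero>" by auto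
    have fc: "f \<in> carrier P" using insert by simp
    have "coeff P f i = \<zero>" if "i \<ge> Suc (deg R f)" for i using deg_aboveD[of f i] fc that by simp
    then show ?case using m by (intro exI[of _ "max m (Suc (deg R f))"]) auto
  qed simp
  then obtain m where m: "\<And>f i. \<lbrakk>f \<in> F; i \<ge> m\<rbrakk> \<Longrightarrow> coeff P f i = \<zero>" by blast
  interpret FS: functional_space P constants X "bounded_polys m" "functionals m" by (rule functional_space)
  have q1: "1 < order R" using q by simp
  have Fc: "f \<in> carrier P" "f \<noteq> \<zero>\<^bsub>P\<^esub>" if "f \<in> F" for f using that F by auto
  have FV: "f \<in> FS.V'" if "f \<in> F" for f
  proof -
    note fc = Fc(1)[OF that]
    have "coeff P (X \<otimes>\<^bsub>P\<^esub> f) i = \<zero>" if "i > m" for i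
    proof -
      obtain n where n: "i = Suc n" using \<open>i > m\<close> by (cases i) auto
      then have "m \<le> n" using \<open>i > m\<close> by simp
      then show ?thesis unfolding n coeff_X_mult(2)[OF fc] by (rule m[OF \<open>f \<in> F\<close>])
    qed
    moreover have "coeff P f i = \<zero>" if "i > m" for i using m[OF \<open>f \<in> F\<close>, of i] that by linarith
    moreover have "X \<otimes>\<^bsub>P\<^esub> f \<in> carrier P" using fc X_closed by (rule UP_mult_closed[rotated])
    ultimately show ?thesis using fc unfolding bounded_polys_def by blast
  qed
  have killed: "\<exists>f\<in>F. a \<in> FS.kill f" if a: "a \<in> functionals m" for a
  proof -
    obtain c where c: "c \<in> {..m} \<rightarrow>\<^sub>E carrier R" "a = functional m c" using a by (auto simp: functionals_def)
    define \<alpha> where "\<alpha> = (\<lambda>i. if - int m - 1 \<le> i \<and> i < 0 then c (nat (- 1 - i)) else \<zero>)"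
    have "\<forall>i>0. \<alpha> i = \<zero>" "\<forall>i. \<alpha> i \<in> carrier R" using c by (auto simp: \<alpha>_def)
    then have \<alpha>c: "\<alpha> \<in> carrier (laurent R)" by (auto simp: laurent_def laurent_carrier_def)
    have "\<alpha> \<in> unit_torus R" using \<alpha>c laurent_abs_less_1_iff[OF \<alpha>c q1] by (simp add: unit_torus_def \<alpha>_def)
    then obtain f where f: "f \<in> F" "frac_abs R (\<alpha> \<otimes>\<^bsub>laurent R\<^esub> poly_to_laurent R f) < 1 / real (order R) ^ 2"
      using cov by blast
    note fc = Fc(1)[OF f(1)]
    note z = frac_abs_less_coeffs[OF q1 f(2), unfolded laurent_coeff[OF c(1) fc \<alpha>_def]]
    have ci: "c i \<in> carrier R" if "i \<le> m" for i using c that by auto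
    have "(\<Oplus>j\<in>{..m}. c j \<otimes> coeff P f j) = (\<Oplus>j\<in>{..m}. c j \<otimes> poly_to_laurent R f (-1 + 1 + int j))"
      using ci fc coeff_closed[OF fc] by (intro R.finsum_cong') (auto simp: poly_to_laurent_def coeff_eq[OF fc] simp del: coeff_closed)
    then have 1: "a f = \<zero>\<^bsub>P\<^esub>" using z(1) fc by (simp add: c(2) functional_eq)
    have Xf: "X \<otimes>\<^bsub>P\<^esub> f \<in> carrier P" using fc X_closed by simp
    have "(\<Oplus>j\<in>{..m}. c j \<otimes> coeff P (X \<otimes>\<^bsub>P\<^esub> f) j) = (\<Oplus>j\<in>{..m}. c j \<otimes> poly_to_laurent R f (-2 + 1 + int j))"
    proof (intro R.finsum_cong')
      fix j assume "j \<in> {..m}"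
      show "c j \<otimes> coeff P (X \<otimes>\<^bsub>P\<^esub> f) j = c j \<otimes> poly_to_laurent R f (-2 + 1 + int j)"
      proof (cases j)
        case 0
        then show ?thesis using coeff_X_mult(1)[OF fc] by (simp add: poly_to_laurent_def)
      next
        case (Suc n)
        then show ?thesis using coeff_X_mult(2)[OF fc, of n] coeff_eq[OF fc, of n] by (simp add: poly_to_laurent_def)
      qed
    next
      show "(\<lambda>j. c j \<otimes> poly_to_laurent R f (-2 + 1 + int j)) \<in> {..m} \<rightarrow> carrier R"
        using ci coeff_closed[OF fc] by (auto simp: poly_to_laurent_def coeff_eq[OF fc] simp del: coeff_closed)
    qed simp
    then have "a (X \<otimes>\<^bsub>P\<^esub> f) = \<zero>\<^bsub>P\<^esub>" using z(2) Xf by (simp add: c(2) functional_eq)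
    then show ?thesis using 1 a f(1) by (auto simp: FS.kill_def)
  qed
  have repF: "FS.rep f \<in> FS.V'" "FS.rep f \<noteq> \<zero>\<^bsub>P\<^esub>" "FS.rep (FS.rep f) = FS.rep f" if fF: "f \<in> F" for f
  proof -
    obtain k where k: "k \<in> constants" "k \<noteq> \<zero>\<^bsub>P\<^esub>" "FS.rep f = k \<otimes>\<^bsub>P\<^esub> f"
      using FS.rep_ray[OF Fc(1)[OF fF]] by (auto simp: FS.ray_def)
    have kc: "k \<in> carrier P" using k(1) FS.K_carrier by blast
    have "X \<otimes>\<^bsub>P\<^esub> (k \<otimes>\<^bsub>P\<^esub> f) = k \<otimes>\<^bsub>P\<^esub> (X \<otimes>\<^bsub>P\<^esub> f)" using kc X_closed Fc[OF fF] by (intro P.m_lcomm)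
    then show "FS.rep f \<in> FS.V'" unfolding k(3) using FV[OF fF] FS.V_smult[OF k(1)] by simp
    show "FS.rep f \<noteq> \<zero>\<^bsub>P\<^esub>" using FS.ray_nonzero[OF FS.rep_ray] Fc[OF fF] by blast
    show "FS.rep (FS.rep f) = FS.rep f" using FS.rep_rep Fc[OF fF] by blast
  qed
  interpret C: covering P constants X "bounded_polys m" "functionals m" "FS.rep ` F"
  proof
    show "finite (FS.rep ` F)" using fin by simp
    show "FS.rep ` F \<subseteq> FS.V'" using repF(1) by blast
    fix a assume "a \<in> functionals m"
    then obtain f where "f \<in> F" "a \<in> FS.kill f" using killed by blast
    then show "\<exists>f\<in>FS.rep ` F. a \<in> FS.kill f" using FS.kill_rep[of f] Fc by blast
  qed (use repF in auto)
  have "real (order R) ^ 2 + 0.4877 * real (order R) < real (card (FS.rep ` F))"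
    using C.card_F_gt q by (simp add: card_constants)
  also have "\<dots> \<le> real (card F)" using card_image_le[OF fin] of_nat_mono by blast
  finally show ?thesis .
qed

end

theorem theorem1p7:
  shows "\<exists>C::real. \<forall>(q::nat) (R::nat ring) (F::(nat \<Rightarrow> nat) set).
    primepow q \<longrightarrow>
    Ring.field R \<longrightarrow> finite (carrier R) \<longrightarrow> order R = q \<longrightarrow>
    F \<subseteq> carrier (UP R) - {\<zero>\<^bsub>UP R\<^esub>} \<longrightarrow>
    finite F \<longrightarrow>
    real (card F) \<le> real q ^ 2 + 0.4877 * real q - C \<longrightarrow>
    loneliness R F \<ge> ereal (1 / real q ^ 2)"
\<comment> \<open>The constant makes the hypothesis unsatisfiable for \<open>q < 10^13\<close>, since then \<open>q^2 + q < 10^27\<close>.\<close>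
proof (intro exI[of _ "10 ^ 27"] allI impI)
  fix q :: nat and R :: "nat ring" and F :: "(nat \<Rightarrow> nat) set"
  assume R: "Ring.field R" "finite (carrier R)" "order R = q" and F: "F \<subseteq> carrier (UP R) - {\<zero>\<^bsub>UP R\<^esub>}" "finite F"
    and card: "real (card F) \<le> real q ^ 2 + 0.4877 * real q - 10 ^ 27"
  have big: "10 ^ 13 \<le> q"
  proof (rule ccontr)
    assume "\<not> ?thesis"
    then have "real q \<le> 10 ^ 13" by simp
    then have "real q ^ 2 \<le> (10 ^ 13) ^ 2" by (intro power_mono) auto
    then show False using card \<open>real q \<le> 10 ^ 13\<close> by simp
  qed
  interpret field R by (rule R)
  interpret finite_field_poly R "UP R"
    by (intro finite_field_poly.intro UP_domain.intro finite_field_poly_axioms.intro R domain_axioms)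
  show "ereal (1 / real q ^ 2) \<le> loneliness R F"
  proof (rule ccontr)
    assume "\<not> ?thesis"
    then have less: "loneliness R F < ereal (1 / real q ^ 2)" by simp
    have "\<exists>f\<in>F. frac_abs R (\<alpha> \<otimes>\<^bsub>laurent R\<^esub> poly_to_laurent R f) < 1 / real (order R) ^ 2"
      if "\<alpha> \<in> unit_torus R" for \<alpha>
    proof -
      have "(INF f\<in>F. ereal (frac_abs R (\<alpha> \<otimes>\<^bsub>laurent R\<^esub> poly_to_laurent R f))) \<le> loneliness R F"
        unfolding loneliness_def using that by (rule SUP_upper)
      then have "(INF f\<in>F. ereal (frac_abs R (\<alpha> \<otimes>\<^bsub>laurent R\<^esub> poly_to_laurent R f))) < ereal (1 / real q ^ 2)"
        using less by (rule le_less_trans)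
      then show ?thesis by (auto simp: INF_less_iff R(3))
    qed
    then have "real (order R) ^ 2 + 0.4877 * real (order R) < real (card F)"
      using card_bound[of F] big F R(3) by simp
    then show False using card R(3) by simp
  qed
qed

end
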